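(* Let $0<q<1$, $M\in\mathbb N$, $\vec k=(k_1,\dots,k_M)$ with all $k_j>0$, $v\in\mathbb R\setminus\{0\}$, $\rho\in\mathbb R$. (i) Define $P^v_{\mathrm J}:X_d\times X_d\to\mathbb R$ by $P^v_{\mathrm J}(\eta,\xi)=\lim_{\lambda\to\infty}P^{vq^\lambda}_{\mathrm{AW}}(\eta,\xi)$. Then $P^v_{\mathrm J}$ is a duality function between $\mathrm{ASIP}(q,\vec k)$ and $\mathrm{ASIP}_{\mathsf R}(q,\vec k,\rho)$, and $$P^v_{\mathrm J}(\eta,\xi)=\prod_{j=1}^Mp_{\mathrm J}\big(\eta_j,\xi_j;h^-_{j-1,0}(\eta),h^+_{j+1}(\xi),v,k_j;q\big).$$ (ii) Define $P^v_{\mathrm M}:X_d\times X_d\to\mathbb R$ by $P^v_{\mathrm M}(\eta,\xi)=\lim_{\rho\to-\infty}P^{vq^{-\rho}}_{\mathrm J}(\eta,\xi)$. Then $P^v_{\mathrm M}$ is a self-duality function for $\mathrm{ASIP}(q,\vec k)$, and $$P^v_{\mathrm M}(\eta,\xi)=\prod_{j=1}^Mp_{\mathrm M}\big(\eta_j,\xi_j;h^-_{j-1,0}(\eta),h^+_{j+1,0}(\xi),v,k_j;q\big).$$ (iii) Define $P^v_{\mathrm L}:X_d\times X_d\to\mathbb R$ by $P^v_{\mathrm L}(\eta,\xi)=\lim_{\rho\to\infty}P^{v^{-1}q^{\rho}}_{\mathrm J}(\eta,\xi)$. Then $P^v_{\mathrm L}$ is a duality function between $\mathrm{ASIP}(q,\vec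 k)$ and $\mathrm{ASIP}(q^{-1},\vec k)$, and $$P^v_{\mathrm L}(\eta,\xi)=\prod_{j=1}^Mp_{\mathrm L}\big(\eta_j,\xi_j;h^-_{j-1,0}(\eta),h^+_{j+1,0}(\xi),v,k_j;q\big).$$
   Context: Notation: $X_d=\mathbb Z_{\ge0}^M$; $|\eta|=\sum_j\eta_j$; $[a]_q=\frac{q^a-q^{-a}}{q-q^{-1}}$; $(a;q)_n=\prod_{i=0}^{n-1}(1-aq^i)$; ${}_{r+1}\varphi_r(a_1,\dots,a_{r+1};b_1,\dots,b_r;q,z)=\sum_{n\ge0}\frac{\prod_i(a_i;q)_n}{\prod_i(b_i;q)_n}\frac{z^n}{(q;q)_n}$, a finite sum over $n\le N$ when an upper parameter is $q^{-N}$. $\eta^{j,m}$ is $\eta$ with one particle moved from $j$ to $m$ if $\eta_j\ge1$, else $\eta$. Two processes with generators $L,\widehat L$ on $\Omega,\widehat\Omega$ are dual with duality function $D$ if $[LD(\cdot,\hat\eta)](\eta)=[\widehat LD(\eta,\cdot)](\hat\eta)$ for all $\eta\in\Omega,\hat\eta\in\widehat\Omega$; self-dual if $\widehat L=L$. (In each item the first process acts on $\eta$, the second on $\xi$.) Heights: $h^-_j(\eta)=\lambda+\sum_{i\le j}(2\eta_i+k_i)$ ($h_0^-=\lambda$), $h^+_j(\xi)=\rho+\sum_{i\ge j}(2\xi_i+k_i)$ ($h^+_{M+1}=\rho$), $h^-_{j,0}(\eta)=\sum_{i\le j}(2\eta_i+k_i)$, $h^+_{j,0}(\xi)=\sum_{i\ge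 j}(2\xi_i+k_i)$. $\mathrm{ASIP}(q,\vec k)$ on $X_d$ (for any $q>0,q\neq1$): $$[L^{\mathrm{ASIP}}_{q,\vec k}f](\eta)=\sum_{j=1}^{M-1}c_j^+[f(\eta^{j,j+1})-f(\eta)]+c_{j+1}^-[f(\eta^{j+1,j})-f(\eta)],$$ $c_j^+=q^{\eta_j+k_j-\eta_{j+1}-1}[\eta_j]_q[\eta_{j+1}+k_{j+1}]_q$, $c_j^-=q^{-(\eta_j+k_j-\eta_{j-1}-1)}[\eta_j]_q[\eta_{j-1}+k_{j-1}]_q$. $\mathrm{ASIP}_{\mathsf R}(q,\vec k,\rho)$, on $X_d$ if $\rho>-1$ and on $\{\xi\in X_d:2|\xi|+|\vec k|+\rho<0\}$ if $\rho\le-1$ (the duality in (i) is for $\xi$ in this state space): $$[L^{\mathrm{ASIP}_{\mathsf R}}_{q,\vec k,\rho}f](\xi)=\sum_{j=1}^{M-1}C_j^{\mathsf R,+}[f(\xi^{j,j+1})-f(\xi)]+C_{j+1}^{\mathsf R,-}[f(\xi^{j+1,j})-f(\xi)],$$ $$C_j^{\mathsf R,+}=[\xi_j]_q[\xi_{j+1}+k_{j+1}]_q\frac{[h^+_j-\xi_j]_q[h^+_{j+1}-\xi_{j+1}]_q}{[h^+_{j+1}]_q[h^+_{j+1}+1]_q},\quad C_j^{\mathsf R,-}=[\xi_j]_q[\xi_{j-1}+k_{j-1}]_q\frac{[h^+_j+\xi_{j-1}]_q[h^+_{j+1}+\xi_j]_q}{[h^+_j]_q[h^+_j-1]_q},$$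 with a rate being $0$ when the departing site $j$ is empty and $[h^+_{j+1}-\xi_{j+1}]_q/[h^+_{j+1}]_q$ read as $1$ when $\xi_{j+1}=0$. Askey–Wilson function (depends on $\lambda,\rho$): $P^v_{\mathrm{AW}}(\zeta,\xi)=\prod_{j=1}^Mp_{\mathrm{AW}}(\zeta_j,\xi_j;h^-_{j-1}(\zeta),h^+_{j+1}(\xi),v,k_j;q)$ with $$p_{\mathrm{AW}}(y,x;\lambda,\rho,v,k;q)=(vq^{\rho+\lambda+k+1};q^2)_x(vq^{-\rho-\lambda-k-1};q^{-2})_y\,{}_4\varphi_3\left(\begin{matrix} q^{-2y},q^{2y+2\lambda+2k},q^{-2x},q^{2x+2\rho+2k} \\ q^{2k},vq^{\rho+\lambda+k+1},v^{-1}q^{\rho+\lambda+k+1}\end{matrix};q^2,q^2\right).$$ One-site functions: $$p_{\mathrm J}(n,x;\lambda,\rho,v,k;q)=(vq^{-\lambda-\rho-k-1};q^{-2})_n\,{}_3\varphi_2\left(\begin{matrix} q^{-2x},q^{2x+2\rho+2k},q^{-2n} \\ q^{2k},v^{-1}q^{\rho+\lambda+k+1}\end{matrix};q^2,q^2\right)\ \text{(big $q$-Jacobi)},$$ $$p_{\mathrm M}(n,x;\lambda,\rho,v,k;q)={}_2\varphi_1\left(\begin{matrix} q^{-2x},q^{-2n} \\ q^{2k}\end{matrix};q^2,vq^{2x+\rho-\lambda+k+1}\right)\ \text{($q$-Meixner)},$$ $$p_{\mathrm L}(n,x;\lambda,\rho,v,k;q)=(v^{-1}q^{-\lambda-\rho-k-1};q^{-2})_n\,{}_3\varphi_2\left(\begin{matrix}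 q^{-2x},0,q^{-2n} \\ q^{2k},vq^{\rho+\lambda+k+1}\end{matrix};q^2,q^2\right)\ \text{(big $q$-Laguerre)}.$$ All these products are polynomials in $v$ or $v^{-1}$ and are extended by continuity where a denominator parameter produces a zero. *)

theory Defs
  imports "HOL-Analysis.Analysis"
begin

section \<open>q-numbers and basic hypergeometric series\<close>

definition qnum :: "real \<Rightarrow> real \<Rightarrow> real" where
  "qnum q a = (q powr a - q powr (- a)) / (q - inverse q)"

definition qpoch :: "real \<Rightarrow> real \<Rightarrow> nat \<Rightarrow> real" where
  "qpoch a q n = (\<Prod>i<n. 1 - a * q ^ i)"

text \<open>
  If some upper parameter is \<open>q powr (- N)\<close>, its shifted factorial vanishes for \<open>n > N\<close>. Those terms
  are then 0 even where a lower parameter makes the denominator vanish, because \<open>x / 0 = 0\<close>, so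
  the series is the finite sum over \<open>n \<le> N\<close>.
\<close>

definition qhyp :: "real list \<Rightarrow> real list \<Rightarrow> real \<Rightarrow> real \<Rightarrow> real" where
  "qhyp us ws q z =
     (\<Sum>n. (\<Prod>u\<leftarrow>us. qpoch u q n) / (\<Prod>w\<leftarrow>ws. qpoch w q n) * (z ^ n / qpoch q q n))"

section \<open>Configurations and heights\<close>

text \<open>
  The sites are \<open>1, \<dots>, M\<close>; a configuration is a function \<open>\<eta>\<close> on \<open>{1..M}\<close>, extended by
  \<open>undefined\<close> elsewhere. Only the values \<open>k 1, \<dots>, k M\<close> of the parameter vector \<open>k\<close> matter.
\<close>

type_synonym config = "nat \<Rightarrow> nat"

definition Xd :: "nat \<Rightarrow> config set" where
  "Xd M = {1..M} \<rightarrow>\<^sub>E UNIV"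

text \<open>Used for \<open>j \<noteq> m\<close> only.\<close>

definition move :: "config \<Rightarrow> nat \<Rightarrow> nat \<Rightarrow> config" where
  "move \<eta> j m = (if \<eta> j \<ge> 1 then \<eta>(j := \<eta> j - 1, m := \<eta> m + 1) else \<eta>)"

definition hminus :: "real \<Rightarrow> (nat \<Rightarrow> real) \<Rightarrow> config \<Rightarrow> nat \<Rightarrow> real" where
  "hminus l k \<eta> j = l + (\<Sum>i=1..j. 2 * real (\<eta> i) + k i)"

definition hplus :: "nat \<Rightarrow> real \<Rightarrow> (nat \<Rightarrow> real) \<Rightarrow> config \<Rightarrow> nat \<Rightarrow> real" where
  "hplus M \<rho> k \<xi> j = \<rho> + (\<Sum>i=j..M. 2 * real (\<xi> i) + k i)"

abbreviation hminus0 :: "(nat \<Rightarrow> real) \<Rightarrow> config \<Rightarrow> nat \<Rightarrow> real" where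
  "hminus0 \<equiv> hminus 0"

abbreviation hplus0 :: "nat \<Rightarrow> (nat \<Rightarrow> real) \<Rightarrow> config \<Rightarrow> nat \<Rightarrow> real" where
  "hplus0 M \<equiv> hplus M 0"

section \<open>Generators and duality\<close>

type_synonym generator = "(config \<Rightarrow> real) \<Rightarrow> config \<Rightarrow> real"

definition asip_right_rate :: "real \<Rightarrow> (nat \<Rightarrow> real) \<Rightarrow> config \<Rightarrow> nat \<Rightarrow> real" where
  "asip_right_rate q k \<eta> j =
     q powr (real (\<eta> j) + k j - real (\<eta> (j + 1)) - 1)
       * qnum q (real (\<eta> j)) * qnum q (real (\<eta> (j + 1)) + k (j + 1))"

definition asip_left_rate :: "real \<Rightarrow> (nat \<Rightarrow> real) \<Rightarrow> config \<Rightarrow> nat \<Rightarrow> real" where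
  "asip_left_rate q k \<eta> j =
     q powr (- (real (\<eta> j) + k j - real (\<eta> (j - 1)) - 1))
       * qnum q (real (\<eta> j)) * qnum q (real (\<eta> (j - 1)) + k (j - 1))"

definition ASIP :: "nat \<Rightarrow> real \<Rightarrow> (nat \<Rightarrow> real) \<Rightarrow> generator" where
  "ASIP M q k f \<eta> =
     (\<Sum>j=1..<M. asip_right_rate q k \<eta> j * (f (move \<eta> j (j + 1)) - f \<eta>)
                + asip_left_rate q k \<eta> (j + 1) * (f (move \<eta> (j + 1) j) - f \<eta>))"

definition ASIP_R_space :: "nat \<Rightarrow> (nat \<Rightarrow> real) \<Rightarrow> real \<Rightarrow> config set" where
  "ASIP_R_space M k \<rho> =
     (if \<rho> > -1 then Xd M
      else {\<xi> \<in> Xd M. 2 * real (\<Sum>j=1..M. \<xi> j) + (\<Sum>j=1..M. k j) + \<rho> < 0})"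

definition asipR_right_rate ::
  "nat \<Rightarrow> real \<Rightarrow> (nat \<Rightarrow> real) \<Rightarrow> real \<Rightarrow> config \<Rightarrow> nat \<Rightarrow> real" where
  "asipR_right_rate M q k \<rho> \<xi> j =
     (let h = hplus M \<rho> k \<xi> in
      if \<xi> j = 0 then 0
      else qnum q (real (\<xi> j)) * qnum q (real (\<xi> (j + 1)) + k (j + 1))
        * (qnum q (h j - real (\<xi> j)) / qnum q (h (j + 1) + 1))
        * (if \<xi> (j + 1) = 0 then 1
           else qnum q (h (j + 1) - real (\<xi> (j + 1))) / qnum q (h (j + 1))))"

definition asipR_left_rate ::
  "nat \<Rightarrow> real \<Rightarrow> (nat \<Rightarrow> real) \<Rightarrow> real \<Rightarrow> config \<Rightarrow> nat \<Rightarrow> real" where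
  "asipR_left_rate M q k \<rho> \<xi> j =
     (let h = hplus M \<rho> k \<xi> in
      if \<xi> j = 0 then 0
      else qnum q (real (\<xi> j)) * qnum q (real (\<xi> (j - 1)) + k (j - 1))
        * (qnum q (h j + real (\<xi> (j - 1))) * qnum q (h (j + 1) + real (\<xi> j)))
        / (qnum q (h j) * qnum q (h j - 1)))"

definition ASIP_R :: "nat \<Rightarrow> real \<Rightarrow> (nat \<Rightarrow> real) \<Rightarrow> real \<Rightarrow> generator" where
  "ASIP_R M q k \<rho> f \<xi> =
     (\<Sum>j=1..<M. asipR_right_rate M q k \<rho> \<xi> j * (f (move \<xi> j (j + 1)) - f \<xi>)
                + asipR_left_rate M q k \<rho> \<xi> (j + 1) * (f (move \<xi> (j + 1) j) - f \<xi>))"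

definition duality_function ::
  "config set \<Rightarrow> generator \<Rightarrow> config set \<Rightarrow> generator \<Rightarrow> (config \<Rightarrow> config \<Rightarrow> real) \<Rightarrow> bool" where
  "duality_function \<Omega> L \<Omega>' L' D \<longleftrightarrow>
     (\<forall>\<eta>\<in>\<Omega>. \<forall>\<xi>\<in>\<Omega>'. L (\<lambda>\<eta>'. D \<eta>' \<xi>) \<eta> = L' (\<lambda>\<xi>'. D \<eta> \<xi>') \<xi>)"

abbreviation self_duality_function ::
  "config set \<Rightarrow> generator \<Rightarrow> (config \<Rightarrow> config \<Rightarrow> real) \<Rightarrow> bool" where
  "self_duality_function \<Omega> L \<equiv> duality_function \<Omega> L \<Omega> L"

section \<open>One-site functions\<close>

text \<open>
  Continuous extension in the parameter \<open>v\<close>. Where no lower parameter of the series produces a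
  zero, the formula is continuous in \<open>v\<close> (for \<open>v \<noteq> 0\<close>), so this is just its value there.
\<close>

definition cont_ext :: "(real \<Rightarrow> real) \<Rightarrow> real \<Rightarrow> real" where
  "cont_ext f v = Lim (at v) f"

definition p_AW ::
  "nat \<Rightarrow> nat \<Rightarrow> real \<Rightarrow> real \<Rightarrow> real \<Rightarrow> real \<Rightarrow> real \<Rightarrow> real" where
  "p_AW y x l \<rho> v k q =
     cont_ext (\<lambda>v. qpoch (v * q powr (\<rho> + l + k + 1)) (q powi 2) x
       * qpoch (v * q powr (- \<rho> - l - k - 1)) (q powi (-2)) y
       * qhyp [q powr (- 2 * real y), q powr (2 * real y + 2 * l + 2 * k),
               q powr (- 2 * real x), q powr (2 * real x + 2 * \<rho> + 2 * k)]
              [q powr (2 * k), v * q powr (\<rho> + l + k + 1), inverse v * q powr (\<rho> + l + k + 1)]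
              (q powi 2) (q powi 2)) v"

definition p_J ::
  "nat \<Rightarrow> nat \<Rightarrow> real \<Rightarrow> real \<Rightarrow> real \<Rightarrow> real \<Rightarrow> real \<Rightarrow> real" where
  "p_J n x l \<rho> v k q =
     cont_ext (\<lambda>v. qpoch (v * q powr (- l - \<rho> - k - 1)) (q powi (-2)) n
       * qhyp [q powr (- 2 * real x), q powr (2 * real x + 2 * \<rho> + 2 * k), q powr (- 2 * real n)]
              [q powr (2 * k), inverse v * q powr (\<rho> + l + k + 1)]
              (q powi 2) (q powi 2)) v"

definition p_M ::
  "nat \<Rightarrow> nat \<Rightarrow> real \<Rightarrow> real \<Rightarrow> real \<Rightarrow> real \<Rightarrow> real \<Rightarrow> real" where
  "p_M n x l \<rho> v k q =
     qhyp [q powr (- 2 * real x), q powr (- 2 * real n)] [q powr (2 * k)]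
          (q powi 2) (v * q powr (2 * real x + \<rho> - l + k + 1))"

definition p_L ::
  "nat \<Rightarrow> nat \<Rightarrow> real \<Rightarrow> real \<Rightarrow> real \<Rightarrow> real \<Rightarrow> real \<Rightarrow> real" where
  "p_L n x l \<rho> v k q =
     cont_ext (\<lambda>v. qpoch (inverse v * q powr (- l - \<rho> - k - 1)) (q powi (-2)) n
       * qhyp [q powr (- 2 * real x), 0, q powr (- 2 * real n)]
              [q powr (2 * k), v * q powr (\<rho> + l + k + 1)]
              (q powi 2) (q powi 2)) v"

section \<open>The Askey--Wilson function and its limits\<close>

definition P_AW ::
  "nat \<Rightarrow> real \<Rightarrow> (nat \<Rightarrow> real) \<Rightarrow> real \<Rightarrow> real \<Rightarrow> real \<Rightarrow> config \<Rightarrow> config \<Rightarrow> real" where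
  "P_AW M q k l \<rho> v \<zeta> \<xi> =
     (\<Prod>j=1..M. p_AW (\<zeta> j) (\<xi> j) (hminus l k \<zeta> (j - 1)) (hplus M \<rho> k \<xi> (j + 1)) v (k j) q)"

definition P_J ::
  "nat \<Rightarrow> real \<Rightarrow> (nat \<Rightarrow> real) \<Rightarrow> real \<Rightarrow> real \<Rightarrow> config \<Rightarrow> config \<Rightarrow> real" where
  "P_J M q k \<rho> v \<eta> \<xi> = Lim at_top (\<lambda>l. P_AW M q k l \<rho> (v * q powr l) \<eta> \<xi>)"

definition P_M :: "nat \<Rightarrow> real \<Rightarrow> (nat \<Rightarrow> real) \<Rightarrow> real \<Rightarrow> config \<Rightarrow> config \<Rightarrow> real" where
  "P_M M q k v \<eta> \<xi> = Lim at_bot (\<lambda>\<rho>. P_J M q k \<rho> (v * q powr (- \<rho>)) \<eta> \<xi>)"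

definition P_L :: "nat \<Rightarrow> real \<Rightarrow> (nat \<Rightarrow> real) \<Rightarrow> real \<Rightarrow> config \<Rightarrow> config \<Rightarrow> real" where
  "P_L M q k v \<eta> \<xi> = Lim at_top (\<lambda>\<rho>. P_J M q k \<rho> (inverse v * q powr \<rho>) \<eta> \<xi>)"

end

theory Submission
  imports Defs
begin

text \<open>
  With \<open>p = q\<^sup>2\<close>, the continuous extension of the big \<open>q\<close>-Jacobi function is a polynomial in
  \<open>w\<close>, a multiple of \<open>v\<close>: each ratio \<open>(w; 1/p)\<^sub>n / (1/w; p)\<^sub>i\<close> is one. Hence the three limits may be
  taken term by term. A jump over a bond leaves the heights at all other sites unchanged, so the
  duality in (i) reduces to two sites. There the factor of the right site satisfies first-order
  relations between the jumps of \<open>\<eta>\<close> and the jumps of \<open>\<xi>\<close>, and so does the factor of the left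
  site; all of them follow by telescoping a single sum. Eliminating between them gives the two-site
  identity for generic parameters. The exceptional values of the right boundary height (zeros of a
  lower parameter or of a denominator of a rate) form a countable set, so continuity in that height
  covers the whole state space. Dualities (ii) and (iii) are limits of (i): as \<open>\<rho>\<close> tends to minus
  or plus infinity, the rates of \<open>ASIP_R\<close> tend to those of ASIP with parameter \<open>q\<close> or \<open>1/q\<close>.
\<close>

subsection \<open>Terminating basic hypergeometric sums\<close>

text \<open>The obstacle is that the heights couple the two sites of a bond. A jump of \<eta>
  changes both degrees and also the argument w of the right factor; a jump of \<xi> changes the
  parameters A and B of both factors and the argument of the left one. So degree, A, B and w have to
  move together in the relations. At the left site all four shifts lie in the span of the functions
  of degree n and n - 1; at the right site two auxiliary sums join the function itself. The
  multipliers that such a relation leaves uncancelled, such as (1 - A) (1 - B) or 1 - 1/(p^n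
  \<kappa>), are factors of the jump rates, so the elimination never divides by them. With \<theta>
  = B / A = q^(2 h), where h is the height of \<xi> at the right site, the remaining denominators A
  - B, A - p B and B - p A are, up to powers of q, the numbers [h], [h + 1] and [h - 1] in the rates
  of \<open>ASIP_R\<close>.\<close>

lemma qpoch_0 [simp]: "qpoch a q 0 = 1"
  by (simp add: qpoch_def)

lemma qpoch_Suc: "qpoch a q (Suc n) = qpoch a q n * (1 - a * q ^ n)"
  by (simp add: qpoch_def)

lemma qpoch_Suc_shift: "qpoch a q (Suc n) = (1 - a) * qpoch (a * q) q n"
  by (simp add: qpoch_def prod.lessThan_Suc_shift mult.assoc del: prod.lessThan_Suc)

lemma qpoch_eq_0_iff: "qpoch a q n = 0 \<longleftrightarrow> (\<exists>i<n. a * q ^ i = 1)"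
  by (auto simp: qpoch_def)

lemma qpoch_inverse_power_eq_0:
  assumes "p \<noteq> 0" "n < j"
  shows "qpoch (1 / p ^ n) p j = 0"
  using assms by (auto simp: qpoch_eq_0_iff)

text \<open>Here d is a telescoping certificate. Every certificate below contains a shifted
  factorial with base point 1/p^n, which kills it beyond the summation range, and vanishes at 0
  through a factor 1 - p^j or by definition.\<close>

lemma sum_telescope_eq:
  fixes f g :: "nat \<Rightarrow> real"
  assumes "\<And>j. j \<le> n \<Longrightarrow> f j - g j = d (Suc j) - d j" and "d 0 = 0" "d (Suc n) = 0"
  shows "(\<Sum>j\<le>n. f j) = (\<Sum>j\<le>n. g j)"
proof -
  have "(\<Sum>j\<le>n. f j) - (\<Sum>j\<le>n. g j) = (\<Sum>j\<le>n. d (Suc j) - d j)"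
    using assms(1) by (simp flip: sum_subtractf)
  also have "\<dots> = d (Suc n) - d 0"
    by (simp add: sum_telescope'' lessThan_Suc_atMost [symmetric] sum_lessThan_telescope)
  finally show ?thesis using assms by simp
qed

text \<open>Excludes 0 and all integer powers of p; two natural exponents stand for one integer
  exponent of either sign. The condition is stable under multiplying or dividing w by p, so shifted
  sums have no vanishing denominators either.\<close>

definition generic :: "real \<Rightarrow> real \<Rightarrow> bool" where
  "generic p w \<longleftrightarrow> w \<noteq> 0 \<and> (\<forall>m j. w * p ^ m \<noteq> p ^ j)"

definition jcoef :: "real \<Rightarrow> real \<Rightarrow> real \<Rightarrow> real \<Rightarrow> real \<Rightarrow> nat \<Rightarrow> real" where
  "jcoef p \<kappa> A B w j =
     qpoch A p j * qpoch B p j * p ^ j / (qpoch p p j * qpoch \<kappa> p j * qpoch (1 / w) p j)"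

text \<open>The terminating 3phi2 series with upper parameters A, B, p^(-n), lower parameters
  \<kappa>, 1/w and argument p. The factor with n is kept out of \<open>jcoef\<close>, so that sums
  of different degree can be compared term by term.\<close>

definition jsum :: "real \<Rightarrow> real \<Rightarrow> nat \<Rightarrow> real \<Rightarrow> real \<Rightarrow> real \<Rightarrow> real" where
  "jsum p \<kappa> n A B w = (\<Sum>j\<le>n. jcoef p \<kappa> A B w j * qpoch (1 / p ^ n) p j)"

lemma jsum_extend:
  assumes "p \<noteq> 0" "n \<le> m"
  shows "jsum p \<kappa> n A B w = (\<Sum>j\<le>m. jcoef p \<kappa> A B w j * qpoch (1 / p ^ n) p j)"
  unfolding jsum_def using assms
  by (intro sum.mono_neutral_left) (auto simp: qpoch_inverse_power_eq_0)

lemma jsum_commute: "jsum p \<kappa> n A B w = jsum p \<kappa> n B A w"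
  by (simp add: jsum_def jcoef_def mult.commute mult.left_commute)

text \<open>
  All parameter shifts at the right site are linear combinations of the sum itself,
  \<open>\<Sum>j. jcoefK j\<close> and \<open>\<Sum>j. jcoefK j * p ^ j\<close>, which makes the elimination below possible.
\<close>

definition jcoefK :: "real \<Rightarrow> real \<Rightarrow> real \<Rightarrow> real \<Rightarrow> real \<Rightarrow> nat \<Rightarrow> nat \<Rightarrow> real" where
  "jcoefK p \<kappa> A B w n j =
     jcoef p \<kappa> A B w j * qpoch (1 / p ^ n) p (Suc j) / ((1 - \<kappa> * p ^ j) * (1 - p ^ j / w))"

context
  fixes p \<kappa> w :: real
  assumes p: "0 < p" "p < 1" and \<kappa>: "0 < \<kappa>" "\<kappa> < 1" and w: "generic p w"
begin

lemma generic_nonzero [simp]: "p \<noteq> 0" "\<kappa> \<noteq> 0" "w \<noteq> 0" "p ^ j \<noteq> 0" "1 - \<kappa> * p ^ j \<noteq> 0" "1 - p ^ j / w \<noteq> 0"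
    "1 - p * p ^ j \<noteq> 0" "\<kappa> * p ^ j \<noteq> 1" "p * p ^ j \<noteq> 1" "w \<noteq> p ^ j" "p ^ j \<noteq> w"
proof -
  show "p \<noteq> 0" "\<kappa> \<noteq> 0" "p ^ j \<noteq> 0" using p \<kappa> by auto
  show "w \<noteq> 0" using w by (simp add: generic_def)
  have "p ^ j \<le> 1" using p by (simp add: power_le_one)
  then have "\<kappa> * p ^ j < 1" using p \<kappa> by (smt (verit) mult_less_cancel_right2 zero_less_power)
  then show "1 - \<kappa> * p ^ j \<noteq> 0" "\<kappa> * p ^ j \<noteq> 1" by simp_all
  have "p * p ^ j < 1" using p \<open>p ^ j \<le> 1\<close> by (smt (verit) mult_less_cancel_right2 zero_less_power)
  then show "1 - p * p ^ j \<noteq> 0" "p * p ^ j \<noteq> 1" by simp_all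
  show "w \<noteq> p ^ j" "p ^ j \<noteq> w"
    using w unfolding generic_def by (metis mult.right_neutral power_0)+
  then show "1 - p ^ j / w \<noteq> 0"
    by auto
qed

lemma jcoef_Suc:
  "jcoef p \<kappa> A B w (Suc j) = jcoef p \<kappa> A B w j * p * (1 - A * p ^ j) * (1 - B * p ^ j)
     / ((1 - p * p ^ j) * (1 - \<kappa> * p ^ j) * (1 - p ^ j / w))"
  by (simp add: jcoef_def qpoch_Suc mult_ac)

text \<open>U is the coefficient divided by all denominators of its successor ratio. Once the terms
  at j and j + 1 are written through U, a telescoping claim becomes an elementary identity in p^j,
  1/p^n and 1/w.\<close>

lemma jcoef_step:
  obtains U where "jcoef p \<kappa> A B w j = U * ((1 - p * p ^ j) * (1 - \<kappa> * p ^ j) * (1 - p ^ j / w))"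
    "jcoef p \<kappa> A B w (Suc j) = U * (p * (1 - A * p ^ j) * (1 - B * p ^ j))"
    "\<And>n. jcoefK p \<kappa> A B w n j = U * ((1 - p * p ^ j) * qpoch (1 / p ^ n) p (Suc j))"
proof -
  define D where "D = (1 - p * p ^ j) * (1 - \<kappa> * p ^ j) * (1 - p ^ j / w)"
  define U where "U = jcoef p \<kappa> A B w j / D"
  have D: "D \<noteq> 0" using generic_nonzero unfolding D_def by simp
  have 1: "jcoef p \<kappa> A B w j = U * D" using D by (simp add: U_def)
  have 2: "jcoef p \<kappa> A B w (Suc j) = U * (p * (1 - A * p ^ j) * (1 - B * p ^ j))"
    unfolding jcoef_Suc U_def D_def by simp
  have "jcoefK p \<kappa> A B w n j = U * ((1 - p * p ^ j) * qpoch (1 / p ^ n) p (Suc j))" for n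
    unfolding jcoefK_def 1 unfolding D_def by simp
  from that [OF 1 [unfolded D_def] 2 this] show ?thesis .
qed

section \<open>Contiguous relations for the right site\<close>

lemma jsum_shift_up:
  "(1 - B) * (jsum p \<kappa> n (A / p) (p * B) w - jsum p \<kappa> n A B w)
     = - (A - p * B) * (\<Sum>j\<le>n. jcoefK p \<kappa> A B w n j * (1 - B * p ^ j))"
proof -
  define u where "u = jcoef p \<kappa> A B w"
  define e where "e = qpoch (1 / p ^ n) p"
  \<comment> \<open>The certificate is the difference of the two summands itself: by fact 2 below,
    its value at i + 1 is the right-hand term at i, so the telescoping is a mere index
    shift.\<close>
  define d where "d = (\<lambda>j. case j of 0 \<Rightarrow> 0 | Suc i \<Rightarrow>
      (1 - B) * (jcoef p \<kappa> (A/p) (p * B) w (Suc i) - u (Suc i)) * e (Suc i))"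
  \<comment> \<open>The factor 1 - B turns (p B; p)_j into (B; p)_j (1 - B p^j), and (A/p; p)_(i+1)
    is (1 - A/p) (A; p)_i. Hence the shifted coefficient at i + 1 is a multiple of the unshifted one
    at i, without division by 1 - B.\<close>
  have 1: "(1 - B) * jcoef p \<kappa> (A / p) (p * B) w (Suc i)
      = u i * p * (1 - A / p) * (1 - B * p ^ i) * (1 - B * p * p ^ i)
         / ((1 - p * p ^ i) * (1 - \<kappa> * p ^ i) * (1 - p ^ i / w))" for i
  proof -
    have "(1 - B) * qpoch (p * B) p (Suc i) = qpoch B p (Suc i) * (1 - B * p ^ Suc i)"
      by (metis mult.commute qpoch_Suc qpoch_Suc_shift)
    then have "(1 - B) * qpoch (p * B) p (Suc i) = qpoch B p i * (1 - B * p ^ i) * (1 - B * p * p ^ i)"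
      by (simp only: qpoch_Suc power_Suc mult.assoc)
    moreover have "qpoch (A / p) p (Suc i) = (1 - A / p) * qpoch A p i"
      by (simp add: qpoch_Suc_shift)
    moreover have "(1 - B) * jcoef p \<kappa> (A / p) (p * B) w (Suc i) = qpoch (A / p) p (Suc i)
        * ((1 - B) * qpoch (p * B) p (Suc i)) * p ^ Suc i
        / (qpoch p p (Suc i) * qpoch \<kappa> p (Suc i) * qpoch (1 / w) p (Suc i))"
      by (simp only: jcoef_def mult_ac times_divide_eq_right)
    ultimately have "(1 - B) * jcoef p \<kappa> (A / p) (p * B) w (Suc i) =
        ((1 - A / p) * qpoch A p i) * (qpoch B p i * (1 - B * p ^ i) * (1 - B * p * p ^ i)) * p ^ Suc i
        / (qpoch p p (Suc i) * qpoch \<kappa> p (Suc i) * qpoch (1 / w) p (Suc i))"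
      by (simp only:)
    then show ?thesis by (simp add: u_def jcoef_def qpoch_Suc mult_ac)
  qed
  have 2: "(1 - B) * (jcoef p \<kappa> (A / p) (p * B) w (Suc i) - u (Suc i)) * e (Suc i)
      = - (A - p * B) * (jcoefK p \<kappa> A B w n i * (1 - B * p ^ i))" for i
  proof -
    define x where "x = p ^ i"
    define v where "v = 1 / w"
    obtain U where U: "u i = U * ((1 - p * x) * (1 - \<kappa> * x) * (1 - x * v))"
      "u (Suc i) = U * (p * (1 - A * x) * (1 - B * x))"
      "jcoefK p \<kappa> A B w n i = U * ((1 - p * x) * e (Suc i))"
      using jcoef_step [of A B i] unfolding u_def e_def x_def v_def by auto
    have "1 - p * x \<noteq> 0" "1 - \<kappa> * x \<noteq> 0" "1 - x * v \<noteq> 0"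
      using generic_nonzero(4-7) [of i] unfolding x_def v_def by simp_all
    moreover have "(1 - B) * jcoef p \<kappa> (A / p) (p * B) w (Suc i)
      = u i * p * (1 - A / p) * (1 - B * x) * (1 - B * p * x)
         / ((1 - p * x) * (1 - \<kappa> * x) * (1 - x * v))"
      unfolding 1 x_def v_def by simp
    ultimately have 3: "(1 - B) * jcoef p \<kappa> (A / p) (p * B) w (Suc i) = U * (p * (1 - A / p) * (1 - B * x) * (1 - B * p * x))"
      unfolding U(1) by simp
    have "(1 - B) * (jcoef p \<kappa> (A / p) (p * B) w (Suc i) - u (Suc i)) * e (Suc i)
        = ((1 - B) * jcoef p \<kappa> (A / p) (p * B) w (Suc i) - (1 - B) * u (Suc i)) * e (Suc i)"
      by (simp only: right_diff_distrib)
    also have "\<dots> = - (A - p * B) * (jcoefK p \<kappa> A B w n i * (1 - B * p ^ i))"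
      unfolding 3 unfolding U x_def [symmetric] by (simp add: field_simps)
    finally show ?thesis .
  qed
  have "(\<Sum>j\<le>n. (1 - B) * (jcoef p \<kappa> (A / p) (p * B) w j - u j) * e j)
      = (\<Sum>j\<le>n. - (A - p * B) * (jcoefK p \<kappa> A B w n j * (1 - B * p ^ j)))"
  proof (rule sum_telescope_eq)
    show "(1 - B) * (jcoef p \<kappa> (A / p) (p * B) w j - u j) * e j - - (A - p * B) * (jcoefK p \<kappa> A B w n j * (1 - B * p ^ j))
        = - d (Suc j) - - d j" for j
      unfolding 2 [symmetric] by (cases j) (simp_all add: d_def u_def jcoef_def)
    show "- d 0 = 0" "- d (Suc n) = 0" by (auto simp: d_def e_def qpoch_inverse_power_eq_0)
  qed
  then show ?thesis
    by (simp only: jsum_def u_def e_def sum_distrib_left [symmetric] sum_subtractf left_diff_distrib right_diff_distrib mult.assoc)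
qed

text \<open>Telescopes the summand times p^(-j) - 1. Removing the two sums on the right by means of
  the two shifts of (A, B) would give the three-term recurrence of the big q-Jacobi polynomials,
  with degree x for A = p^(-x) and argument p^(-n). In the two-site identity it serves to eliminate
  p^(-n).\<close>

lemma jsum_recurrence:
  "(1 / p ^ n - 1) * jsum p \<kappa> n A B w
     = (\<Sum>j\<le>n. jcoefK p \<kappa> A B w n j * ((\<kappa> - A - B + 1 / w) + (A * B - \<kappa> / w) * p ^ j))"
proof -
  define u where "u = jcoef p \<kappa> A B w"
  define e where "e = qpoch (1 / p ^ n) p"
  have "(\<Sum>j\<le>n. (1 / p ^ n - 1) * (u j * e j))
      = (\<Sum>j\<le>n. jcoefK p \<kappa> A B w n j * ((\<kappa> - A - B + 1 / w) + (A * B - \<kappa> / w) * p ^ j))"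
  proof (rule sum_telescope_eq [where d = "\<lambda>j. - (u j * e j * (1 - p ^ j) / p ^ j)"])
    fix j
    define x where "x = p ^ j"
    define y where "y = 1 / p ^ n"
    define v where "v = 1 / w"
    obtain U where U: "u j = U * ((1 - p * x) * (1 - \<kappa> * x) * (1 - x * v))"
      "u (Suc j) = U * (p * (1 - A * x) * (1 - B * x))"
      "jcoefK p \<kappa> A B w n j = U * ((1 - p * x) * e (Suc j))"
      using jcoef_step [of A B j] unfolding u_def e_def x_def v_def by auto
    have e: "e (Suc j) = e j * (1 - x * y)" by (simp add: e_def qpoch_Suc x_def y_def)
    have "x \<noteq> 0" by (simp add: x_def)
    then show "(1 / p ^ n - 1) * (u j * e j) -
         jcoefK p \<kappa> A B w n j * (\<kappa> - A - B + 1 / w + (A * B - \<kappa> / w) * p ^ j) =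
         - (u (Suc j) * e (Suc j) * (1 - p ^ Suc j) / p ^ Suc j) - - (u j * e j * (1 - p ^ j) / p ^ j)"
      unfolding power_Suc divide_inverse [of \<kappa>] inverse_eq_divide
        x_def [symmetric] y_def [symmetric] v_def [symmetric] U e
      by (simp add: divide_simps) (simp add: algebra_simps)
  qed (auto simp: e_def qpoch_inverse_power_eq_0)
  then show ?thesis by (simp add: jsum_def sum_distrib_left u_def e_def)
qed

lemma qpoch_inverse_power_Suc_shift:
  "qpoch (1 / p ^ Suc n) p (Suc j) = (1 - 1 / p ^ Suc n) * qpoch (1 / p ^ n) p j"
  by (simp add: qpoch_Suc_shift)

text \<open>No telescoping is involved: (p/w; p)_j and (p^(-n); p)_j arise from (1/w; p)_(j+1) and
  (p^(-n-1); p)_(j+1) by splitting off the first factor. This is the right site losing a particle to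
  the left site, whose larger occupation divides w by p.\<close>

lemma jsum_lower:
  "(1 - 1 / p ^ Suc n) * jsum p \<kappa> n A B (w / p)
     = (1 - 1 / w) * (\<Sum>j\<le>Suc n. jcoefK p \<kappa> A B w (Suc n) j * (1 - \<kappa> * p ^ j))"
proof -
  have w1: "1 - 1 / w \<noteq> 0" using generic_nonzero(6) [of 0] by simp
  have "(1 - 1 / p ^ Suc n) * (jcoef p \<kappa> A B (w / p) j * qpoch (1 / p ^ n) p j)
     = (1 - 1 / w) * (jcoefK p \<kappa> A B w (Suc n) j * (1 - \<kappa> * p ^ j))" for j
  proof -
    have "qpoch (1 / w) p j * (1 - p ^ j / w) = (1 - 1 / w) * qpoch (1 / (w / p)) p j"
      using qpoch_Suc [of "1/w" p j] qpoch_Suc_shift [of "1 / w" p j] by simp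
    then have "jcoef p \<kappa> A B (w / p) j = (1 - 1 / w) * (jcoef p \<kappa> A B w j / (1 - p ^ j / w))"
      unfolding jcoef_def divide_divide_eq_left mult.assoc using w1 by simp
    moreover have "1 - \<kappa> * p ^ j \<noteq> 0" by simp
    ultimately show ?thesis
      unfolding jcoefK_def qpoch_inverse_power_Suc_shift by (simp only: nonzero_mult_div_cancel_left) simp
  qed
  moreover have "jcoefK p \<kappa> A B w (Suc n) (Suc n) = 0"
    by (simp add: jcoefK_def qpoch_inverse_power_eq_0 del: power_Suc)
  ultimately show ?thesis
    by (simp add: jsum_def sum_distrib_left del: power_Suc)
qed

lemma jcoef_wp:
  "(1 - 1 / (w * p)) * jcoef p \<kappa> A B (w * p) j = jcoef p \<kappa> A B w j * (1 - p ^ j / (w * p))"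
proof -
  have w1: "1 - p ^ j / (w * p) \<noteq> 0" for j
    using w unfolding generic_def by (metis eq_iff_diff_eq_0 divide_eq_1_iff power_one_right)
  define a where "a = 1 - p ^ j / (w * p)"
  define b where "b = 1 - 1 / (w * p)"
  have ab: "a \<noteq> 0" "b \<noteq> 0" using w1 [of j] w1 [of 0] unfolding a_def b_def power_0 by blast+
  have "qpoch (1 / (w * p)) p j * a = b * qpoch (1 / w) p j"
    using qpoch_Suc [of "1/(w*p)" p j] qpoch_Suc_shift [of "1 / (w*p)" p j] by (simp add: a_def b_def)
  then have "qpoch (1 / w) p j = qpoch (1 / (w * p)) p j * a / b"
    using ab by (simp add: field_simps)
  then show ?thesis
    unfolding jcoef_def a_def [symmetric] b_def [symmetric] using ab by (simp add: mult_ac)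
qed

text \<open>The right site gains a particle from the left one, so w is multiplied by p. The
  telescoping leaves the denominators 1 - \<kappa> p^j, which \<open>jsum_raise_coefficients\<close>
  removes.\<close>

lemma jsum_raise:
  "(1 - 1 / (w * p)) * jsum p \<kappa> (Suc n) A B (w * p) = - 1 / (w * p) * (jsum p \<kappa> n A B w
     + w * p * (\<Sum>j\<le>n. jcoef p \<kappa> A B w j * qpoch (1 / p ^ n) p j
                    * (\<kappa> - A - B + A * B * p ^ j) / (1 - \<kappa> * p ^ j)))"
proof -
  define u where "u = jcoef p \<kappa> A B w"
  define e where "e = qpoch (1 / p ^ n) p"
  define e' where "e' = qpoch (1 / p ^ Suc n) p"
  define y where "y = 1 / p ^ n"
  define s where "s = (\<lambda>x. \<kappa> - A - B + A * B * x)"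
  define d where "d = (\<lambda>j. case j of 0 \<Rightarrow> 0 | Suc i \<Rightarrow>
    - w * u i * p * (1 - A * p ^ i) * (1 - B * p ^ i) / ((1 - \<kappa> * p ^ i) * p ^ i) * e i)"
  have e'_Suc: "e' (Suc i) = (1 - y / p) * e i" for i
    by (simp add: e'_def e_def qpoch_Suc_shift y_def)
  have "(\<Sum>j\<le>Suc n. u j * (p ^ j - w * p) * e' j)
    = (\<Sum>j\<le>Suc n. u j * e j * (1 + w * p * s (p ^ j) / (1 - \<kappa> * p ^ j)))"
  proof (rule sum_telescope_eq)
    fix j
    define x where "x = p ^ j"
    have x: "x \<noteq> 0" "1 - \<kappa> * x \<noteq> 0" using generic_nonzero(4-7) [of j] by (simp_all add: x_def)
    \<comment> \<open>Both summands are compared with u j * e j * (x - w * p) / x: the left one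
      differs from it by d j, the right one by d (Suc j).\<close>
    have "u j * (x - w * p) * e' j = u j * e j * (x - w * p) / x - d j"
    proof (cases j)
      case 0
      then show ?thesis by (simp add: d_def e_def e'_def x_def)
    next
      case (Suc i)
      define z where "z = p ^ i"
      define v where "v = 1 / w"
      obtain U where U: "u i = U * ((1 - p * z) * (1 - \<kappa> * z) * (1 - z * v))"
        "u (Suc i) = U * (p * (1 - A * z) * (1 - B * z))"
        using jcoef_step [of A B i] unfolding u_def z_def v_def by auto
      have wv: "w = 1 / v" "v \<noteq> 0" by (simp_all add: v_def)
      have z: "z \<noteq> 0" "1 - \<kappa> * z \<noteq> 0" using generic_nonzero(4-7) [of i] by (simp_all add: z_def)
      have e: "e (Suc i) = e i * (1 - z * y)" by (simp add: e_def qpoch_Suc z_def y_def)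
      have "x = p * z" by (simp add: x_def Suc z_def)
      have d: "d j = - w * U * (1 - p * z) * (1 - z * v) * p * (1 - A * z) * (1 - B * z) / z * e i"
        unfolding Suc d_def nat.case z_def [symmetric] U using z by simp
      show ?thesis
        unfolding d unfolding Suc e'_Suc e U \<open>x = p * z\<close> wv(1) using wv(2) z
        by (simp add: divide_simps) (simp add: algebra_simps)
    qed
    moreover have "u j * e j * (1 + w * p * s x / (1 - \<kappa> * x)) = u j * e j * (x - w * p) / x - d (Suc j)"
      unfolding d_def nat.case x_def [symmetric] s_def using x
      by (simp add: divide_simps) (simp add: algebra_simps)
    ultimately show "u j * (p ^ j - w * p) * e' j - u j * e j * (1 + w * p * s (p ^ j) / (1 - \<kappa> * p ^ j))
      = d (Suc j) - d j"
      unfolding x_def by simp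
  qed (auto simp: d_def e_def qpoch_inverse_power_eq_0)
  also have "\<dots> = (\<Sum>j\<le>n. u j * e j) + w * p * (\<Sum>j\<le>n. u j * e j * s (p ^ j) / (1 - \<kappa> * p ^ j))"
    by (simp add: e_def qpoch_inverse_power_eq_0 sum_distrib_left distrib_left sum.distrib mult_ac)
  finally have 1: "(\<Sum>j\<le>Suc n. u j * (p ^ j - w * p) * e' j) = \<dots>" .
  have 2: "(1 - 1 / (w * p)) * jcoef p \<kappa> A B (w * p) j * e' j = - 1 / (w * p) * (u j * (p ^ j - w * p) * e' j)" for j
    unfolding jcoef_wp u_def by (simp add: field_simps)
  have "(1 - 1 / (w * p)) * jsum p \<kappa> (Suc n) A B (w * p) = - 1 / (w * p) * (\<Sum>j\<le>Suc n. u j * (p ^ j - w * p) * e' j)"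
    unfolding jsum_def sum_distrib_left e'_def [symmetric]
    by (rule sum.cong [OF refl]) (use 2 in \<open>simp only: mult.assoc\<close>)
  then show ?thesis unfolding 1 by (simp only: u_def e_def s_def jsum_def)
qed

text \<open>The multiplier 1 - 1/(p^n \<kappa>) is the value at the pole x = 1/\<kappa> of 1 -
  x/p^n, the factor by which (p^(-n); p)_j grows with x = p^j. The two differ by a multiple of 1 -
  \<kappa> x, so multiplying by it trades the poles for \<open>jcoefK\<close>.\<close>

lemma jsum_raise_coefficients:
  "(1 - 1 / (p ^ n * \<kappa>)) * (\<Sum>j\<le>n. jcoef p \<kappa> A B w j * qpoch (1 / p ^ n) p j
          * (\<kappa> - A - B + A * B * p ^ j) / (1 - \<kappa> * p ^ j))
   = (\<Sum>j\<le>n. jcoefK p \<kappa> A B w n j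
        * ((\<kappa> - A - B) * (A + B - 1 / w - A * B * p ^ j) + A * B * (1 - p ^ j / w))) / \<kappa>
     - (\<kappa> - A - B + A * B) / \<kappa> * jsum p \<kappa> n A B w"
proof -
  define u where "u = jcoef p \<kappa> A B w"
  define e where "e = qpoch (1 / p ^ n) p"
  define y where "y = 1 / p ^ n"
  define v where "v = 1 / w"
  have "(\<Sum>j\<le>n. (1 - y / \<kappa>) * (u j * e j * (\<kappa> - A - B + A * B * p ^ j) / (1 - \<kappa> * p ^ j)))
    = (\<Sum>j\<le>n. jcoefK p \<kappa> A B w n j
        * ((\<kappa> - A - B) * (A + B - v - A * B * p ^ j) + A * B * (1 - p ^ j * v)) / \<kappa>
        - (\<kappa> - A - B + A * B) / \<kappa> * (u j * e j))"
  proof (rule sum_telescope_eq [where d = "\<lambda>j. (\<kappa> - A - B) / \<kappa> * (u j * e j * (1 - p ^ j) / p ^ j)"])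
    fix j
    define x where "x = p ^ j"
    obtain U where U: "u j = U * ((1 - p * x) * (1 - \<kappa> * x) * (1 - x * v))"
      "u (Suc j) = U * (p * (1 - A * x) * (1 - B * x))"
      "jcoefK p \<kappa> A B w n j = U * ((1 - p * x) * e (Suc j))"
      using jcoef_step [of A B j] unfolding u_def e_def x_def v_def by auto
    have e: "e (Suc j) = e j * (1 - x * y)" by (simp add: e_def qpoch_Suc x_def y_def)
    have x: "x \<noteq> 0" "1 - \<kappa> * x \<noteq> 0" using generic_nonzero(4-7) [of j] by (simp_all add: x_def)
    have "u j * e j * (\<kappa> - A - B + A * B * p ^ j) / (1 - \<kappa> * p ^ j) = U * ((1 - p * x) * (1 - x * v)) * e j * (\<kappa> - A - B + A * B * x)"
      unfolding U x_def [symmetric] using x by simp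
    then show "(1 - y / \<kappa>) * (u j * e j * (\<kappa> - A - B + A * B * p ^ j) / (1 - \<kappa> * p ^ j)) -
        (jcoefK p \<kappa> A B w n j
        * ((\<kappa> - A - B) * (A + B - v - A * B * p ^ j) + A * B * (1 - p ^ j * v)) / \<kappa>
        - (\<kappa> - A - B + A * B) / \<kappa> * (u j * e j))
      = (\<kappa> - A - B) / \<kappa> * (u (Suc j) * e (Suc j) * (1 - p ^ Suc j) / p ^ Suc j)
        - (\<kappa> - A - B) / \<kappa> * (u j * e j * (1 - p ^ j) / p ^ j)"
      unfolding power_Suc x_def [symmetric] U e using x(1)
      by (simp add: divide_simps) (simp add: algebra_simps)
  qed (auto simp: e_def qpoch_inverse_power_eq_0)
  then show ?thesis
    by (simp add: jsum_def sum_distrib_left u_def e_def y_def v_def sum_subtractf sum_divide_distrib mult_ac)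
qed

section \<open>Contiguous relations for the left site\<close>

lemma jcoef_shift:
  "(1 - A) * (1 - B) * jcoef p \<kappa> (p * A) (p * B) (w / p) j
     = (1 - 1 / w) * jcoef p \<kappa> A B w (Suc j) * (1 - p * p ^ j) * (1 - \<kappa> * p ^ j) / p"
proof -
  have w1: "1 - 1 / w \<noteq> 0" using generic_nonzero(6) [of 0] by simp
  have f: "qpoch a p (Suc j) = (1 - a) * qpoch (p * a) p j" for a
    by (simp add: qpoch_Suc_shift mult.commute)
  define a where "a = 1 - p * p ^ j"
  define b where "b = 1 - \<kappa> * p ^ j"
  define c where "c = 1 - 1 / w"
  have abc: "a \<noteq> 0" "b \<noteq> 0" "c \<noteq> 0" using w1 unfolding a_def b_def c_def by simp_all
  have "jcoef p \<kappa> A B w (Suc j) = (1 - A) * qpoch (p * A) p j * ((1 - B) * qpoch (p * B) p j) * (p * p ^ j)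
     / (qpoch p p j * a * (qpoch \<kappa> p j * b) * (c * qpoch (p * (1 / w)) p j))"
    unfolding jcoef_def f [of A] f [of B] f [of "1 / w"] qpoch_Suc [of p] qpoch_Suc [of \<kappa>]
    by (simp only: power_Suc a_def b_def c_def)
  then have "c * jcoef p \<kappa> A B w (Suc j) * a * b / p = (1 - A) * qpoch (p * A) p j * ((1 - B) * qpoch (p * B) p j) * p ^ j
     / (qpoch p p j * qpoch \<kappa> p j * qpoch (p * (1 / w)) p j)"
    using abc by (simp add: mult_ac)
  then show ?thesis
    by (simp add: a_def b_def c_def jcoef_def mult_ac)
qed

text \<open>Prepares the left factor after a right jump of \<xi>, where A, B, w become p A, p B,
  w/p; the first sum is the one produced by \<open>jcoef_shift\<close>. Its constant - (1 - w/p^n) /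
  w is the quotient of (1 - 1/w) (w/p; 1/p)_n and (w; 1/p)_n.\<close>

lemma jsum_shift:
  "p * (- (1 - w / p ^ n) / w * (\<Sum>j\<le>n. jcoef p \<kappa> A B w (Suc j) * (1 - p * p ^ j) * (1 - \<kappa> * p ^ j) / p
        * qpoch (1 / p ^ n) p j) - (1 - A) * (1 - B) * jsum p \<kappa> n A B w)
   = (\<kappa> - p * (A * B)) * (\<Sum>j\<le>n. jcoef p \<kappa> A B w j * qpoch (1 / p ^ n) p j * (1 - p ^ j))"
proof -
  define u where "u = jcoef p \<kappa> A B w"
  define e where "e = qpoch (1 / p ^ n) p"
  define y where "y = 1 / p ^ n"
  define v where "v = 1 / w"
  have "(\<Sum>j\<le>n. - (v - y) * (u (Suc j) * (1 - p * p ^ j) * (1 - \<kappa> * p ^ j) * e j)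
           - p * (1 - A) * (1 - B) * (u j * e j))
    = (\<Sum>j\<le>n. (\<kappa> - p * (A * B)) * (u j * e j * (1 - p ^ j)))"
  proof (rule sum_telescope_eq [where d = "\<lambda>j. - (u j * e j * (1 - p ^ j) * (1 - \<kappa> * p ^ j / p) * p / p ^ j)"])
    fix j
    define x where "x = p ^ j"
    obtain U where U: "u j = U * ((1 - p * x) * (1 - \<kappa> * x) * (1 - x * v))"
      "u (Suc j) = U * (p * (1 - A * x) * (1 - B * x))"
      using jcoef_step [of A B j] unfolding u_def e_def x_def v_def by auto
    have e: "e (Suc j) = e j * (1 - x * y)" by (simp add: e_def qpoch_Suc x_def y_def)
    have x: "x \<noteq> 0" by (simp add: x_def)
    then show "- (v - y) * (u (Suc j) * (1 - p * p ^ j) * (1 - \<kappa> * p ^ j) * e j)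
           - p * (1 - A) * (1 - B) * (u j * e j) - (\<kappa> - p * (A * B)) * (u j * e j * (1 - p ^ j))
      = - (u (Suc j) * e (Suc j) * (1 - p ^ Suc j) * (1 - \<kappa> * p ^ Suc j / p) * p / p ^ Suc j)
        - - (u j * e j * (1 - p ^ j) * (1 - \<kappa> * p ^ j / p) * p / p ^ j)"
      unfolding power_Suc x_def [symmetric] U e
      by (simp add: divide_simps) (simp add: algebra_simps)
  qed (auto simp: e_def qpoch_inverse_power_eq_0)
  then have 1: "- (v - y) * (\<Sum>j\<le>n. u (Suc j) * (1 - p * p ^ j) * (1 - \<kappa> * p ^ j) * e j)
      - p * (1 - A) * (1 - B) * (\<Sum>j\<le>n. u j * e j) = (\<kappa> - p * (A * B)) * (\<Sum>j\<le>n. u j * e j * (1 - p ^ j))"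
    by (simp only: sum_subtractf sum_distrib_left [symmetric])
  have 2: "- (1 - w / p ^ n) / w = - (v - y)" by (simp add: v_def y_def field_simps)
  have 3: "(\<Sum>j\<le>n. u (Suc j) * (1 - p * p ^ j) * (1 - \<kappa> * p ^ j) / p * e j)
     = (\<Sum>j\<le>n. u (Suc j) * (1 - p * p ^ j) * (1 - \<kappa> * p ^ j) * e j) / p"
    by (simp add: sum_divide_distrib)
  show ?thesis
    unfolding 2 jsum_def u_def [symmetric] e_def [symmetric] 3 1 [symmetric]
    by (simp add: right_diff_distrib)
qed

text \<open>The factorials (p^(-n-1); p)_(j+1) and (p^(-n); p)_(j+1) share the factor (p^(-n); p)_j,
  and the difference of their cofactors is proportional to 1 - p^(j+1).\<close>

lemma jsum_Suc_diff:
  "jsum p \<kappa> (Suc n) A B w - jsum p \<kappa> n A B w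
    = - 1 / p ^ n * (\<Sum>j\<le>n. jcoef p \<kappa> A B w (Suc j) * (1 - p * p ^ j) / p * qpoch (1 / p ^ n) p j)"
proof -
  define u where "u = jcoef p \<kappa> A B w"
  define e where "e = qpoch (1 / p ^ n) p"
  define e' where "e' = qpoch (1 / p ^ Suc n) p"
  define y where "y = 1 / p ^ n"
  have "(\<Sum>j\<le>Suc n. u j * (e' j - e j)) = (\<Sum>j\<le>n. u (Suc j) * (e' (Suc j) - e (Suc j)))"
    by (subst sum.atMost_Suc_shift) (simp add: e'_def e_def)
  also have "\<dots> = (\<Sum>j\<le>n. - y * (u (Suc j) * (1 - p * p ^ j) / p * e j))"
  proof (rule sum.cong [OF refl])
    fix j
    have 1: "e' (Suc j) = (1 - y / p) * e j"
      by (simp add: e'_def e_def qpoch_Suc_shift y_def)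
    have 2: "e (Suc j) = e j * (1 - p ^ j * y)" by (simp add: e_def qpoch_Suc y_def)
    show "u (Suc j) * (e' (Suc j) - e (Suc j)) = - y * (u (Suc j) * (1 - p * p ^ j) / p * e j)"
      unfolding 1 2 by (simp add: field_simps)
  qed
  finally show ?thesis
    using jsum_extend [of p n "Suc n" \<kappa> A B w]
    by (simp add: jsum_def [of p \<kappa> "Suc n"] e'_def e_def u_def y_def right_diff_distrib sum_subtractf sum_distrib_left sum_negf mult_ac
      del: sum.atMost_Suc power_Suc)
qed

text \<open>Links the sum by which degree n + 1 differs from degree n to the sum with weights 1 -
  p^j, which governs the step to degree n - 1. Of the multipliers, p^n \<kappa> - 1 is a factor of a
  jump rate and 1 - w/p^n is the quotient of the prefactors (w; 1/p)_(n+1) and (w; 1/p)_n.\<close>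

lemma jsum_difference:
  "- (p ^ n * \<kappa> - 1) * (1 - w / p ^ n) / p ^ n
       * (\<Sum>j\<le>n. jcoef p \<kappa> A B w (Suc j) * (1 - p * p ^ j) / p * qpoch (1 / p ^ n) p j)
     + (\<kappa> / p - A * B * w / p ^ n)
       * (\<Sum>j\<le>n. jcoef p \<kappa> A B w j * qpoch (1 / p ^ n) p j * (1 - p ^ j))
     = - w / p ^ n * (1 - A) * (1 - B) * jsum p \<kappa> n A B w"
proof -
  define u where "u = jcoef p \<kappa> A B w"
  define e where "e = qpoch (1 / p ^ n) p"
  define y where "y = 1 / p ^ n"
  define v where "v = 1 / w"
  have wv: "w = 1 / v" "v \<noteq> 0" by (simp_all add: v_def)
  have "(\<Sum>j\<le>n. - (\<kappa> - y) * (1 - w * y) * (u (Suc j) * (1 - p * p ^ j) / p * e j)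
         + (\<kappa> / p - A * B * w * y) * (u j * e j * (1 - p ^ j)))
    = (\<Sum>j\<le>n. - w * y * (1 - A) * (1 - B) * (u j * e j))"
  proof (rule sum_telescope_eq [where d = "\<lambda>j. u j * e j * (1 - p ^ j) * (w * y * p / p ^ j - \<kappa>) / p"])
    fix j
    define x where "x = p ^ j"
    obtain U where U: "u j = U * ((1 - p * x) * (1 - \<kappa> * x) * (1 - x * v))"
      "u (Suc j) = U * (p * (1 - A * x) * (1 - B * x))"
      using jcoef_step [of A B j] unfolding u_def e_def x_def v_def by auto
    have e: "e (Suc j) = e j * (1 - x * y)" by (simp add: e_def qpoch_Suc x_def y_def)
    have x: "x \<noteq> 0" by (simp add: x_def)
    then show "- (\<kappa> - y) * (1 - w * y) * (u (Suc j) * (1 - p * p ^ j) / p * e j)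
         + (\<kappa> / p - A * B * w * y) * (u j * e j * (1 - p ^ j)) - (- w * y * (1 - A) * (1 - B) * (u j * e j))
      = u (Suc j) * e (Suc j) * (1 - p ^ Suc j) * (w * y * p / p ^ Suc j - \<kappa>) / p
        - u j * e j * (1 - p ^ j) * (w * y * p / p ^ j - \<kappa>) / p"
      unfolding power_Suc x_def [symmetric] U e wv(1) using wv(2)
      by (simp add: divide_simps) (simp add: algebra_simps)
  qed (auto simp: e_def qpoch_inverse_power_eq_0)
  then have "- (\<kappa> - y) * (1 - w * y) * (\<Sum>j\<le>n. u (Suc j) * (1 - p * p ^ j) / p * e j)
         + (\<kappa> / p - A * B * w * y) * (\<Sum>j\<le>n. u j * e j * (1 - p ^ j))
    = - w * y * (1 - A) * (1 - B) * (\<Sum>j\<le>n. u j * e j)"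
    by (simp only: sum.distrib sum_distrib_left [symmetric])
  moreover have "- (p ^ n * \<kappa> - 1) * (1 - w / p ^ n) / p ^ n = - (\<kappa> - y) * (1 - w * y)"
    by (simp add: y_def field_simps)
  ultimately show ?thesis
    by (simp add: jsum_def u_def e_def y_def)
qed

text \<open>The left factor after a left jump of \<xi>. The constants 1 - w p and 1 - p w/p^n come
  from (1 - w p) (w; 1/p)_n = (w p; 1/p)_n (1 - p w/p^n). The sum with poles on the right is
  evaluated by \<open>jsum_shift_down_coefficients\<close>.\<close>

lemma jsum_shift_down:
  "(1 - w * p) * (\<Sum>j\<le>n. jcoef p \<kappa> (A / p) (B / p) (w * p) j * qpoch (1 / p ^ n) p j)
      - (1 - p * w / p ^ n) * jsum p \<kappa> n A B w
   = w * (\<kappa> * p - A * B)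
      * (\<Sum>j\<le>n. jcoef p \<kappa> A B w j * qpoch (1 / p ^ n) p (Suc j) / (1 - \<kappa> * p ^ j))"
proof -
  define u where "u = jcoef p \<kappa> A B w"
  define u' where "u' = jcoef p \<kappa> (A / p) (B / p) (w * p)"
  define e where "e = qpoch (1 / p ^ n) p"
  define y where "y = 1 / p ^ n"
  define v where "v = 1 / w"
  have wv: "w = 1 / v" "v \<noteq> 0" by (simp_all add: v_def)
  define d where "d = (\<lambda>j. case j of 0 \<Rightarrow> 0 | Suc i \<Rightarrow>
     - w * p * u i * e (Suc i) * (1 - A * B * p ^ i / p) / ((1 - \<kappa> * p ^ i) * p ^ i))"
  have u': "(1 - w * p) * u' (Suc i) = - w * p * (1 - A / p) * (1 - B / p) * u i * p / ((1 - p * p ^ i) * (1 - \<kappa> * p ^ i))" for i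
  proof -
    have w1: "1 - 1 / (w * p) \<noteq> 0"
      using w unfolding generic_def by (metis eq_iff_diff_eq_0 divide_eq_1_iff power_0 power_one_right)
    define a where "a = 1 - p * p ^ i"
    define b where "b = 1 - \<kappa> * p ^ i"
    define c where "c = 1 - 1 / (w * p)"
    have abc: "a \<noteq> 0" "b \<noteq> 0" "c \<noteq> 0" using w1 unfolding a_def b_def c_def by simp_all
    have c: "1 - w * p = - w * p * c" unfolding c_def by (simp add: field_simps)
    have "u' (Suc i) = (1 - A / p) * qpoch A p i * ((1 - B / p) * qpoch B p i) * (p * p ^ i)
       / (qpoch p p i * a * (qpoch \<kappa> p i * b) * (c * qpoch (1 / w) p i))"
      unfolding u'_def jcoef_def qpoch_Suc_shift [of "A / p"] qpoch_Suc_shift [of "B / p"]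
        qpoch_Suc_shift [of "1 / (w * p)"] qpoch_Suc [of p] qpoch_Suc [of \<kappa>] a_def b_def c_def
      by simp
    then show ?thesis
      unfolding a_def [symmetric] b_def [symmetric] c using abc
      by (simp add: u_def jcoef_def mult_ac)
  qed
  have "(\<Sum>j\<le>n. (1 - w * p) * (u' j * e j) - (1 - p * w * y) * (u j * e j))
     = (\<Sum>j\<le>n. w * (\<kappa> * p - A * B) * (u j * e (Suc j) / (1 - \<kappa> * p ^ j)))"
  proof (rule sum_telescope_eq)
    fix j
    define x where "x = p ^ j"
    have x: "x \<noteq> 0" "1 - \<kappa> * x \<noteq> 0" using generic_nonzero(4-7) [of j] by (simp_all add: x_def)
    have e: "e (Suc j) = e j * (1 - x * y)" by (simp add: e_def qpoch_Suc x_def y_def)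
    have F: "(1 - w * p) * (u' j * e j) = w * p * (x * v / p - 1) * u j * e j / x - d j"
    proof (cases j)
      case 0
      then show ?thesis by (simp add: d_def e_def u_def u'_def jcoef_def x_def field_simps v_def)
    next
      case (Suc i)
      define z where "z = p ^ i"
      obtain U where U: "u i = U * ((1 - p * z) * (1 - \<kappa> * z) * (1 - z * v))"
        "u (Suc i) = U * (p * (1 - A * z) * (1 - B * z))"
        using jcoef_step [of A B i] unfolding u_def z_def v_def by auto
      have z: "z \<noteq> 0" "1 - \<kappa> * z \<noteq> 0" "1 - p * z \<noteq> 0" using generic_nonzero(4-7) [of i] by (simp_all add: z_def)
      have "x = p * z" by (simp add: x_def Suc z_def)
      have d: "d j = - w * p * U * (1 - p * z) * (1 - z * v) * e (Suc i) * (1 - A * B * z / p) / z"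
        unfolding Suc d_def nat.case z_def [symmetric] U using z by simp
      have u': "(1 - w * p) * u' (Suc i) = - w * p * (1 - A / p) * (1 - B / p) * U * (1 - z * v) * p"
        unfolding u' unfolding z_def [symmetric] U using z by simp
      have "(1 - w * p) * (u' j * e j) = (1 - w * p) * u' (Suc i) * e (Suc i)" by (simp add: Suc)
      then show ?thesis
        unfolding u' d unfolding Suc U \<open>x = p * z\<close> wv(1) using wv(2) z
        by (simp add: divide_simps) (simp add: algebra_simps)
    qed
    have dS: "d (Suc j) = - w * p * u j * (e j * (1 - x * y)) * (1 - A * B * x / p) / ((1 - \<kappa> * x) * x)"
      unfolding d_def nat.case x_def [symmetric] e ..
    show "(1 - w * p) * (u' j * e j) - (1 - p * w * y) * (u j * e j)
       - w * (\<kappa> * p - A * B) * (u j * e (Suc j) / (1 - \<kappa> * p ^ j)) = d (Suc j) - d j"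
      unfolding F dS unfolding x_def [symmetric] e wv(1) using wv(2) x
      by (simp add: divide_simps) (simp add: algebra_simps)
  qed (auto simp: d_def e_def qpoch_inverse_power_eq_0)
  then have "(1 - w * p) * (\<Sum>j\<le>n. u' j * e j) - (1 - p * w * y) * (\<Sum>j\<le>n. u j * e j)
      = w * (\<kappa> * p - A * B) * (\<Sum>j\<le>n. u j * e (Suc j) / (1 - \<kappa> * p ^ j))"
    by (simp only: sum_subtractf sum_distrib_left [symmetric])
  moreover have "p * w * y = p * w / p ^ n" by (simp add: y_def)
  ultimately show ?thesis
    by (simp only: jsum_def u_def u'_def e_def)
qed

text \<open>The multiplier \<kappa> - A - B + A B/\<kappa> is \<kappa> (1 - A/\<kappa>) (1 -
  B/\<kappa>), that is, \<kappa> times the numerator (1 - A x) (1 - B x) of the coefficient ratio at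
  the pole x = 1/\<kappa>. This is what makes the poles removable by telescoping.\<close>

lemma jsum_shift_down_coefficients:
  "p * w * (\<kappa> - A - B + A * B / \<kappa>)
      * (\<Sum>j\<le>n. jcoef p \<kappa> A B w j * qpoch (1 / p ^ n) p (Suc j) / (1 - \<kappa> * p ^ j))
   = - ((1 - p * (A * B / \<kappa>) * w / p ^ n)
          * ((\<Sum>j\<le>n. jcoef p \<kappa> A B w j * qpoch (1 / p ^ n) p j * (1 - p ^ j))
             + (p ^ n - 1) * jsum p \<kappa> n A B w)
        - (p ^ n - 1) * (1 - p * w / p ^ n) * jsum p \<kappa> n A B w)"
proof -
  define u where "u = jcoef p \<kappa> A B w"
  define e where "e = qpoch (1 / p ^ n) p"
  define N where "N = p ^ n"
  define v where "v = 1 / w"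
  define \<theta> where "\<theta> = A * B / \<kappa>"
  have wv: "w = 1 / v" "v \<noteq> 0" by (simp_all add: v_def)
  have N: "N \<noteq> 0" by (simp add: N_def)
  have "(\<Sum>j\<le>n. p * w * (\<kappa> - A - B + \<theta>) * (u j * e (Suc j) / (1 - \<kappa> * p ^ j)))
     = (\<Sum>j\<le>n. - ((1 - p * \<theta> * w / N) * (u j * e j * (1 - p ^ j) + (N - 1) * (u j * e j))
        - (N - 1) * (1 - p * w / N) * (u j * e j)))"
  proof (rule sum_telescope_eq [where d = "\<lambda>j. u j * e j * (1 - p ^ j) * (w * p - p ^ j) / p ^ j"])
    fix j
    define x where "x = p ^ j"
    have x: "x \<noteq> 0" "1 - \<kappa> * x \<noteq> 0" using generic_nonzero(4-7) [of j] by (simp_all add: x_def)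
    obtain U where U: "u j = U * ((1 - p * x) * (1 - \<kappa> * x) * (1 - x * v))"
      "u (Suc j) = U * (p * (1 - A * x) * (1 - B * x))"
      using jcoef_step [of A B j] unfolding u_def e_def x_def v_def by auto
    have e: "e (Suc j) = e j * (1 - x / N)" by (simp add: e_def qpoch_Suc x_def N_def)
    have 1: "u j * e (Suc j) / (1 - \<kappa> * p ^ j) = U * ((1 - p * x) * (1 - x * v)) * e (Suc j)"
      unfolding U x_def [symmetric] using x by simp
    have AB: "A * B = \<kappa> * \<theta>" by (simp add: \<theta>_def)
    have "p * w * (\<kappa> - A - B + \<theta>) * (u j * e (Suc j) / (1 - \<kappa> * p ^ j)) - - ((1 - p * \<theta> * w / N) * (u j * e j * (1 - p ^ j) + (N - 1) * (u j * e j))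
        - (N - 1) * (1 - p * w / N) * (u j * e j))
     = p * w * (\<kappa> - A - B + \<theta>) * U * (1 - p * x) * (1 - x * v) * e j * (1 - x / N)
       + U * (1 - p * x) * (1 - \<kappa> * x) * (1 - x * v) * e j * ((1 - p * \<theta> * w / N) * (N - x) - (N - 1) * (1 - p * w / N))"
      unfolding 1 unfolding U e x_def [symmetric] using N by (simp add: field_simps)
    also have "\<dots> = U * (p * (1 - (A + B) * x + \<kappa> * \<theta> * x * x)) * (e j * (1 - x / N)) * (1 - p * x) * (w * p - p * x) / (p * x)
       - U * ((1 - p * x) * (1 - \<kappa> * x) * (1 - x * v)) * e j * (1 - x) * (w * p - x) / x"
      unfolding wv(1) using wv(2) x N
      by (simp add: divide_simps) (simp add: algebra_simps)
    also have "1 - (A + B) * x + \<kappa> * \<theta> * x * x = (1 - A * x) * (1 - B * x)"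
      unfolding AB [symmetric] by (simp add: algebra_simps)
    finally show "p * w * (\<kappa> - A - B + \<theta>) * (u j * e (Suc j) / (1 - \<kappa> * p ^ j)) - - ((1 - p * \<theta> * w / N) * (u j * e j * (1 - p ^ j) + (N - 1) * (u j * e j))
        - (N - 1) * (1 - p * w / N) * (u j * e j))
      = u (Suc j) * e (Suc j) * (1 - p ^ Suc j) * (w * p - p ^ Suc j) / p ^ Suc j
         - u j * e j * (1 - p ^ j) * (w * p - p ^ j) / p ^ j"
      unfolding power_Suc x_def [symmetric] U e by (simp only: mult.assoc)
  qed (auto simp: e_def qpoch_inverse_power_eq_0)
  then show ?thesis
    by (simp only: sum_distrib_left [symmetric] sum.distrib sum_subtractf sum_negf
      jsum_def u_def e_def N_def \<theta>_def)
qed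

end

subsection \<open>Relations for the one-site polynomial\<close>

lemma qpoch_inverse_base: "p \<noteq> 0 \<Longrightarrow> qpoch w (1 / p) n = (\<Prod>m<n. 1 - w / p ^ m)"
  by (simp add: qpoch_def power_one_over)

text \<open>The polynomial in \<open>w\<close> that continues \<open>(w; 1/p)\<^sub>n / (1/w; p)\<^sub>i\<close> to the zeros of its denominator.\<close>

definition tail_poch :: "real \<Rightarrow> nat \<Rightarrow> nat \<Rightarrow> real \<Rightarrow> real" where
  "tail_poch p n i w = (\<Prod>m<i. - w / p ^ m) * (\<Prod>m=i..<n. 1 - w / p ^ m)"

lemma tail_poch_eq:
  assumes "p \<noteq> 0" "w \<noteq> 0" "i \<le> n"
  shows "tail_poch p n i w * qpoch (1 / w) p i = qpoch w (1 / p) n"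
proof -
  have "(\<Prod>m<i. - w / p ^ m) * qpoch (1 / w) p i = (\<Prod>m<i. 1 - w / p ^ m)"
    unfolding qpoch_def prod.distrib [symmetric]
    by (rule prod.cong [OF refl]) (use assms in \<open>simp add: field_simps\<close>)
  moreover have "(\<Prod>m<n. 1 - w / p ^ m) = (\<Prod>m<i. 1 - w / p ^ m) * (\<Prod>m=i..<n. 1 - w / p ^ m)"
    using prod.atLeastLessThan_concat [of 0 i n "\<lambda>m. 1 - w / p ^ m"] assms(3) by (simp add: lessThan_atLeast0)
  ultimately show ?thesis
    by (simp add: tail_poch_def qpoch_inverse_base assms mult_ac)
qed

definition bigJ :: "real \<Rightarrow> real \<Rightarrow> nat \<Rightarrow> real \<Rightarrow> real \<Rightarrow> real \<Rightarrow> real" where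
  "bigJ p \<kappa> n A B w =
     (\<Sum>i\<le>n. qpoch A p i * qpoch B p i * qpoch (1 / p ^ n) p i / (qpoch p p i * qpoch \<kappa> p i)
        * p ^ i * tail_poch p n i w)"

lemma bigJ_eq:
  assumes "p \<noteq> 0" "w \<noteq> 0" "\<And>i. i < n \<Longrightarrow> p ^ i \<noteq> w"
  shows "bigJ p \<kappa> n A B w = qpoch w (1 / p) n * jsum p \<kappa> n A B w"
  unfolding bigJ_def jsum_def sum_distrib_left
proof (rule sum.cong [OF refl])
  fix i assume "i \<in> {..n}"
  then have "i \<le> n" by simp
  have "qpoch (1 / w) p i \<noteq> 0"
    using assms(2) assms(3) [OF less_le_trans [OF _ \<open>i \<le> n\<close>]] by (auto simp: qpoch_eq_0_iff)
  then have "tail_poch p n i w = qpoch w (1 / p) n / qpoch (1 / w) p i"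
    using tail_poch_eq [OF assms(1,2) \<open>i \<le> n\<close>] by (simp add: field_simps)
  then show "qpoch A p i * qpoch B p i * qpoch (1 / p ^ n) p i / (qpoch p p i * qpoch \<kappa> p i)
        * p ^ i * tail_poch p n i w = qpoch w (1 / p) n * (jcoef p \<kappa> A B w i * qpoch (1 / p ^ n) p i)"
    by (simp add: jcoef_def)
qed

lemma generic_mult: "generic p w \<Longrightarrow> p \<noteq> 0 \<Longrightarrow> generic p (w * p)"
  unfolding generic_def by (metis mult.assoc mult_eq_0_iff power_Suc)

lemma generic_divide:
  assumes "generic p w" "p \<noteq> 0"
  shows "generic p (w / p)"
  unfolding generic_def
proof (intro conjI allI)
  show "w / p \<noteq> 0" using assms by (simp add: generic_def)
  show "w / p * p ^ m \<noteq> p ^ j" for m j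
  proof
    assume "w / p * p ^ m = p ^ j"
    then have "w * p ^ m = p ^ Suc j" using assms(2) by (simp add: field_simps)
    then show False using assms(1) unfolding generic_def by blast
  qed
qed

lemma bigJ_generic:
  assumes "generic p w" "p \<noteq> 0"
  shows "bigJ p \<kappa> n A B w = qpoch w (1 / p) n * jsum p \<kappa> n A B w"
  by (rule bigJ_eq) (use assms in \<open>auto simp: generic_def, metis mult.right_neutral power_0\<close>)

context
  fixes p \<kappa> w :: real
  assumes p: "0 < p" "p < 1" and \<kappa>: "0 < \<kappa>" "\<kappa> < 1" and w: "generic p w"
begin

private lemma p0: "p \<noteq> 0" using p by simp

private lemma w0: "w \<noteq> 0" using w by (simp add: generic_def)

private lemma w_ne: "1 - w / p ^ j \<noteq> 0"
  using generic_nonzero(10) [OF p \<kappa> w, of j] p0 by simp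

text \<open>The elimination uses only these linear relations, so the two sums stay abstract. The
  truncated n - 1 is harmless at n = 0, where 1 - 1/p^n vanishes.\<close>

lemma bigJ_right_site:
  obtains K0 K1 where
    "(1 - B) * (bigJ p \<kappa> n (A / p) (p * B) w - bigJ p \<kappa> n A B w) = - (A - p * B) * (K0 - B * K1)"
    "(1 - A) * (bigJ p \<kappa> n (p * A) (B / p) w - bigJ p \<kappa> n A B w) = - (B - p * A) * (K0 - A * K1)"
    "(1 / p ^ n - 1) * bigJ p \<kappa> n A B w = (\<kappa> - A - B + 1 / w) * K0 + (A * B - \<kappa> / w) * K1"
    "w * ((1 - 1 / p ^ n) * bigJ p \<kappa> (n - 1) A B (w / p)) = - (K0 - \<kappa> * K1)"
    "(1 - 1 / (p ^ n * \<kappa>)) * bigJ p \<kappa> (Suc n) A B (w * p)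
       = (1 - 1 / (p ^ n * \<kappa>)) * bigJ p \<kappa> n A B w
         + w * p / \<kappa> * ((\<kappa> - A - B) * ((A + B - 1 / w) * K0 - A * B * K1)
             + A * B * (K0 - K1 / w) - (\<kappa> - A - B + A * B) * bigJ p \<kappa> n A B w)"
proof -
  define \<omega> where "\<omega> = qpoch w (1 / p) n"
  define k where "k = jcoefK p \<kappa> A B w n"
  define S0 where "S0 = (\<Sum>j\<le>n. k j)"
  define S1 where "S1 = (\<Sum>j\<le>n. k j * p ^ j)"
  have lin: "(\<Sum>j\<le>n. k j * (a + b * p ^ j)) = a * S0 + b * S1" for a b
    by (simp add: S0_def S1_def distrib_left sum.distrib sum_distrib_left mult_ac)
  have lin': "(\<Sum>j\<le>n. k j * (1 - b * p ^ j)) = S0 - b * S1" for b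
    using lin [of 1 "- b"] by simp
  note J = bigJ_generic [OF w p0]
  show ?thesis
  proof (rule that [of "\<omega> * S0" "\<omega> * S1"])
    show "(1 - B) * (bigJ p \<kappa> n (A / p) (p * B) w - bigJ p \<kappa> n A B w) = - (A - p * B) * (\<omega> * S0 - B * (\<omega> * S1))"
      using arg_cong [OF jsum_shift_up [OF p \<kappa> w, of B n A, folded k_def, unfolded lin'], of "\<lambda>x. \<omega> * x"]
      unfolding J \<omega>_def [symmetric] by (simp add: algebra_simps)
    \<comment> \<open>The weights are symmetric in A and B, so the second shift is the first one
      with the two exchanged and leads to the same two sums.\<close>
    have "jcoefK p \<kappa> B A w n = k"
      by (rule ext) (simp add: k_def jcoefK_def jcoef_def mult_ac)
    then show "(1 - A) * (bigJ p \<kappa> n (p * A) (B / p) w - bigJ p \<kappa> n A B w) = - (B - p * A) * (\<omega> * S0 - A * (\<omega> * S1))"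
      using arg_cong [OF jsum_shift_up [OF p \<kappa> w, of A n B, unfolded \<open>_ = k\<close> lin'], of "\<lambda>x. \<omega> * x"]
      unfolding J \<omega>_def [symmetric] jsum_commute [of p \<kappa> n "p * A"] jsum_commute [of p \<kappa> n A]
      by (simp add: algebra_simps)
    show "(1 / p ^ n - 1) * bigJ p \<kappa> n A B w = (\<kappa> - A - B + 1 / w) * (\<omega> * S0) + (A * B - \<kappa> / w) * (\<omega> * S1)"
      using arg_cong [OF jsum_recurrence [OF p \<kappa> w, of n A B, folded k_def, unfolded lin], of "\<lambda>x. \<omega> * x"]
      unfolding J \<omega>_def [symmetric] by (simp add: algebra_simps)
    show "w * ((1 - 1 / p ^ n) * bigJ p \<kappa> (n - 1) A B (w / p)) = - (\<omega> * S0 - \<kappa> * (\<omega> * S1))"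
    proof (cases n)
      case 0
      \<comment> \<open>For n = 0 every weight contains the factor 1 - 1 of (1; p)_(j+1), so both
        sums vanish.\<close>
      then show ?thesis by (simp add: S0_def S1_def k_def jcoefK_def qpoch_def)
    next
      case (Suc m)
      have 1: "(1 - 1 / p ^ n) * jsum p \<kappa> m A B (w / p) = (1 - 1 / w) * (S0 - \<kappa> * S1)"
        using jsum_lower [OF p \<kappa> w, of m A B] lin' [of \<kappa>] unfolding k_def Suc by simp
      have 2: "\<omega> = (1 - w) * qpoch (w / p) (1 / p) m"
        by (simp add: \<omega>_def Suc qpoch_Suc_shift)
      have 3: "w * (1 - 1 / w) = - (1 - w)" using w0 by (simp add: field_simps)
      have "w * ((1 - 1 / p ^ n) * (qpoch (w / p) (1 / p) m * jsum p \<kappa> m A B (w / p)))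
         = qpoch (w / p) (1 / p) m * w * ((1 - 1 / p ^ n) * jsum p \<kappa> m A B (w / p))"
        by (simp only: mult_ac)
      also have "\<dots> = qpoch (w / p) (1 / p) m * (w * (1 - 1 / w)) * (S0 - \<kappa> * S1)"
        unfolding 1 by (simp only: mult_ac)
      also have "\<dots> = - (\<omega> * S0 - \<kappa> * (\<omega> * S1))"
        unfolding 2 3 by (simp add: algebra_simps)
      finally show ?thesis
        unfolding Suc diff_Suc_1 bigJ_generic [OF generic_divide [OF w p0] p0] .
    qed
    define T where "T = (\<Sum>j\<le>n. jcoef p \<kappa> A B w j * qpoch (1 / p ^ n) p j
                    * (\<kappa> - A - B + A * B * p ^ j) / (1 - \<kappa> * p ^ j))"
    have "qpoch (w * p) (1 / p) (Suc n) = (1 - w * p) * \<omega>"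
      using p0 by (simp add: qpoch_Suc_shift \<omega>_def)
    moreover have "1 - w * p = - (w * p) * (1 - 1 / (w * p))" using w0 p0 by (simp add: field_simps)
    ultimately have "bigJ p \<kappa> (Suc n) A B (w * p) = - (w * p) * \<omega> * ((1 - 1 / (w * p)) * jsum p \<kappa> (Suc n) A B (w * p))"
      unfolding bigJ_generic [OF generic_mult [OF w p0] p0] by (simp only: mult_ac)
    also have "\<dots> = \<omega> * jsum p \<kappa> n A B w + w * p * (\<omega> * T)"
      unfolding jsum_raise [OF p \<kappa> w] T_def [symmetric] using w0 p0 by (simp add: field_simps)
    finally have 1: "bigJ p \<kappa> (Suc n) A B (w * p) = \<omega> * jsum p \<kappa> n A B w + w * p * (\<omega> * T)" .
    have "(\<Sum>j\<le>n. k j * ((\<kappa> - A - B) * (A + B - 1 / w - A * B * p ^ j) + A * B * (1 - p ^ j / w)))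
      = (\<Sum>j\<le>n. k j * (((\<kappa> - A - B) * (A + B - 1 / w) + A * B) + (- (\<kappa> - A - B) * A * B - A * B / w) * p ^ j))"
      by (intro sum.cong refl arg_cong2 [where f = "(*)"]) (simp add: algebra_simps)
    then have 2: "(1 - 1 / (p ^ n * \<kappa>)) * T
      = (((\<kappa> - A - B) * (A + B - 1 / w) + A * B) * S0 + (- (\<kappa> - A - B) * A * B - A * B / w) * S1) / \<kappa>
         - (\<kappa> - A - B + A * B) / \<kappa> * jsum p \<kappa> n A B w"
      using jsum_raise_coefficients [OF p \<kappa> w, of n A B] by (simp add: T_def k_def [symmetric] lin)
    have 3: "(1 - 1 / (p ^ n * \<kappa>)) * (w * p * (\<omega> * T)) = w * p * \<omega> * ((1 - 1 / (p ^ n * \<kappa>)) * T)"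
      by (simp only: mult_ac)
    show "(1 - 1 / (p ^ n * \<kappa>)) * bigJ p \<kappa> (Suc n) A B (w * p)
       = (1 - 1 / (p ^ n * \<kappa>)) * bigJ p \<kappa> n A B w
         + w * p / \<kappa> * ((\<kappa> - A - B) * ((A + B - 1 / w) * (\<omega> * S0) - A * B * (\<omega> * S1))
             + A * B * (\<omega> * S0 - (\<omega> * S1) / w) - (\<kappa> - A - B + A * B) * bigJ p \<kappa> n A B w)"
      unfolding 1 distrib_left [of "1 - 1 / (p ^ n * \<kappa>)"] 3 2 J \<omega>_def [symmetric]
      using \<kappa> w0 by (simp add: divide_simps) (simp add: algebra_simps)
  qed
qed

text \<open>D is the prefactor times the sum with weights 1 - p^j. The first relation expresses it
  by degrees n - 1 and n, which makes these two functions enough for all jumps at the left site. For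
  n = 0 it vanishes, in accordance with the factor p^n - 1.\<close>

lemma bigJ_left_site:
  obtains D where
    "(1 - p * w / p ^ n) * ((p ^ n - 1) * bigJ p \<kappa> (n - 1) A B w) = D + (p ^ n - 1) * bigJ p \<kappa> n A B w"
    "(p ^ n * \<kappa> - 1) * bigJ p \<kappa> (Suc n) A B w
       = ((p ^ n * \<kappa> - 1) * (1 - w / p ^ n) - w / p ^ n * (1 - A) * (1 - B)) * bigJ p \<kappa> n A B w
         - (\<kappa> / p - A * B * w / p ^ n) * D"
    "p * ((1 - A) * (1 - B) * (bigJ p \<kappa> n (p * A) (p * B) (w / p) - bigJ p \<kappa> n A B w))
       = (\<kappa> - p * (A * B)) * D"
    "p * (\<kappa> - A - B + A * B / \<kappa>) * (bigJ p \<kappa> n (A / p) (B / p) (w * p) - bigJ p \<kappa> n A B w)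
       = (A * B - \<kappa> * p) * ((1 - p * (A * B / \<kappa>) * w / p ^ n) * ((p ^ n - 1) * bigJ p \<kappa> (n - 1) A B w)
           - (p ^ n - 1) * bigJ p \<kappa> n A B w)"
proof -
  define \<omega> where "\<omega> = qpoch w (1 / p) n"
  define u where "u = jcoef p \<kappa> A B w"
  define e where "e = qpoch (1 / p ^ n) p"
  define N where "N = p ^ n"
  define S where "S = (\<Sum>j\<le>n. u j * e j * (1 - p ^ j))"
  define \<phi> where "\<phi> = jsum p \<kappa> n A B w"
  define R where "R = (\<Sum>j\<le>n. u (Suc j) * (1 - p * p ^ j) / p * e j)"
  define T where "T = (\<Sum>j\<le>n. u j * e (Suc j) / (1 - \<kappa> * p ^ j))"
  have N0: "N \<noteq> 0" using p0 by (simp add: N_def)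
  note J = bigJ_generic [OF w p0]
  have Jn: "bigJ p \<kappa> n A B w = \<omega> * \<phi>" by (simp add: J \<omega>_def \<phi>_def)
  \<comment> \<open>The relation for (A/p, B/p, w p) is first obtained multiplied by this factor,
    which is cancelled at the end. For n = 0 it is 1 - p w, so genericity must exclude negative
    powers of p as well.\<close>
  have pw: "1 - p * w / N \<noteq> 0"
  proof (cases n)
    case 0
    then show ?thesis using w p0 unfolding N_def generic_def
      by (metis div_by_1 eq_iff_diff_eq_0 mult.commute power_0 power_one_right)
  next
    case (Suc m)
    then show ?thesis using w_ne [of m] p0 by (simp add: N_def)
  qed
  have em: "(1 - p * w / N) * ((N - 1) * bigJ p \<kappa> (n - 1) A B w) = \<omega> * S + (N - 1) * bigJ p \<kappa> n A B w"
  proof (cases n)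
    case 0
    then show ?thesis by (simp add: N_def S_def)
  next
    case (Suc m)
    have "(N - 1) * (u j * qpoch (1 / p ^ m) p j) = u j * e j * (1 - p ^ j) + (N - 1) * (u j * e j)" for j
    proof -
      have "(1 - 1 / N) * qpoch (1 / p ^ m) p j = e j * (1 - p ^ j / N)"
        using qpoch_Suc_shift [of "1 / p ^ n" p j] qpoch_Suc [of "1 / p ^ n" p j] p0
        by (simp add: N_def e_def Suc)
      then have "(N - 1) * qpoch (1 / p ^ m) p j = e j * (N - p ^ j)"
        using N0 by (simp add: field_simps)
      then have "(N - 1) * (u j * qpoch (1 / p ^ m) p j) = u j * (e j * (N - p ^ j))"
        by (metis mult.left_commute)
      then show ?thesis by (simp add: algebra_simps)
    qed
    then have "(\<Sum>j\<le>n. (N - 1) * (u j * qpoch (1 / p ^ m) p j)) = S + (N - 1) * \<phi>"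
      by (simp only: sum.distrib S_def \<phi>_def jsum_def sum_distrib_left u_def e_def)
    moreover have "jsum p \<kappa> m A B w = (\<Sum>j\<le>n. u j * qpoch (1 / p ^ m) p j)"
      unfolding u_def by (rule jsum_extend) (use p0 Suc in auto)
    ultimately have a: "(N - 1) * jsum p \<kappa> m A B w = S + (N - 1) * \<phi>"
      by (simp only: sum_distrib_left)
    have b: "qpoch w (1 / p) m * (1 - p * w / N) = \<omega>"
      using p0 by (simp add: \<omega>_def Suc qpoch_Suc N_def power_one_over)
    have "(1 - p * w / N) * ((N - 1) * (qpoch w (1 / p) m * jsum p \<kappa> m A B w))
        = qpoch w (1 / p) m * (1 - p * w / N) * ((N - 1) * jsum p \<kappa> m A B w)"
      by (simp only: mult_ac)
    then show ?thesis
      unfolding Suc diff_Suc_1 J [of _ m] Jn [unfolded Suc] a b by (simp add: algebra_simps)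
  qed
  have D1: "jsum p \<kappa> (Suc n) A B w - \<phi> = - R / N"
    using jsum_Suc_diff [OF p \<kappa> w, of n A B] by (simp add: \<phi>_def R_def u_def e_def N_def)
  have D2: "- (N * \<kappa> - 1) * (1 - w / N) / N * R + (\<kappa> / p - A * B * w / N) * S = - w / N * (1 - A) * (1 - B) * \<phi>"
    using jsum_difference [OF p \<kappa> w, of n A B] by (simp add: \<phi>_def R_def S_def u_def e_def N_def)
  show ?thesis
  proof (rule that [of "\<omega> * S"])
    show "(1 - p * w / p ^ n) * ((p ^ n - 1) * bigJ p \<kappa> (n - 1) A B w) = \<omega> * S + (p ^ n - 1) * bigJ p \<kappa> n A B w"
      using em by (simp add: N_def)
    have "qpoch w (1 / p) (Suc n) = \<omega> * (1 - w / N)"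
      using p0 by (simp add: \<omega>_def qpoch_Suc N_def power_one_over)
    moreover have "jsum p \<kappa> (Suc n) A B w = \<phi> - R / N" using D1 by simp
    ultimately have 1: "bigJ p \<kappa> (Suc n) A B w = \<omega> * (1 - w / N) * (\<phi> - R / N)"
      by (simp only: J)
    have "(N * \<kappa> - 1) * bigJ p \<kappa> (Suc n) A B w
        = \<omega> * ((N * \<kappa> - 1) * (1 - w / N) * \<phi> + - (N * \<kappa> - 1) * (1 - w / N) / N * R)"
      unfolding 1 using N0 by (simp add: field_simps)
    also have "- (N * \<kappa> - 1) * (1 - w / N) / N * R = - w / N * (1 - A) * (1 - B) * \<phi> - (\<kappa> / p - A * B * w / N) * S"
      using D2 by simp
    finally show "(p ^ n * \<kappa> - 1) * bigJ p \<kappa> (Suc n) A B w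
       = ((p ^ n * \<kappa> - 1) * (1 - w / p ^ n) - w / p ^ n * (1 - A) * (1 - B)) * bigJ p \<kappa> n A B w
         - (\<kappa> / p - A * B * w / p ^ n) * (\<omega> * S)"
      unfolding N_def Jn by (simp add: algebra_simps)
    define Z where "Z = (\<Sum>j\<le>n. u (Suc j) * (1 - p * p ^ j) * (1 - \<kappa> * p ^ j) / p * e j)"
    have 1: "(1 - A) * (1 - B) * jsum p \<kappa> n (p * A) (p * B) (w / p) = (1 - 1 / w) * Z"
      unfolding jsum_def sum_distrib_left Z_def
      by (rule sum.cong [OF refl])
        (simp add: mult.assoc [symmetric] jcoef_shift [OF p \<kappa> w] u_def e_def)
    have "(1 - w) * qpoch (w / p) (1 / p) n = \<omega> * (1 - w / N)"
      using qpoch_Suc [of w "1 / p" n] qpoch_Suc_shift [of w "1 / p" n] by (simp add: \<omega>_def N_def power_one_over)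
    then have 2: "qpoch (w / p) (1 / p) n * (1 - 1 / w) = \<omega> * (- (1 - w / N) / w)"
      using w0 N0 by (simp add: divide_simps) (simp add: algebra_simps)
    have "(1 - A) * (1 - B) * bigJ p \<kappa> n (p * A) (p * B) (w / p)
        = qpoch (w / p) (1 / p) n * ((1 - A) * (1 - B) * jsum p \<kappa> n (p * A) (p * B) (w / p))"
      unfolding bigJ_generic [OF generic_divide [OF w p0] p0] by (simp only: mult_ac)
    also have "\<dots> = \<omega> * (- (1 - w / N) / w) * Z"
      unfolding 1 2 [symmetric] by (simp only: mult_ac)
    finally have 3: "(1 - A) * (1 - B) * bigJ p \<kappa> n (p * A) (p * B) (w / p) = \<omega> * (- (1 - w / N) / w) * Z" .
    have 4: "p * (- (1 - w / N) / w * Z - (1 - A) * (1 - B) * \<phi>) = (\<kappa> - p * (A * B)) * S"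
      using jsum_shift [OF p \<kappa> w, of n A B] by (simp only: Z_def S_def \<phi>_def u_def e_def N_def)
    have "p * ((1 - A) * (1 - B) * (bigJ p \<kappa> n (p * A) (p * B) (w / p) - bigJ p \<kappa> n A B w))
       = \<omega> * (p * (- (1 - w / N) / w * Z - (1 - A) * (1 - B) * \<phi>))"
      unfolding Jn right_diff_distrib [of "(1 - A) * (1 - B)"] 3
      by (simp only: right_diff_distrib mult_ac)
    then show "p * ((1 - A) * (1 - B) * (bigJ p \<kappa> n (p * A) (p * B) (w / p) - bigJ p \<kappa> n A B w))
       = (\<kappa> - p * (A * B)) * (\<omega> * S)"
      unfolding 4 by (simp only: mult_ac)
    have "(1 - w * p) * qpoch w (1 / p) n = qpoch (w * p) (1 / p) n * (1 - p * w / N)"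
      using qpoch_Suc [of "w * p" "1 / p" n] qpoch_Suc_shift [of "w * p" "1 / p" n] p0
      by (simp add: N_def power_one_over mult_ac)
    then have "qpoch w (1 / p) n * (1 - w * p) * x = qpoch (w * p) (1 / p) n * (1 - p * w / N) * x" for x
      by (simp only: mult.commute)
    then have 3: "(1 - p * w / N) * (qpoch (w * p) (1 / p) n * x) = qpoch w (1 / p) n * ((1 - w * p) * x)" for x
      by (simp only: mult_ac)
    have "(1 - p * w / N) * bigJ p \<kappa> n (A / p) (B / p) (w * p)
      = \<omega> * ((1 - w * p) * (\<Sum>j\<le>n. jcoef p \<kappa> (A / p) (B / p) (w * p) j * qpoch (1 / p ^ n) p j))"
      unfolding bigJ_generic [OF generic_mult [OF w p0] p0] jsum_def \<omega>_def by (rule 3)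
    also have "\<dots> = \<omega> * (w * (\<kappa> * p - A * B) * T + (1 - p * w / N) * \<phi>)"
      using jsum_shift_down [OF p \<kappa> w, of A B n] by (simp add: T_def u_def e_def N_def \<phi>_def)
    finally have 1: "(1 - p * w / N) * (bigJ p \<kappa> n (A / p) (B / p) (w * p) - bigJ p \<kappa> n A B w)
      = \<omega> * w * (\<kappa> * p - A * B) * T"
      unfolding Jn by (simp add: algebra_simps)
    define \<theta> where "\<theta> = A * B / \<kappa>"
    define k where "k = \<kappa> - A - B + \<theta>"
    have 2: "p * w * k * T = - ((1 - p * \<theta> * w / N) * (S + (N - 1) * \<phi>) - (N - 1) * (1 - p * w / N) * \<phi>)"
      using jsum_shift_down_coefficients [OF p \<kappa> w, of A B n]
      by (simp only: T_def u_def e_def N_def \<phi>_def S_def k_def \<theta>_def)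
    have em': "\<omega> * (S + (N - 1) * \<phi>) = (1 - p * w / N) * ((N - 1) * bigJ p \<kappa> (n - 1) A B w)"
      unfolding em Jn by (simp add: algebra_simps)
    have "(1 - p * w / N) * (p * k * (bigJ p \<kappa> n (A / p) (B / p) (w * p) - bigJ p \<kappa> n A B w))
       = \<omega> * (\<kappa> * p - A * B) * (p * w * k * T)"
      using arg_cong [OF 1, of "\<lambda>x. p * k * x"] by (simp add: mult_ac)
    also have "\<dots> = (A * B - \<kappa> * p) * ((1 - p * \<theta> * w / N) * (\<omega> * (S + (N - 1) * \<phi>)) - (N - 1) * (1 - p * w / N) * (\<omega> * \<phi>))"
      unfolding 2 using N0 by (simp add: field_simps)
    also have "\<dots> = (1 - p * w / N) * ((A * B - \<kappa> * p) * ((1 - p * \<theta> * w / N) * ((N - 1) * bigJ p \<kappa> (n - 1) A B w) - (N - 1) * bigJ p \<kappa> n A B w))"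
      unfolding em' Jn using N0 by (simp add: field_simps)
    finally have 3: "(1 - p * w / N) * (p * k * (bigJ p \<kappa> n (A / p) (B / p) (w * p) - bigJ p \<kappa> n A B w))
      = (1 - p * w / N) * ((A * B - \<kappa> * p) * ((1 - p * \<theta> * w / N) * ((N - 1) * bigJ p \<kappa> (n - 1) A B w) - (N - 1) * bigJ p \<kappa> n A B w))" .
    show "p * (\<kappa> - A - B + A * B / \<kappa>) * (bigJ p \<kappa> n (A / p) (B / p) (w * p) - bigJ p \<kappa> n A B w)
       = (A * B - \<kappa> * p) * ((1 - p * (A * B / \<kappa>) * w / p ^ n) * ((p ^ n - 1) * bigJ p \<kappa> (n - 1) A B w)
           - (p ^ n - 1) * bigJ p \<kappa> n A B w)"
      using 3 [unfolded mult_cancel_left] pw unfolding k_def \<theta>_def N_def by blast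
  qed
qed

end

subsection \<open>The two-site identity\<close>

text \<open>
  Here \<open>em\<close>, \<open>ep\<close> (\<open>fm\<close>, \<open>fp\<close>) stand for the factor of the left (right) site after \<open>\<eta>\<close> loses or
  gains a particle there, each with its part of the jump rate; \<open>gp\<close>, \<open>gm\<close> and \<open>hp\<close>, \<open>hm\<close> are the two
  factors after a right or left jump of \<open>\<xi>\<close>. Using the relations, both sides become bilinear forms in
  \<open>em, e0\<close> and \<open>f0, K0, K1\<close>, whose six coefficients agree.
\<close>

lemma two_site_elimination:
  fixes p \<kappa>1 \<kappa>2 A B N w m N2 em e0 D gp gm f0 K0 K1 fm fp hp hm ep k :: real
  assumes nz: "p \<noteq> 0" "\<kappa>1 \<noteq> 0" "\<kappa>2 \<noteq> 0" "A \<noteq> 0" "w \<noteq> 0" "A \<noteq> B" "A \<noteq> p * B" "B \<noteq> p * A"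
    and B: "B = \<theta> * A"
    and D: "D = (1 - p * w * A) * em - (N - 1) * e0"
    and ep: "ep = ((N * \<kappa>1 - 1) * (1 - w * A) - w * A * m) * e0 - (\<kappa>1 / p - \<kappa>1 * w * B) * D"
    and gp: "p * (m * (gp - e0)) = (\<kappa>1 - p * (\<kappa>1 * \<theta>)) * D"
    and k: "k = m - (1 - \<kappa>1) * (1 - \<theta>)"
    and gm: "p * k * (gm - e0) = (\<kappa>1 * \<theta> - \<kappa>1 * p) * ((1 - p * w * B) * em - (N - 1) * e0)"
    and hp: "(1 - B) * (hp - f0) = - (A - p * B) * (K0 - B * K1)"
    and hm: "(1 - A) * (hm - f0) = - (B - p * A) * (K0 - A * K1)"
    and N2: "N2 * f0 = f0 + (\<kappa>2 - A - B + 1 / w) * K0 + (A * B - \<kappa>2 / w) * K1"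
    and fm: "w * fm = - (K0 - \<kappa>2 * K1)"
    and fp: "fp = f0 - N2 * f0 / \<kappa>2
         + w * p / \<kappa>2 * ((\<kappa>2 - A - B) * ((A + B - 1 / w) * K0 - A * B * K1)
             + A * B * (K0 - K1 / w) - (\<kappa>2 - A - B + A * B) * f0)"
  shows "\<kappa>1 * \<kappa>2 * em * fp + p * ep * fm
      - (\<kappa>1 * \<kappa>2 * (N - 1) * (1 - N2 / \<kappa>2) + p * (1 - N2) * (N * \<kappa>1 - 1)) * e0 * f0
    = - p * A * ((A - \<kappa>2) * (1 - B) / ((A - B) * (A - p * B)) * m * (gp * hp - e0 * f0)
       + (B - \<kappa>2) * (1 - A) / ((B - A) * (B - p * A)) * k * (gm * hm - e0 * f0))"
proof -
  define P where "P = (A - \<kappa>2) * (1 - B) / ((A - B) * (A - p * B))"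
  define Q where "Q = (B - \<kappa>2) * (1 - A) / ((B - A) * (B - p * A))"
  define Y where "Y = (1 - p * w * B) * em - (N - 1) * e0"
  \<comment> \<open>The only denominator that survives: A - p B and B - p A cancel against the
    right-hand sides of the shift relations.\<close>
  define d where "d = inverse (A - B)"
  have d: "d * (A - B) = 1" using nz by (simp add: d_def)
  have nz': "A - B \<noteq> 0" "B - A \<noteq> 0" "A - p * B \<noteq> 0" "B - p * A \<noteq> 0" using nz by auto
  have cancel: "a / (y * x) * (- x * t) = - inverse y * a * t" "a / (y * x) * (x * t) = inverse y * a * t"
    if "x \<noteq> 0" "y \<noteq> 0" for a x y t :: real
    using that by (simp_all add: field_simps)
  have d': "inverse (B - A) = - d" by (metis d_def inverse_minus_eq minus_diff_eq)
  have P1: "P * (hp - f0) = - d * (A - \<kappa>2) * (K0 - B * K1)"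
  proof -
    have "P * (hp - f0) = (A - \<kappa>2) / ((A - B) * (A - p * B)) * ((1 - B) * (hp - f0))" by (simp add: P_def)
    then show ?thesis unfolding hp cancel(1) [OF nz'(3,1)] by (simp add: d_def)
  qed
  have Q1: "Q * (hm - f0) = d * (B - \<kappa>2) * (K0 - A * K1)"
  proof -
    have "Q * (hm - f0) = (B - \<kappa>2) / ((B - A) * (B - p * A)) * ((1 - A) * (hm - f0))" by (simp add: Q_def)
    then show ?thesis unfolding hm cancel(1) [OF nz'(4,2)] d' by simp
  qed
  have \<theta>: "\<theta> = B / A" using B nz by simp
  have gp': "m * (gp - e0) * A * p = \<kappa>1 * (A - p * B) * D"
    using gp nz unfolding \<theta> by (simp add: field_simps)
  have gm': "k * (gm - e0) * A * p = \<kappa>1 * (B - p * A) * Y"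
    using gm nz unfolding \<theta> Y_def [symmetric] by (simp add: field_simps)
  have P2: "P * (m * (gp - e0) * A * p) = d * (A - \<kappa>2) * (1 - B) * \<kappa>1 * D"
  proof -
    have "P * (\<kappa>1 * (A - p * B) * D) = (A - \<kappa>2) * (1 - B) / ((A - B) * (A - p * B)) * ((A - p * B) * (\<kappa>1 * D))"
      by (simp only: P_def mult_ac)
    then show ?thesis unfolding gp' cancel(2) [OF nz'(3,1)] by (simp add: d_def)
  qed
  have Q2: "Q * (k * (gm - e0) * A * p) = - d * (B - \<kappa>2) * (1 - A) * \<kappa>1 * Y"
  proof -
    have "Q * (\<kappa>1 * (B - p * A) * Y) = (B - \<kappa>2) * (1 - A) / ((B - A) * (B - p * A)) * ((B - p * A) * (\<kappa>1 * Y))"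
      by (simp only: Q_def mult_ac)
    then show ?thesis unfolding gm' cancel(2) [OF nz'(4,2)] d' by simp
  qed
  \<comment> \<open>The product rule gp hp - e0 f0 = (gp - e0) (hp - f0) + (gp - e0) f0 + e0 (hp -
    f0). In each term P meets exactly one difference that cancels its factor A - p B.\<close>
  have rhsP: "p * A * (P * m * (gp * hp - e0 * f0))
    = (m * (gp - e0) * A * p) * (P * (hp - f0)) + P * (m * (gp - e0) * A * p) * f0 + p * A * m * e0 * (P * (hp - f0))"
    by (simp add: algebra_simps)
  have rhsQ: "p * A * (Q * k * (gm * hm - e0 * f0))
    = (k * (gm - e0) * A * p) * (Q * (hm - f0)) + Q * (k * (gm - e0) * A * p) * f0 + p * A * k * e0 * (Q * (hm - f0))"
    by (simp add: algebra_simps)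
  define v where "v = 1 / w"
  have wv: "w * v = 1" using nz by (simp add: v_def)
  have fm': "fm = - v * (K0 - \<kappa>2 * K1)" using fm nz by (simp add: v_def field_simps)
  \<comment> \<open>N2 enters only through this product. Replacing it by its expression in f0, K0
    and K1 removes the degree, after which f0, K0 and K1 can be treated as independent.\<close>
  define g where "g = N2 * f0"
  have g: "g = f0 + (\<kappa>2 - A - B + v) * K0 + (A * B - \<kappa>2 * v) * K1"
    using N2 by (simp add: v_def g_def)
  have fp': "\<kappa>2 * fp = \<kappa>2 * f0 - g
         + p * ((\<kappa>2 - A - B) * ((w * (A + B) - 1) * K0 - w * A * B * K1)
             + A * B * (w * K0 - K1) - w * (\<kappa>2 - A - B + A * B) * f0)"
    unfolding fp g_def using nz by (simp add: field_simps)
  have ep': "p * ep = p * ((N * \<kappa>1 - 1) * (1 - w * A) - w * A * m) * e0 - \<kappa>1 * (1 - p * w * B) * D"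
    unfolding ep using nz by (simp add: field_simps)
  have "\<kappa>1 * \<kappa>2 * em * fp + p * ep * fm
      - (\<kappa>1 * \<kappa>2 * (N - 1) * (1 - N2 / \<kappa>2) + p * (1 - N2) * (N * \<kappa>1 - 1)) * e0 * f0
    = \<kappa>1 * em * (\<kappa>2 * fp) + (p * ep) * fm - (\<kappa>1 * (N - 1) * (\<kappa>2 * f0 - g) + p * (N * \<kappa>1 - 1) * (f0 - g)) * e0"
    unfolding g_def using nz by (simp add: field_simps)
  also have "\<dots> =
    - ((\<kappa>1 * (A - p * B) * D) * (- d * (A - \<kappa>2) * (K0 - B * K1)) + d * (A - \<kappa>2) * (1 - B) * \<kappa>1 * D * f0 + p * A * m * e0 * (- d * (A - \<kappa>2) * (K0 - B * K1)))
    - ((\<kappa>1 * (B - p * A) * Y) * (d * (B - \<kappa>2) * (K0 - A * K1)) + - d * (B - \<kappa>2) * (1 - A) * \<kappa>1 * Y * f0 + p * A * k * e0 * (d * (B - \<kappa>2) * (K0 - A * K1)))"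
  proof -
    \<comment> \<open>Passing to K0 / w and K1 / w clears the negative powers of w, so that the
      coefficients to be compared are polynomials.\<close>
    define L0 where "L0 = v * K0"
    define L1 where "L1 = v * K1"
    have L: "K0 = w * L0" "K1 = w * L1" using wv by (simp_all add: L0_def L1_def)
    have g: "g = f0 + ((\<kappa>2 - A - B) * w + 1) * L0 + (A * B * w - \<kappa>2) * L1"
      unfolding g unfolding L0_def L1_def using wv by algebra
    have fm: "fm = - (L0 - \<kappa>2 * L1)" unfolding fm' L0_def L1_def by (simp add: algebra_simps)
    have k': "p * A * k = p * (A * m - (1 - \<kappa>1) * (A - B))"
      unfolding k \<theta> using nz by (simp add: field_simps)
    define L where "L = \<kappa>1 * em * (\<kappa>2 * fp) + p * ep * fm
      - (\<kappa>1 * (N - 1) * (\<kappa>2 * f0 - g) + p * (N * \<kappa>1 - 1) * (f0 - g)) * e0"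
    define R where "R = \<kappa>1 * (A - p * B) * D * (A - \<kappa>2) * (K0 - B * K1) - (A - \<kappa>2) * (1 - B) * \<kappa>1 * D * f0
         + p * A * m * e0 * (A - \<kappa>2) * (K0 - B * K1)
         - \<kappa>1 * (B - p * A) * Y * (B - \<kappa>2) * (K0 - A * K1) + (B - \<kappa>2) * (1 - A) * \<kappa>1 * Y * f0
         - p * A * k * e0 * (B - \<kappa>2) * (K0 - A * K1)"
    define x where "x = 1 - p * w * A"
    define x' where "x' = 1 - p * w * B"
    define y where "y = N - 1"
    define g0 where "g0 = (\<kappa>2 - A - B) * w + 1"
    define g1 where "g1 = A * B * w - \<kappa>2"
    define af where "af = \<kappa>2 - 1 - p * w * (\<kappa>2 - A - B + A * B)"
    define a0 where "a0 = p * ((\<kappa>2 - A - B) * (w * (A + B) - 1) * w + A * B * w * w) - g0"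
    define a1 where "a1 = p * (- (\<kappa>2 - A - B) * w * w * A * B - A * B * w) - g1"
    define bm where "bm = - \<kappa>1 * x' * x"
    define b0 where "b0 = p * ((N * \<kappa>1 - 1) * (1 - w * A) - w * A * m) + \<kappa>1 * x' * y"
    define c where "c = \<kappa>1 * y + p * (N * \<kappa>1 - 1)"
    define \<alpha> where "\<alpha> = \<kappa>1 * (A - p * B) * (A - \<kappa>2)"
    define \<alpha>' where "\<alpha>' = \<kappa>1 * (B - p * A) * (B - \<kappa>2)"
    define \<beta> where "\<beta> = (A - \<kappa>2) * (1 - B) * \<kappa>1"
    define \<beta>' where "\<beta>' = (B - \<kappa>2) * (1 - A) * \<kappa>1"
    define \<gamma> where "\<gamma> = p * A * m * (A - \<kappa>2)"
    define \<delta> where "\<delta> = p * (A * m - (1 - \<kappa>1) * (A - B)) * (B - \<kappa>2)"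
    note defs = x_def x'_def y_def g0_def g1_def af_def a0_def a1_def bm_def b0_def c_def
      \<alpha>_def \<alpha>'_def \<beta>_def \<beta>'_def \<gamma>_def \<delta>_def
    have DY: "D = x * em - y * e0" "Y = x' * em - y * e0" by (simp_all add: D Y_def x_def x'_def y_def)
    have gg: "g = f0 + g0 * L0 + g1 * L1" by (simp add: g g0_def g1_def)
    have pe: "p * ep = bm * em + b0 * e0"
      unfolding ep' DY by (simp add: bm_def b0_def x'_def algebra_simps)
    have kf: "\<kappa>2 * fp = af * f0 + a0 * L0 + a1 * L1"
      unfolding fp' gg L by (simp add: af_def a0_def a1_def algebra_simps)
    have L_eq: "L = em * f0 * (\<kappa>1 * af) + em * L0 * (\<kappa>1 * a0 - bm) + em * L1 * (\<kappa>1 * a1 + \<kappa>2 * bm)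
      + e0 * f0 * (- (\<kappa>1 * y * (\<kappa>2 - 1))) + e0 * L0 * (c * g0 - b0) + e0 * L1 * (c * g1 + \<kappa>2 * b0)"
      unfolding L_def pe kf gg fm c_def y_def [symmetric] by (simp add: algebra_simps)
    have "R = \<alpha> * D * (K0 - B * K1) - \<beta> * D * f0 + \<gamma> * e0 * (K0 - B * K1)
        - \<alpha>' * Y * (K0 - A * K1) + \<beta>' * Y * f0 - \<delta> * e0 * (K0 - A * K1)"
      unfolding R_def k' \<alpha>_def \<alpha>'_def \<beta>_def \<beta>'_def \<gamma>_def \<delta>_def by (simp only: mult_ac)
    then have R_eq: "R = em * f0 * (\<beta>' * x' - \<beta> * x) + em * L0 * (w * (\<alpha> * x - \<alpha>' * x'))
       + em * L1 * (w * (A * \<alpha>' * x' - B * \<alpha> * x)) + e0 * f0 * (y * (\<beta> - \<beta>'))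
       + e0 * L0 * (w * (y * (\<alpha>' - \<alpha>) + \<gamma> - \<delta>)) + e0 * L1 * (w * (y * (B * \<alpha> - A * \<alpha>') - B * \<gamma> + A * \<delta>))"
      unfolding DY L by (simp add: algebra_simps)
    \<comment> \<open>Comparison of the coefficients of em f0, em L0, em L1, e0 f0, e0 L0 and e0 L1,
      each multiplied by A - B.\<close>
    have 1: "(A - B) * (\<kappa>1 * af) = \<beta>' * x' - \<beta> * x" unfolding defs by (simp add: algebra_simps)
    have 2: "(A - B) * (\<kappa>1 * a0 - bm) = w * (\<alpha> * x - \<alpha>' * x')" unfolding defs by (simp add: algebra_simps)
    have 3: "(A - B) * (\<kappa>1 * a1 + \<kappa>2 * bm) = w * (A * \<alpha>' * x' - B * \<alpha> * x)" unfolding defs by (simp add: algebra_simps)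
    have 4: "(A - B) * (- (\<kappa>1 * y * (\<kappa>2 - 1))) = y * (\<beta> - \<beta>')" unfolding defs by (simp add: algebra_simps)
    have 5: "(A - B) * (c * g0 - b0) = w * (y * (\<alpha>' - \<alpha>) + \<gamma> - \<delta>)" unfolding defs by (simp add: algebra_simps)
    have 6: "(A - B) * (c * g1 + \<kappa>2 * b0) = w * (y * (B * \<alpha> - A * \<alpha>') - B * \<gamma> + A * \<delta>)" unfolding defs by (simp add: algebra_simps)
    have "(A - B) * L = R"
      unfolding R_eq 1 [symmetric] 2 [symmetric] 3 [symmetric] 4 [symmetric] 5 [symmetric] 6 [symmetric]
      unfolding L_eq distrib_left by (simp only: mult_ac)
    then have "L = d * R" using d by (metis mult.assoc mult.commute mult.right_neutral)
    then show ?thesis unfolding L_def R_def by (simp add: algebra_simps)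
  qed
  also have "\<dots> = - (p * A * (P * m * (gp * hp - e0 * f0))) - (p * A * (Q * k * (gm * hm - e0 * f0)))"
    unfolding rhsP rhsQ P1 Q1 P2 Q2 unfolding gp' gm' ..
  finally show ?thesis unfolding P_def [symmetric] Q_def [symmetric]
    by (simp add: algebra_simps)
qed

lemma generic_divide_power: "generic p w \<Longrightarrow> p \<noteq> 0 \<Longrightarrow> generic p (w / p ^ n)"
proof (induction n)
  case (Suc n)
  then show ?case using generic_divide [of p "w / p ^ n"] by (simp add: mult.commute)
qed simp

text \<open>In the application \<theta> is q^(2 h) for the height h of \<xi> at the right site; it
  ties the parameters of both sites together, as B / A at the right and A1 B1 / \<kappa>1 at the
  left. That A is a power of p keeps w A generic.\<close>

lemma bigJ_two_site:
  fixes p \<kappa>1 \<kappa>2 w A B A1 B1 \<theta> :: real and n1 n2 x :: nat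
  assumes p: "0 < p" "p < 1" and \<kappa>1: "0 < \<kappa>1" "\<kappa>1 < 1" and \<kappa>2: "0 < \<kappa>2" "\<kappa>2 < 1"
    and w: "generic p w" and A: "A = 1 / p ^ x" and B: "B = \<theta> * A" and \<theta>: "A1 * B1 = \<kappa>1 * \<theta>"
    and ne: "A \<noteq> B" "A \<noteq> p * B" "B \<noteq> p * A"
  defines "F \<equiv> bigJ p \<kappa>1 n1 A1 B1 (w * A) * bigJ p \<kappa>2 n2 A B (w / p ^ n1)"
  shows "\<kappa>1 * \<kappa>2 * (p ^ n1 - 1) * (1 - 1 / (p ^ n2 * \<kappa>2))
        * (bigJ p \<kappa>1 (n1 - 1) A1 B1 (w * A) * bigJ p \<kappa>2 (Suc n2) A B (w / p ^ n1 * p) - F)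
      + p * (1 - 1 / p ^ n2) * (p ^ n1 * \<kappa>1 - 1)
        * (bigJ p \<kappa>1 (Suc n1) A1 B1 (w * A) * bigJ p \<kappa>2 (n2 - 1) A B (w / p ^ n1 / p) - F)
    = - p * A * ((A - \<kappa>2) * (1 - B) / ((A - B) * (A - p * B)) * ((1 - A1) * (1 - B1))
          * (bigJ p \<kappa>1 n1 (p * A1) (p * B1) (w * A / p) * bigJ p \<kappa>2 n2 (A / p) (p * B) (w / p ^ n1) - F)
       + (B - \<kappa>2) * (1 - A) / ((B - A) * (B - p * A)) * (\<kappa>1 - A1 - B1 + \<theta>)
          * (bigJ p \<kappa>1 n1 (A1 / p) (B1 / p) (w * A * p) * bigJ p \<kappa>2 n2 (p * A) (B / p) (w / p ^ n1) - F))"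
proof -
  have p0: "p \<noteq> 0" and \<kappa>0: "\<kappa>1 \<noteq> 0" "\<kappa>2 \<noteq> 0" and A0: "A \<noteq> 0" using p \<kappa>1 \<kappa>2 A by auto
  have g1: "generic p (w * A)" and g2: "generic p (w / p ^ n1)"
    using generic_divide_power [OF w p0] by (simp_all add: A)
  obtain K0 K1 where 1:
    "(1 - B) * (bigJ p \<kappa>2 n2 (A / p) (p * B) (w / p ^ n1) - bigJ p \<kappa>2 n2 A B (w / p ^ n1)) = - (A - p * B) * (K0 - B * K1)"
    "(1 - A) * (bigJ p \<kappa>2 n2 (p * A) (B / p) (w / p ^ n1) - bigJ p \<kappa>2 n2 A B (w / p ^ n1)) = - (B - p * A) * (K0 - A * K1)"
    "(1 / p ^ n2 - 1) * bigJ p \<kappa>2 n2 A B (w / p ^ n1) = (\<kappa>2 - A - B + 1 / (w / p ^ n1)) * K0 + (A * B - \<kappa>2 / (w / p ^ n1)) * K1"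
    "w / p ^ n1 * ((1 - 1 / p ^ n2) * bigJ p \<kappa>2 (n2 - 1) A B (w / p ^ n1 / p)) = - (K0 - \<kappa>2 * K1)"
    "(1 - 1 / (p ^ n2 * \<kappa>2)) * bigJ p \<kappa>2 (Suc n2) A B (w / p ^ n1 * p)
       = (1 - 1 / (p ^ n2 * \<kappa>2)) * bigJ p \<kappa>2 n2 A B (w / p ^ n1)
         + w / p ^ n1 * p / \<kappa>2 * ((\<kappa>2 - A - B) * ((A + B - 1 / (w / p ^ n1)) * K0 - A * B * K1)
             + A * B * (K0 - K1 / (w / p ^ n1)) - (\<kappa>2 - A - B + A * B) * bigJ p \<kappa>2 n2 A B (w / p ^ n1))"
    by (rule bigJ_right_site [OF p \<kappa>2 g2, where n = n2 and A = A and B = B])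
  obtain D where 2:
    "(1 - p * (w * A) / p ^ n1) * ((p ^ n1 - 1) * bigJ p \<kappa>1 (n1 - 1) A1 B1 (w * A)) = D + (p ^ n1 - 1) * bigJ p \<kappa>1 n1 A1 B1 (w * A)"
    "(p ^ n1 * \<kappa>1 - 1) * bigJ p \<kappa>1 (Suc n1) A1 B1 (w * A)
       = ((p ^ n1 * \<kappa>1 - 1) * (1 - (w * A) / p ^ n1) - (w * A) / p ^ n1 * (1 - A1) * (1 - B1)) * bigJ p \<kappa>1 n1 A1 B1 (w * A)
         - (\<kappa>1 / p - A1 * B1 * (w * A) / p ^ n1) * D"
    "p * ((1 - A1) * (1 - B1) * (bigJ p \<kappa>1 n1 (p * A1) (p * B1) (w * A / p) - bigJ p \<kappa>1 n1 A1 B1 (w * A)))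
       = (\<kappa>1 - p * (A1 * B1)) * D"
    "p * (\<kappa>1 - A1 - B1 + A1 * B1 / \<kappa>1) * (bigJ p \<kappa>1 n1 (A1 / p) (B1 / p) (w * A * p) - bigJ p \<kappa>1 n1 A1 B1 (w * A))
       = (A1 * B1 - \<kappa>1 * p) * ((1 - p * (A1 * B1 / \<kappa>1) * (w * A) / p ^ n1) * ((p ^ n1 - 1) * bigJ p \<kappa>1 (n1 - 1) A1 B1 (w * A))
           - (p ^ n1 - 1) * bigJ p \<kappa>1 n1 A1 B1 (w * A))"
    by (rule bigJ_left_site [OF p \<kappa>1 g1, where n = n1 and A = A1 and B = B1])
  define N where "N = p ^ n1"
  define u where "u = w / N"
  define N2 where "N2 = 1 / p ^ n2"
  define e0 where "e0 = bigJ p \<kappa>1 n1 A1 B1 (w * A)"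
  define em where "em = (N - 1) * bigJ p \<kappa>1 (n1 - 1) A1 B1 (w * A)"
  define ep where "ep = (N * \<kappa>1 - 1) * bigJ p \<kappa>1 (Suc n1) A1 B1 (w * A)"
  define gp where "gp = bigJ p \<kappa>1 n1 (p * A1) (p * B1) (w * A / p)"
  define gm where "gm = bigJ p \<kappa>1 n1 (A1 / p) (B1 / p) (w * A * p)"
  define f0 where "f0 = bigJ p \<kappa>2 n2 A B u"
  define fp where "fp = (1 - N2 / \<kappa>2) * bigJ p \<kappa>2 (Suc n2) A B (u * p)"
  define fm where "fm = (1 - N2) * bigJ p \<kappa>2 (n2 - 1) A B (u / p)"
  define hp where "hp = bigJ p \<kappa>2 n2 (A / p) (p * B) u"
  define hm where "hm = bigJ p \<kappa>2 n2 (p * A) (B / p) u"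
  define m where "m = (1 - A1) * (1 - B1)"
  define k where "k = \<kappa>1 - A1 - B1 + \<theta>"
  have u0: "u \<noteq> 0" using g2 by (simp add: u_def N_def generic_def)
  have wA: "w * A / N = u * A" "p * (w * A) / N = p * u * A" by (simp_all add: u_def)
  have \<theta>1: "A1 * B1 / \<kappa>1 = \<theta>" using \<theta> \<kappa>0 by simp
  have N2': "1 / (p ^ n2 * \<kappa>2) = N2 / \<kappa>2" by (simp add: N2_def)
  have "\<kappa>1 * \<kappa>2 * em * fp + p * ep * fm
      - (\<kappa>1 * \<kappa>2 * (N - 1) * (1 - N2 / \<kappa>2) + p * (1 - N2) * (N * \<kappa>1 - 1)) * e0 * f0
    = - p * A * ((A - \<kappa>2) * (1 - B) / ((A - B) * (A - p * B)) * m * (gp * hp - e0 * f0)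
       + (B - \<kappa>2) * (1 - A) / ((B - A) * (B - p * A)) * k * (gm * hm - e0 * f0))"
  proof (rule two_site_elimination)
    show "p \<noteq> 0" "\<kappa>1 \<noteq> 0" "\<kappa>2 \<noteq> 0" "A \<noteq> 0" "u \<noteq> 0" "A \<noteq> B" "A \<noteq> p * B" "B \<noteq> p * A" "B = \<theta> * A"
      by fact+
    show "D = (1 - p * u * A) * em - (N - 1) * e0"
      using 2(1) unfolding em_def e0_def N_def [symmetric] wA by simp
    show "ep = ((N * \<kappa>1 - 1) * (1 - u * A) - u * A * m) * e0 - (\<kappa>1 / p - \<kappa>1 * u * B) * D"
    proof -
      have "w * A / N * (1 - A1) * (1 - B1) = u * A * m" "A1 * B1 * (w * A) / N = \<kappa>1 * u * B"
        unfolding \<theta> by (simp_all add: u_def m_def B)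
      then show ?thesis
        using 2(2) unfolding N_def [symmetric] ep_def [symmetric] e0_def [symmetric] wA(1) by simp
    qed
    show "p * (m * (gp - e0)) = (\<kappa>1 - p * (\<kappa>1 * \<theta>)) * D"
      using 2(3) unfolding gp_def e0_def m_def \<theta> .
    show "k = m - (1 - \<kappa>1) * (1 - \<theta>)"
      using \<theta> by (simp add: k_def m_def algebra_simps)
    have "p * \<theta> * (w * A) / N = p * u * B" by (simp add: u_def B)
    then show "p * k * (gm - e0) = (\<kappa>1 * \<theta> - \<kappa>1 * p) * ((1 - p * u * B) * em - (N - 1) * e0)"
      using 2(4) unfolding \<theta>1 unfolding \<theta> gm_def e0_def k_def em_def N_def [symmetric] by simp
    show "(1 - B) * (hp - f0) = - (A - p * B) * (K0 - B * K1)"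
      using 1(1) unfolding hp_def f0_def u_def N_def .
    show "(1 - A) * (hm - f0) = - (B - p * A) * (K0 - A * K1)"
      using 1(2) unfolding hm_def f0_def u_def N_def .
    show "N2 * f0 = f0 + (\<kappa>2 - A - B + 1 / u) * K0 + (A * B - \<kappa>2 / u) * K1"
      using 1(3) unfolding N_def [symmetric] u_def [symmetric] f0_def [symmetric] N2_def [symmetric]
      by (simp add: algebra_simps)
    show "u * fm = - (K0 - \<kappa>2 * K1)"
      using 1(4) unfolding N_def [symmetric] u_def [symmetric] fm_def N2_def .
    show "fp = f0 - N2 * f0 / \<kappa>2
         + u * p / \<kappa>2 * ((\<kappa>2 - A - B) * ((A + B - 1 / u) * K0 - A * B * K1)
             + A * B * (K0 - K1 / u) - (\<kappa>2 - A - B + A * B) * f0)"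
      using 1(5) unfolding N_def [symmetric] u_def [symmetric] f0_def [symmetric] N2' fp_def [symmetric]
      by (simp add: left_diff_distrib)
  qed
  note main = this
  have F: "F = e0 * f0" by (simp add: F_def e0_def f0_def u_def N_def)
  \<comment> \<open>Each factor of a rate is attached to the shifted function it multiplies, because
    the one-site relations determine only these products.\<close>
  have aux: "K * P * R * (a * b - F) + p * S * T * (c * d - F)
    = K * (P * a) * (R * b) + p * (T * c) * (S * d) - (K * P * R + p * S * T) * F" for K P R S T a b c d :: real
    by (simp add: algebra_simps)
  show ?thesis
    unfolding aux
    unfolding N_def [symmetric] u_def [symmetric] N2_def [symmetric] N2'
      gp_def [symmetric] gm_def [symmetric] hp_def [symmetric] hm_def [symmetric] m_def [symmetric] k_def [symmetric]
      em_def [symmetric] ep_def [symmetric] fm_def [symmetric] fp_def [symmetric] F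
    using main by (simp only: mult.assoc)
qed

subsection \<open>One-site functions as polynomials in \<open>v\<close>\<close>

lemma qhyp_finite:
  assumes "u \<in> set us" "u * q ^ m = 1"
  shows "qhyp us ws q z =
    (\<Sum>n\<le>m. (\<Prod>u\<leftarrow>us. qpoch u q n) / (\<Prod>w\<leftarrow>ws. qpoch w q n) * (z ^ n / qpoch q q n))"
  unfolding qhyp_def
proof (rule suminf_finite)
  fix n assume "n \<notin> {..m}"
  then have "qpoch u q n = 0" using assms(2) by (auto simp: qpoch_eq_0_iff intro!: exI [of _ m])
  then have "(\<Prod>u\<leftarrow>us. qpoch u q n) = 0"
    using assms(1) by (auto simp: prod_list_zero_iff)
  then show "(\<Prod>u\<leftarrow>us. qpoch u q n) / (\<Prod>w\<leftarrow>ws. qpoch w q n) * (z ^ n / qpoch q q n) = 0"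
    by simp
qed simp

text \<open>The limit ignores the value at v itself, so it suffices that f agrees with a convergent
  g in a punctured neighbourhood.\<close>

lemma cont_ext_eqI:
  assumes "(g \<longlongrightarrow> c) (at v)" "\<forall>\<^sub>F x in at v. f x = g x"
  shows "cont_ext f v = c"
  unfolding cont_ext_def
  by (rule tendsto_Lim) (use assms in \<open>auto simp: tendsto_cong\<close>)

lemma eventually_at_notin_finite:
  fixes v :: "'a :: t1_space"
  assumes "finite S"
  shows "\<forall>\<^sub>F x in at v. x \<notin> S"
proof -
  have "open (- (S - {v}))" using assms by (intro open_Compl finite_imp_closed) auto
  then show ?thesis unfolding eventually_at_topological by (intro exI [of _ "- (S - {v})"]) auto
qed

lemma tendsto_qpoch:
  "(a \<longlongrightarrow> a') F \<Longrightarrow> ((\<lambda>t. qpoch (a t) p i) \<longlongrightarrow> qpoch a' p i) F"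
  unfolding qpoch_def by (intro tendsto_intros)

lemma tendsto_tail_poch:
  "(w \<longlongrightarrow> w') F \<Longrightarrow> ((\<lambda>t. tail_poch p n i (w t)) \<longlongrightarrow> tail_poch p n i w') F"
  unfolding tail_poch_def divide_inverse by (intro tendsto_intros)

lemma tendsto_bigJ:
  assumes "(A \<longlongrightarrow> A') F" "(B \<longlongrightarrow> B') F" "(w \<longlongrightarrow> w') F"
  shows "((\<lambda>t. bigJ p \<kappa> n (A t) (B t) (w t)) \<longlongrightarrow> bigJ p \<kappa> n A' B' w') F"
proof -
  define c where "c = (\<lambda>i. qpoch (1 / p ^ n) p i / (qpoch p p i * qpoch \<kappa> p i) * p ^ i)"
  have eq: "bigJ p \<kappa> n a b u = (\<Sum>i\<le>n. c i * (qpoch a p i * qpoch b p i * tail_poch p n i u))" for a b u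
    unfolding bigJ_def c_def by (intro sum.cong refl) simp
  show ?thesis
    unfolding eq
    by (intro tendsto_sum tendsto_mult_left tendsto_mult tendsto_qpoch tendsto_tail_poch assms)
qed

lemma powr_even_eq:
  assumes "0 < (q :: real)"
  shows "q powi 2 = q ^ 2" "q powi (- 2) = 1 / q ^ 2" "q powr (- 2 * real n) = 1 / (q ^ 2) ^ n"
    "q powr (2 * real n) = (q ^ 2) ^ n"
proof -
  show "q powr (2 * real n) = (q ^ 2) ^ n"
    using powr_realpow [OF assms, of "2 * n"] by (simp add: power_mult)
  then show "q powr (- 2 * real n) = 1 / (q ^ 2) ^ n"
    by (simp add: powr_minus_divide)
  show "q powi (- 2) = 1 / q ^ 2" by (simp add: power_int_def divide_inverse power_inverse)
qed (simp add: power_int_def)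

text \<open>The two conditions say that a lower parameter 1/(x c), respectively x d, produces no
  zero in the terms concerned. A bound n = 0 or m = 0 switches one of them off.\<close>

lemma eventually_generic_parameter:
  fixes c v p :: real
  assumes "c \<noteq> 0"
  shows "\<forall>\<^sub>F x in at v. x \<noteq> 0 \<and> (\<forall>i<n. p ^ i \<noteq> x * c) \<and> (\<forall>i<m. p ^ i * (x * d) \<noteq> 1)"
proof -
  have "finite ({0} \<union> (\<lambda>i. p ^ i / c) ` {..<n} \<union> (\<lambda>i. 1 / (p ^ i * d)) ` {..<m})" by simp
  from eventually_at_notin_finite [OF this] show ?thesis
  proof (rule eventually_mono)
    fix x assume x: "x \<notin> {0} \<union> (\<lambda>i. p ^ i / c) ` {..<n} \<union> (\<lambda>i. 1 / (p ^ i * d)) ` {..<m}"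
    have "p ^ i * (x * d) \<noteq> 1" if "i < m" for i
    proof
      assume "p ^ i * (x * d) = 1"
      then have "x = 1 / (p ^ i * d)" by (metis mult.commute mult.left_commute nonzero_eq_divide_eq mult_zero_left zero_neq_one mult_zero_right)
      then show False using x that by auto
    qed
    moreover have "p ^ i \<noteq> x * c" if "i < n" for i
    proof
      assume "p ^ i = x * c"
      then have "x = p ^ i / c" using assms by simp
      then show False using x that by auto
    qed
    ultimately show "x \<noteq> 0 \<and> (\<forall>i<n. p ^ i \<noteq> x * c) \<and> (\<forall>i<m. p ^ i * (x * d) \<noteq> 1)"
      using x by auto
  qed
qed

lemma p_J_eq_bigJ:
  assumes q: "0 < q" and v: "v \<noteq> 0"
  shows "p_J n x l \<rho> v k q = bigJ (q ^ 2) (q powr (2 * k)) n (1 / (q ^ 2) ^ x)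
    (q powr (2 * real x + 2 * \<rho> + 2 * k)) (v * q powr (- l - \<rho> - k - 1))"
  unfolding p_J_def powr_even_eq [OF q]
proof (rule cont_ext_eqI)
  define p where "p = q ^ 2"
  define c where "c = q powr (- l - \<rho> - k - 1)"
  have p0: "p \<noteq> 0" and c0: "c \<noteq> 0" using q by (auto simp: p_def c_def)
  have c: "inverse y * q powr (\<rho> + l + k + 1) = 1 / (y * c)" for y
    using powr_minus [of q "- l - \<rho> - k - 1"] by (simp add: c_def divide_inverse algebra_simps)
  show "((\<lambda>v. bigJ (q ^ 2) (q powr (2 * k)) n (1 / (q ^ 2) ^ x) (q powr (2 * real x + 2 * \<rho> + 2 * k)) (v * q powr (- l - \<rho> - k - 1)))
    \<longlongrightarrow> bigJ (q ^ 2) (q powr (2 * k)) n (1 / (q ^ 2) ^ x) (q powr (2 * real x + 2 * \<rho> + 2 * k)) (v * q powr (- l - \<rho> - k - 1))) (at v)"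
    by (intro tendsto_bigJ tendsto_intros)
  have e: "\<forall>\<^sub>F y in at v. y \<noteq> 0 \<and> (\<forall>i<n. p ^ i \<noteq> y * c) \<and> (\<forall>i<0. p ^ i * (y * 0) \<noteq> 1)"
    by (rule eventually_generic_parameter [OF c0])
  show "\<forall>\<^sub>F v in at v. qpoch (v * q powr (- l - \<rho> - k - 1)) (1 / q ^ 2) n *
       qhyp [1 / (q ^ 2) ^ x, q powr (2 * real x + 2 * \<rho> + 2 * k), 1 / (q ^ 2) ^ n] [q powr (2 * k), inverse v * q powr (\<rho> + l + k + 1)] (q ^ 2) (q ^ 2)
     = bigJ (q ^ 2) (q powr (2 * k)) n (1 / (q ^ 2) ^ x) (q powr (2 * real x + 2 * \<rho> + 2 * k)) (v * q powr (- l - \<rho> - k - 1))"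
    using e
  proof (rule eventually_mono)
    fix y assume y: "y \<noteq> 0 \<and> (\<forall>i<n. p ^ i \<noteq> y * c) \<and> (\<forall>i<0. p ^ i * (y * 0) \<noteq> 1)"
    have "qhyp [1 / p ^ x, q powr (2 * real x + 2 * \<rho> + 2 * k), 1 / p ^ n] [q powr (2 * k), inverse y * q powr (\<rho> + l + k + 1)] p p
      = jsum p (q powr (2 * k)) n (1 / p ^ x) (q powr (2 * real x + 2 * \<rho> + 2 * k)) (y * c)"
      unfolding jsum_def jcoef_def c
      by (subst qhyp_finite [of "1 / p ^ n" _ _ n]) (use p0 in \<open>auto intro!: sum.cong simp: mult_ac\<close>)
    then show "qpoch (y * q powr (- l - \<rho> - k - 1)) (1 / q ^ 2) n *
       qhyp [1 / (q ^ 2) ^ x, q powr (2 * real x + 2 * \<rho> + 2 * k), 1 / (q ^ 2) ^ n] [q powr (2 * k), inverse y * q powr (\<rho> + l + k + 1)] (q ^ 2) (q ^ 2)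
     = bigJ (q ^ 2) (q powr (2 * k)) n (1 / (q ^ 2) ^ x) (q powr (2 * real x + 2 * \<rho> + 2 * k)) (y * q powr (- l - \<rho> - k - 1))"
      unfolding p_def [symmetric] c_def [symmetric]
      by (subst bigJ_eq) (use y p0 c0 in auto)
  qed
qed

text \<open>The upper parameter 0 is the case B = 0, and v and 1/v have changed places compared with
  big q-Jacobi; so big q-Laguerre needs no polynomial of its own.\<close>

lemma p_L_eq_bigJ:
  assumes q: "0 < q" and v: "v \<noteq> 0"
  shows "p_L n x l \<rho> v k q = bigJ (q ^ 2) (q powr (2 * k)) n (1 / (q ^ 2) ^ x) 0
    (inverse v * q powr (- l - \<rho> - k - 1))"
  unfolding p_L_def powr_even_eq [OF q]
proof (rule cont_ext_eqI)
  define p where "p = q ^ 2"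
  define d where "d = q powr (\<rho> + l + k + 1)"
  define c where "c = q powr (- l - \<rho> - k - 1)"
  have p0: "p \<noteq> 0" and d0: "d \<noteq> 0" and c0: "c \<noteq> 0" using q by (auto simp: p_def d_def c_def)
  have "d * c = 1" using q by (simp add: c_def d_def powr_add [symmetric])
  then have c: "c = 1 / d" using d0 by (simp add: field_simps)
  show "((\<lambda>v. bigJ (q ^ 2) (q powr (2 * k)) n (1 / (q ^ 2) ^ x) 0 (inverse v * q powr (- l - \<rho> - k - 1)))
    \<longlongrightarrow> bigJ (q ^ 2) (q powr (2 * k)) n (1 / (q ^ 2) ^ x) 0 (inverse v * q powr (- l - \<rho> - k - 1))) (at v)"
    by (intro tendsto_bigJ tendsto_intros v)
  have e: "\<forall>\<^sub>F y in at v. y \<noteq> 0 \<and> (\<forall>i<0. p ^ i \<noteq> y * 1) \<and> (\<forall>i<n. p ^ i * (y * d) \<noteq> 1)"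
    by (rule eventually_generic_parameter) simp
  show "\<forall>\<^sub>F v in at v. qpoch (inverse v * q powr (- l - \<rho> - k - 1)) (1 / q ^ 2) n *
       qhyp [1 / (q ^ 2) ^ x, 0, 1 / (q ^ 2) ^ n] [q powr (2 * k), v * q powr (\<rho> + l + k + 1)] (q ^ 2) (q ^ 2)
     = bigJ (q ^ 2) (q powr (2 * k)) n (1 / (q ^ 2) ^ x) 0 (inverse v * q powr (- l - \<rho> - k - 1))"
    using e
  proof (rule eventually_mono)
    fix y assume y: "y \<noteq> 0 \<and> (\<forall>i<0. p ^ i \<noteq> y * 1) \<and> (\<forall>i<n. p ^ i * (y * d) \<noteq> 1)"
    have yd: "y * d = 1 / (inverse y * c)" using d0 by (simp add: c divide_inverse)
    have "qhyp [1 / p ^ x, 0, 1 / p ^ n] [q powr (2 * k), y * d] p p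
      = jsum p (q powr (2 * k)) n (1 / p ^ x) 0 (inverse y * c)"
      unfolding jsum_def jcoef_def yd
      by (subst qhyp_finite [of "1 / p ^ n" _ _ n]) (use p0 in \<open>auto intro!: sum.cong simp: mult_ac\<close>)
    moreover have "p ^ i \<noteq> inverse y * c" if "i < n" for i
      using y that d0 p0 unfolding c by (auto simp: field_simps)
    ultimately show "qpoch (inverse y * q powr (- l - \<rho> - k - 1)) (1 / q ^ 2) n *
       qhyp [1 / (q ^ 2) ^ x, 0, 1 / (q ^ 2) ^ n] [q powr (2 * k), y * q powr (\<rho> + l + k + 1)] (q ^ 2) (q ^ 2)
     = bigJ (q ^ 2) (q powr (2 * k)) n (1 / (q ^ 2) ^ x) 0 (inverse y * q powr (- l - \<rho> - k - 1))"
      unfolding p_def [symmetric] c_def [symmetric] d_def [symmetric]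
      by (subst bigJ_eq) (use y p0 c0 in auto)
  qed
qed

text \<open>The last product is (z; p)_x / (z; p)_i for i \<le> x. For i > x it is empty, but (A;
  p)_i vanishes there because A = p^(-x) in the application.\<close>

definition bigAW ::
  "real \<Rightarrow> real \<Rightarrow> nat \<Rightarrow> nat \<Rightarrow> real \<Rightarrow> real \<Rightarrow> real \<Rightarrow> real \<Rightarrow> real \<Rightarrow> real" where
  "bigAW p \<kappa> n x A B C w z =
     (\<Sum>i\<le>n. qpoch A p i * qpoch B p i * qpoch C p i * qpoch (1 / p ^ n) p i / (qpoch p p i * qpoch \<kappa> p i)
        * p ^ i * tail_poch p n i w * (\<Prod>m=i..<x. 1 - z * p ^ m))"

lemma tendsto_bigAW:
  assumes "(C \<longlongrightarrow> C') F" "(w \<longlongrightarrow> w') F" "(z \<longlongrightarrow> z') F"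
  shows "((\<lambda>t. bigAW p \<kappa> n x A B (C t) (w t) (z t)) \<longlongrightarrow> bigAW p \<kappa> n x A B C' w' z') F"
proof -
  define c where "c = (\<lambda>i. qpoch A p i * qpoch B p i * qpoch (1 / p ^ n) p i / (qpoch p p i * qpoch \<kappa> p i) * p ^ i)"
  have eq: "bigAW p \<kappa> n x A B a b d = (\<Sum>i\<le>n. c i * (qpoch a p i * tail_poch p n i b * (\<Prod>m=i..<x. 1 - d * p ^ m)))" for a b d
    unfolding bigAW_def c_def by (intro sum.cong refl) simp
  show ?thesis
    unfolding eq
    by (intro tendsto_sum tendsto_mult_left tendsto_mult tendsto_qpoch tendsto_tail_poch tendsto_prod tendsto_diff
      tendsto_mult_right tendsto_const assms)
qed

lemma bigAW_0: "bigAW p \<kappa> n x A B 0 w 0 = bigJ p \<kappa> n A B w"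
  unfolding bigAW_def bigJ_def by (simp add: qpoch_def)

lemma p_AW_eq_bigAW:
  assumes q: "0 < q" and v: "v \<noteq> 0"
  shows "p_AW y x l \<rho> v k q = bigAW (q ^ 2) (q powr (2 * k)) y x (1 / (q ^ 2) ^ x)
    (q powr (2 * real x + 2 * \<rho> + 2 * k)) (q powr (2 * real y + 2 * l + 2 * k))
    (v * q powr (- \<rho> - l - k - 1)) (v * q powr (\<rho> + l + k + 1))"
  unfolding p_AW_def powr_even_eq [OF q]
proof (rule cont_ext_eqI)
  define p where "p = q ^ 2"
  define d where "d = q powr (\<rho> + l + k + 1)"
  define c where "c = q powr (- \<rho> - l - k - 1)"
  define A where "A = 1 / p ^ x"
  define B where "B = q powr (2 * real x + 2 * \<rho> + 2 * k)"
  define C where "C = q powr (2 * real y + 2 * l + 2 * k)"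
  define \<kappa> where "\<kappa> = q powr (2 * k)"
  have p0: "p \<noteq> 0" and c0: "c \<noteq> 0" using q by (auto simp: p_def c_def)
  have "d * c = 1" using q by (simp add: c_def d_def powr_add [symmetric])
  then have c: "d = 1 / c" using c0 by (simp add: field_simps)
  show "((\<lambda>v. bigAW (q ^ 2) (q powr (2 * k)) y x (1 / (q ^ 2) ^ x)
    (q powr (2 * real x + 2 * \<rho> + 2 * k)) (q powr (2 * real y + 2 * l + 2 * k))
    (v * q powr (- \<rho> - l - k - 1)) (v * q powr (\<rho> + l + k + 1)))
    \<longlongrightarrow> bigAW (q ^ 2) (q powr (2 * k)) y x (1 / (q ^ 2) ^ x)
    (q powr (2 * real x + 2 * \<rho> + 2 * k)) (q powr (2 * real y + 2 * l + 2 * k))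
    (v * q powr (- \<rho> - l - k - 1)) (v * q powr (\<rho> + l + k + 1))) (at v)"
    by (intro tendsto_bigJ tendsto_bigAW tendsto_intros)
  have e: "\<forall>\<^sub>F u in at v. u \<noteq> 0 \<and> (\<forall>i<y. p ^ i \<noteq> u * c) \<and> (\<forall>i<x. p ^ i * (u * d) \<noteq> 1)"
    by (rule eventually_generic_parameter [OF c0])
  show "\<forall>\<^sub>F v in at v. qpoch (v * q powr (\<rho> + l + k + 1)) (q ^ 2) x * qpoch (v * q powr (- \<rho> - l - k - 1)) (1 / q ^ 2) y *
       qhyp [1 / (q ^ 2) ^ y, q powr (2 * real y + 2 * l + 2 * k), 1 / (q ^ 2) ^ x, q powr (2 * real x + 2 * \<rho> + 2 * k)]
          [q powr (2 * k), v * q powr (\<rho> + l + k + 1), inverse v * q powr (\<rho> + l + k + 1)] (q ^ 2) (q ^ 2)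
     = bigAW (q ^ 2) (q powr (2 * k)) y x (1 / (q ^ 2) ^ x)
    (q powr (2 * real x + 2 * \<rho> + 2 * k)) (q powr (2 * real y + 2 * l + 2 * k))
    (v * q powr (- \<rho> - l - k - 1)) (v * q powr (\<rho> + l + k + 1))"
    using e
  proof (rule eventually_mono)
    fix u assume u: "u \<noteq> 0 \<and> (\<forall>i<y. p ^ i \<noteq> u * c) \<and> (\<forall>i<x. p ^ i * (u * d) \<noteq> 1)"
    define w where "w = u * c"
    define z where "z = u * d"
    have uw: "inverse u * d = 1 / w" by (simp add: c w_def divide_inverse)
    have w0: "w \<noteq> 0" using u c0 by (simp add: w_def)
    have "qpoch z p x * qpoch w (1 / p) y * qhyp [1 / p ^ y, C, A, B] [\<kappa>, z, 1 / w] p p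
      = (\<Sum>i\<le>y. qpoch z p x * qpoch w (1 / p) y * (qpoch (1 / p ^ y) p i * qpoch C p i * qpoch A p i * qpoch B p i
           / (qpoch \<kappa> p i * qpoch z p i * qpoch (1 / w) p i) * (p ^ i / qpoch p p i)))"
      by (subst qhyp_finite [of "1 / p ^ y" _ _ y]) (use p0 in \<open>auto intro!: sum.cong simp: mult_ac sum_distrib_left\<close>)
    also have "\<dots> = bigAW p \<kappa> y x A B C w z"
      unfolding bigAW_def
    proof (rule sum.cong [OF refl])
      fix i assume "i \<in> {..y}"
      then have i: "i \<le> y" by simp
      show "qpoch z p x * qpoch w (1 / p) y * (qpoch (1 / p ^ y) p i * qpoch C p i * qpoch A p i * qpoch B p i
           / (qpoch \<kappa> p i * qpoch z p i * qpoch (1 / w) p i) * (p ^ i / qpoch p p i))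
        = qpoch A p i * qpoch B p i * qpoch C p i * qpoch (1 / p ^ y) p i / (qpoch p p i * qpoch \<kappa> p i)
        * p ^ i * tail_poch p y i w * (\<Prod>m=i..<x. 1 - z * p ^ m)"
      proof (cases "i \<le> x")
        case False
        then have "qpoch A p i = 0" using p0 by (simp add: A_def qpoch_inverse_power_eq_0)
        then show ?thesis by simp
      next
        case True
        have "qpoch z p x = qpoch z p i * (\<Prod>m=i..<x. 1 - z * p ^ m)"
          using prod.atLeastLessThan_concat [of 0 i x "\<lambda>m. 1 - z * p ^ m"] True by (simp add: lessThan_atLeast0 qpoch_def)
        moreover have "qpoch z p i \<noteq> 0" using u True by (auto simp: qpoch_eq_0_iff z_def mult.commute)
        moreover have "p ^ j \<noteq> w" if "j < i" for j
          using u i that unfolding w_def by simp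
        then have "qpoch (1 / w) p i \<noteq> 0" using w0 by (auto simp: qpoch_eq_0_iff)
        moreover note tail_poch_eq [OF p0 w0 i, symmetric]
        ultimately show ?thesis by (simp add: mult_ac)
      qed
    qed
    finally show "qpoch (u * q powr (\<rho> + l + k + 1)) (q ^ 2) x * qpoch (u * q powr (- \<rho> - l - k - 1)) (1 / q ^ 2) y *
       qhyp [1 / (q ^ 2) ^ y, q powr (2 * real y + 2 * l + 2 * k), 1 / (q ^ 2) ^ x, q powr (2 * real x + 2 * \<rho> + 2 * k)]
          [q powr (2 * k), u * q powr (\<rho> + l + k + 1), inverse u * q powr (\<rho> + l + k + 1)] (q ^ 2) (q ^ 2)
     = bigAW (q ^ 2) (q powr (2 * k)) y x (1 / (q ^ 2) ^ x)
    (q powr (2 * real x + 2 * \<rho> + 2 * k)) (q powr (2 * real y + 2 * l + 2 * k))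
    (u * q powr (- \<rho> - l - k - 1)) (u * q powr (\<rho> + l + k + 1))"
      unfolding p_def [symmetric] c_def [symmetric] d_def [symmetric] A_def [symmetric] B_def [symmetric]
        C_def [symmetric] \<kappa>_def [symmetric] w_def [symmetric] z_def [symmetric] uw .
  qed
qed

lemma powr_at_top_tendsto_0:
  fixes q a c :: real
  assumes "0 < q" "q < 1" "0 < a"
  shows "((\<lambda>x. q powr (a * x + c)) \<longlongrightarrow> 0) at_top"
proof -
  have "ln q < 0" using assms by simp
  have "filterlim (\<lambda>x. a * x + c) at_top at_top"
    using filterlim_tendsto_add_at_top [OF tendsto_const [of c]
        filterlim_tendsto_pos_mult_at_top [OF tendsto_const assms(3) filterlim_ident]]
    by (simp add: add.commute)
  then have "filterlim (\<lambda>x. (- ln q) * (a * x + c)) at_top at_top"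
    by (intro filterlim_tendsto_pos_mult_at_top [OF tendsto_const]) (use \<open>ln q < 0\<close> in auto)
  then have "filterlim (\<lambda>x. ln q * (a * x + c)) at_bot at_top"
    by (subst filterlim_uminus_at_bot) simp
  then have "((\<lambda>x. exp (ln q * (a * x + c))) \<longlongrightarrow> 0) at_top"
    by (rule filterlim_compose [OF exp_at_bot])
  then show ?thesis using assms by (simp add: powr_def mult.commute)
qed

lemma powr_at_bot_tendsto_0:
  fixes q a c :: real
  assumes "0 < q" "q < 1" "a < 0"
  shows "((\<lambda>x. q powr (a * x + c)) \<longlongrightarrow> 0) at_bot"
  unfolding at_bot_mirror filterlim_filtermap
  using powr_at_top_tendsto_0 [OF assms(1,2), of "- a" c] assms(3) by simp

subsection \<open>Duality on one bond\<close>

lemma qnum_0 [simp]: "qnum q 0 = 0"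
  by (simp add: qnum_def)

lemma minus_inverse_neq_0:
  assumes "0 < (q :: real)" "q < 1"
  shows "q - inverse q \<noteq> 0"
  using one_less_inverse [OF assms] assms by simp

lemma qnum_eq_0_iff:
  assumes "0 < q" "q < 1"
  shows "qnum q a = 0 \<longleftrightarrow> a = 0"
proof -
  have "q - inverse q \<noteq> 0" by (rule minus_inverse_neq_0 [OF assms])
  then show ?thesis using assms by (auto simp: qnum_def powr_inj)
qed

lemma qnum_inverse:
  assumes "0 < q"
  shows "qnum (inverse q) a = qnum q a"
proof -
  have "inverse q powr b = q powr (- b)" for b
    using assms by (simp add: powr_minus inverse_powr)
  then show ?thesis
    unfolding qnum_def by (metis inverse_inverse_eq minus_diff_eq minus_divide_divide minus_minus)
qed

lemma right_rate_identity:
  fixes q a b c e H :: real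
  assumes q: "0 < q" "q < 1" and pos: "0 < a" "0 < b" "0 < c" "0 < e" "0 < H"
    and ne: "(H * b\<^sup>2 * c)\<^sup>2 \<noteq> 1" "(H * b\<^sup>2 * c * q)\<^sup>2 \<noteq> 1"
  defines "A \<equiv> 1 / b\<^sup>2" and "B \<equiv> b\<^sup>2 * c\<^sup>2 * H\<^sup>2" and "A1 \<equiv> 1 / a\<^sup>2" and "B1 \<equiv> a\<^sup>2 * H\<^sup>2 * b ^ 4 * c\<^sup>2 * e\<^sup>2"
    and "br \<equiv> \<lambda>u. (u - inverse u) / (q - inverse q)"
  shows "q * e * c * (q - inverse q)\<^sup>2 * (br a * br (b * c) * (br (H * b\<^sup>2 * c * a * e) / br (H * b\<^sup>2 * c * q))
        * (br (H * b * c) / br (H * b\<^sup>2 * c)))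
    = - q\<^sup>2 * A * ((A - c\<^sup>2) * (1 - B) / ((A - B) * (A - q\<^sup>2 * B)) * ((1 - A1) * (1 - B1)))"
proof -
  define h where "h = H * b\<^sup>2 * c"
  have h: "h > 0" using pos by (simp add: h_def)
  note s0 = minus_inverse_neq_0 [OF q]
  have br: "br u = (u\<^sup>2 - 1) / u / (q - inverse q)" if "u > 0" for u
    using that unfolding br_def by (simp add: power2_eq_square field_simps)
  define s where "s = q - inverse q"
  have s: "s \<noteq> 0" using s0 by (simp add: s_def)
  have h1: "h\<^sup>2 - 1 \<noteq> 0" "(h * q)\<^sup>2 - 1 \<noteq> 0" using ne by (simp_all add: h_def)
  have AB: "A - B = - (h\<^sup>2 - 1) / b\<^sup>2" "A - q\<^sup>2 * B = - ((h * q)\<^sup>2 - 1) / b\<^sup>2"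
    using pos by (simp_all add: A_def B_def h_def power2_eq_square field_simps)
  have "br a * br (b * c) * (br (H * b\<^sup>2 * c * a * e) / br (H * b\<^sup>2 * c * q)) * (br (H * b * c) / br (H * b\<^sup>2 * c))
    = ((a\<^sup>2 - 1) / a) * (((b * c)\<^sup>2 - 1) / (b * c)) * (((h * a * e)\<^sup>2 - 1) / (h * a * e) / (((h * q)\<^sup>2 - 1) / (h * q)))
       * (((H * b * c)\<^sup>2 - 1) / (H * b * c) / ((h\<^sup>2 - 1) / h)) / s\<^sup>2"
    unfolding h_def [symmetric] using br [of a] br [of "b * c"] br [of "h * a * e"] br [of "h * q"] br [of "H * b * c"] br [of h]
      pos q h s unfolding s_def [symmetric] by (simp add: power2_eq_square)
  then have "q * e * c * (q - inverse q)\<^sup>2 * (br a * br (b * c) * (br (H * b\<^sup>2 * c * a * e) / br (H * b\<^sup>2 * c * q))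
        * (br (H * b * c) / br (H * b\<^sup>2 * c)))
     = q * e * c * (((a\<^sup>2 - 1) / a) * (((b * c)\<^sup>2 - 1) / (b * c)) * (((h * a * e)\<^sup>2 - 1) / (h * a * e) / (((h * q)\<^sup>2 - 1) / (h * q)))
       * (((H * b * c)\<^sup>2 - 1) / (H * b * c) / ((h\<^sup>2 - 1) / h)))"
    unfolding s_def [symmetric] using s by simp
  also have "\<dots> = q\<^sup>2 * (a\<^sup>2 - 1) * ((b * c)\<^sup>2 - 1) * ((h * a * e)\<^sup>2 - 1) * ((H * b * c)\<^sup>2 - 1)
       / (a\<^sup>2 * (((h * q)\<^sup>2 - 1) * (h\<^sup>2 - 1))) * (h / (H * b\<^sup>2 * c))"
    using pos q h h1 by (simp add: power2_eq_square) (simp only: mult_ac)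
  also have "h / (H * b\<^sup>2 * c) = 1" using pos by (simp add: h_def)
  also have "q\<^sup>2 * (a\<^sup>2 - 1) * ((b * c)\<^sup>2 - 1) * ((h * a * e)\<^sup>2 - 1) * ((H * b * c)\<^sup>2 - 1)
       / (a\<^sup>2 * (((h * q)\<^sup>2 - 1) * (h\<^sup>2 - 1))) * 1
     = - q\<^sup>2 * A * ((A - c\<^sup>2) * (1 - B) / ((A - B) * (A - q\<^sup>2 * B)) * ((1 - A1) * (1 - B1)))"
  proof -
    have 1: "A - c\<^sup>2 = - ((b * c)\<^sup>2 - 1) / b\<^sup>2" "1 - B = - ((H * b * c)\<^sup>2 - 1)"
      "1 - A1 = (a\<^sup>2 - 1) / a\<^sup>2" "1 - B1 = - ((h * a * e)\<^sup>2 - 1)"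
      using pos by (simp_all add: A_def B_def A1_def B1_def h_def power_mult_distrib field_simps)
    define y1 y2 y3 y4 y5 y6 where y: "y1 = (b * c)\<^sup>2 - 1" "y2 = (H * b * c)\<^sup>2 - 1" "y3 = a\<^sup>2 - 1"
      "y4 = (h * a * e)\<^sup>2 - 1" "y5 = h\<^sup>2 - 1" "y6 = (h * q)\<^sup>2 - 1"
    show ?thesis
      using h1 pos unfolding 1 AB y [symmetric] unfolding A_def by (simp add: power2_eq_square) (simp only: mult_ac)
  qed
  finally show ?thesis .
qed

text \<open>Since A1 B1 = e^2 \<theta>, the last factor splits as e^2 (1 - A1/e^2) (1 - B1/e^2);
  this produces the q-numbers of x1 + k1 and of the height plus x1.\<close>

lemma left_rate_identity:
  fixes q a b c e H :: real
  assumes q: "0 < q" "q < 1" and pos: "0 < a" "0 < b" "0 < c" "0 < e" "0 < H"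
    and ne: "(H * b\<^sup>2 * c)\<^sup>2 \<noteq> 1" "(H * b\<^sup>2 * c / q)\<^sup>2 \<noteq> 1"
  defines "A \<equiv> 1 / b\<^sup>2" and "B \<equiv> b\<^sup>2 * c\<^sup>2 * H\<^sup>2" and "A1 \<equiv> 1 / a\<^sup>2" and "B1 \<equiv> a\<^sup>2 * H\<^sup>2 * b ^ 4 * c\<^sup>2 * e\<^sup>2"
    and "\<theta> \<equiv> H\<^sup>2 * b ^ 4 * c\<^sup>2"
    and "br \<equiv> \<lambda>u. (u - inverse u) / (q - inverse q)"
  shows "q * e * c * (q - inverse q)\<^sup>2 * (br b * br (a * e) * (br (H * b\<^sup>2 * c * a) * br (H * b))
        / (br (H * b\<^sup>2 * c) * br (H * b\<^sup>2 * c / q)))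
    = - q\<^sup>2 * A * ((B - c\<^sup>2) * (1 - A) / ((B - A) * (B - q\<^sup>2 * A)) * (e\<^sup>2 - A1 - B1 + \<theta>))"
proof -
  define h where "h = H * b\<^sup>2 * c"
  have h: "h > 0" using pos by (simp add: h_def)
  note s0 = minus_inverse_neq_0 [OF q]
  have br: "br u = (u\<^sup>2 - 1) / u / (q - inverse q)" if "u > 0" for u
    using that unfolding br_def by (simp add: power2_eq_square field_simps)
  define s where "s = q - inverse q"
  have s: "s \<noteq> 0" using s0 by (simp add: s_def)
  have h1: "h\<^sup>2 - 1 \<noteq> 0" "(h / q)\<^sup>2 - 1 \<noteq> 0" using ne by (simp_all add: h_def)
  have AB: "B - A = (h\<^sup>2 - 1) / b\<^sup>2" "B - q\<^sup>2 * A = q\<^sup>2 * ((h / q)\<^sup>2 - 1) / b\<^sup>2"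
    using pos q by (simp_all add: A_def B_def h_def power2_eq_square field_simps)
  have "br b * br (a * e) * (br (H * b\<^sup>2 * c * a) * br (H * b)) / (br (H * b\<^sup>2 * c) * br (H * b\<^sup>2 * c / q))
    = ((b\<^sup>2 - 1) / b) * (((a * e)\<^sup>2 - 1) / (a * e)) * (((h * a)\<^sup>2 - 1) / (h * a) * (((H * b)\<^sup>2 - 1) / (H * b)))
       / ((h\<^sup>2 - 1) / h * (((h / q)\<^sup>2 - 1) / (h / q))) / s\<^sup>2"
    unfolding h_def [symmetric] using br [of b] br [of "a * e"] br [of "h * a"] br [of "h / q"] br [of "H * b"] br [of h]
      pos q h s unfolding s_def [symmetric] by (simp add: power2_eq_square)
  then have "q * e * c * (q - inverse q)\<^sup>2 * (br b * br (a * e) * (br (H * b\<^sup>2 * c * a) * br (H * b))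
        / (br (H * b\<^sup>2 * c) * br (H * b\<^sup>2 * c / q)))
     = q * e * c * (((b\<^sup>2 - 1) / b) * (((a * e)\<^sup>2 - 1) / (a * e)) * (((h * a)\<^sup>2 - 1) / (h * a) * (((H * b)\<^sup>2 - 1) / (H * b)))
       / ((h\<^sup>2 - 1) / h * (((h / q)\<^sup>2 - 1) / (h / q))))"
    unfolding s_def [symmetric] using s by simp
  also have "\<dots> = (b\<^sup>2 - 1) * ((a * e)\<^sup>2 - 1) * ((h * a)\<^sup>2 - 1) * ((H * b)\<^sup>2 - 1)
       / (a\<^sup>2 * ((h\<^sup>2 - 1) * ((h / q)\<^sup>2 - 1))) * (h * c / (H * b\<^sup>2))"
    using pos q h h1 by (simp add: power2_eq_square) (simp only: mult_ac)
  also have "h * c / (H * b\<^sup>2) = c\<^sup>2" using pos by (simp add: h_def power2_eq_square)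
  also have "(b\<^sup>2 - 1) * ((a * e)\<^sup>2 - 1) * ((h * a)\<^sup>2 - 1) * ((H * b)\<^sup>2 - 1)
       / (a\<^sup>2 * ((h\<^sup>2 - 1) * ((h / q)\<^sup>2 - 1))) * c\<^sup>2
     = - q\<^sup>2 * A * ((B - c\<^sup>2) * (1 - A) / ((B - A) * (B - q\<^sup>2 * A)) * (e\<^sup>2 - A1 - B1 + \<theta>))"
  proof -
    have 1: "B - c\<^sup>2 = c\<^sup>2 * ((H * b)\<^sup>2 - 1)" "1 - A = (b\<^sup>2 - 1) / b\<^sup>2"
      "e\<^sup>2 - A1 - B1 + \<theta> = - (((a * e)\<^sup>2 - 1) * ((h * a)\<^sup>2 - 1)) / a\<^sup>2"
      using pos by (simp_all add: A_def B_def A1_def B1_def \<theta>_def h_def power2_eq_square power4_eq_xxxx field_simps)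
    define y1 y2 y3 y4 y5 y6 where y: "y1 = (H * b)\<^sup>2 - 1" "y2 = b\<^sup>2 - 1" "y3 = (a * e)\<^sup>2 - 1"
      "y4 = (h * a)\<^sup>2 - 1" "y5 = h\<^sup>2 - 1" "y6 = (h / q)\<^sup>2 - 1"
    show ?thesis
      using h1 pos q unfolding 1 AB y [symmetric] unfolding A_def by (simp add: power2_eq_square) (simp only: mult_ac)
  qed
  finally show ?thesis .
qed

text \<open>The numbers l and h are the heights just outside the bond, the only trace of all other
  sites.\<close>

definition p_J_pair :: "real \<Rightarrow> real \<Rightarrow> real \<Rightarrow> real \<Rightarrow> real \<Rightarrow> real \<Rightarrow> nat \<Rightarrow> nat \<Rightarrow> nat \<Rightarrow> nat \<Rightarrow> real" where
  "p_J_pair q v l k1 k2 h n1 n2 x1 x2 =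
     p_J n1 x1 l (h + 2 * real x2 + k2) v k1 q * p_J n2 x2 (l + 2 * real n1 + k1) h v k2 q"

definition pair_right_rate :: "real \<Rightarrow> real \<Rightarrow> real \<Rightarrow> real \<Rightarrow> nat \<Rightarrow> nat \<Rightarrow> real" where
  "pair_right_rate q k1 k2 h x1 x2 = (if x1 = 0 then 0
      else qnum q (real x1) * qnum q (real x2 + k2)
        * (qnum q (h + 2 * real x2 + k2 + real x1 + k1) / qnum q (h + 2 * real x2 + k2 + 1))
        * (if x2 = 0 then 1 else qnum q (h + real x2 + k2) / qnum q (h + 2 * real x2 + k2)))"

definition pair_left_rate :: "real \<Rightarrow> real \<Rightarrow> real \<Rightarrow> real \<Rightarrow> nat \<Rightarrow> nat \<Rightarrow> real" where
  "pair_left_rate q k1 k2 h x1 x2 = (if x2 = 0 then 0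
      else qnum q (real x2) * qnum q (real x1 + k1)
        * (qnum q (h + 2 * real x2 + k2 + real x1) * qnum q (h + real x2))
        / (qnum q (h + 2 * real x2 + k2) * qnum q (h + 2 * real x2 + k2 - 1)))"

lemma p_J_pair_eq_bigJ:
  fixes q v l k1 k2 h :: real and n1 n2 x1 x2 :: nat
  assumes q: "0 < q" and v: "v \<noteq> 0"
  defines "p \<equiv> q\<^sup>2" and "c \<equiv> q powr k2" and "e \<equiv> q powr k1" and "H \<equiv> q powr h"
    and "w \<equiv> v * q powr (- l - k1 - h - k2 - 1)"
  shows "p_J_pair q v l k1 k2 h n1 n2 x1 x2 =
    bigJ p (e\<^sup>2) n1 (1 / p ^ x1) (p ^ x1 * (p ^ x2)\<^sup>2 * H\<^sup>2 * c\<^sup>2 * e\<^sup>2) (w / p ^ x2)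
     * bigJ p (c\<^sup>2) n2 (1 / p ^ x2) (p ^ x2 * c\<^sup>2 * H\<^sup>2) (w / p ^ n1)"
proof -
  have sq: "q powr (2 * b) = (q powr b)\<^sup>2" for b
    by (simp add: power2_eq_square powr_add [symmetric])
  have pn: "p ^ n = q powr (2 * real n)" for n unfolding p_def powr_even_eq(4) [OF q] ..
  have B1: "q powr (2 * real x1 + 2 * (h + 2 * real x2 + k2) + 2 * k1) = p ^ x1 * (p ^ x2)\<^sup>2 * H\<^sup>2 * c\<^sup>2 * e\<^sup>2"
    unfolding pn H_def c_def e_def sq [symmetric] by (simp add: powr_add [symmetric] algebra_simps)
  have B2: "q powr (2 * real x2 + 2 * h + 2 * k2) = p ^ x2 * c\<^sup>2 * H\<^sup>2"
    unfolding pn H_def c_def e_def sq [symmetric] by (simp add: powr_add [symmetric] algebra_simps)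
  have "- l - (h + 2 * real x2 + k2) - k1 - 1 = - l - k1 - h - k2 - 1 - 2 * real x2" by simp
  then have w1: "v * q powr (- l - (h + 2 * real x2 + k2) - k1 - 1) = w / p ^ x2"
    unfolding pn w_def by (simp only: powr_diff times_divide_eq_right)
  have "- (l + 2 * real n1 + k1) - h - k2 - 1 = - l - k1 - h - k2 - 1 - 2 * real n1" by simp
  then have w2: "v * q powr (- (l + 2 * real n1 + k1) - h - k2 - 1) = w / p ^ n1"
    unfolding pn w_def by (simp only: powr_diff times_divide_eq_right)
  show ?thesis
    unfolding p_J_pair_def p_J_eq_bigJ [OF q v] B1 B2 w1 w2 sq p_def c_def e_def ..
qed

lemma qnum_powr: "qnum q a = (q powr a - inverse (q powr a)) / (q - inverse q)"
  by (simp add: qnum_def powr_minus)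

text \<open>The excluded heights 0, -1 and 1 correspond to A = B, A = p B and B = p A, the zeros of
  the denominators in \<open>bigJ_two_site\<close>.\<close>

lemma p_J_pair_duality_generic:
  fixes q v l k1 k2 h :: real and n1 n2 x1 x2 :: nat
  assumes q: "0 < q" "q < 1" and v: "v \<noteq> 0" and k: "0 < k1" "0 < k2"
    and gen: "generic (q\<^sup>2) (v * q powr (- l - k1 - h - k2 - 1))"
    and h2: "h + 2 * real x2 + k2 \<notin> {0, 1, -1}"
  defines "F \<equiv> p_J_pair q v l k1 k2 h"
  shows "q powr (real n1 + k1 - real n2 - 1) * qnum q (real n1) * qnum q (real n2 + k2)
        * (F (n1 - 1) (n2 + 1) x1 x2 - F n1 n2 x1 x2)
      + q powr (- (real n2 + k2 - real n1 - 1)) * qnum q (real n2) * qnum q (real n1 + k1)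
        * (F (n1 + 1) (n2 - 1) x1 x2 - F n1 n2 x1 x2)
    = pair_right_rate q k1 k2 h x1 x2 * (F n1 n2 (x1 - 1) (x2 + 1) - F n1 n2 x1 x2)
      + pair_left_rate q k1 k2 h x1 x2 * (F n1 n2 (x1 + 1) (x2 - 1) - F n1 n2 x1 x2)"
proof -
  define p where "p = q\<^sup>2"
  define c where "c = q powr k2"
  define e where "e = q powr k1"
  define H where "H = q powr h"
  define a where "a = q powr real x1"
  define b where "b = q powr real x2"
  define \<alpha> where "\<alpha> = q powr real n1"
  define \<beta> where "\<beta> = q powr real n2"
  define w where "w = v * q powr (- l - k1 - h - k2 - 1)"
  define A where "A = 1 / b\<^sup>2"
  define B where "B = b\<^sup>2 * c\<^sup>2 * H\<^sup>2"
  define A1 where "A1 = 1 / a\<^sup>2"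
  define B1 where "B1 = a\<^sup>2 * H\<^sup>2 * b ^ 4 * c\<^sup>2 * e\<^sup>2"
  define \<theta> where "\<theta> = H\<^sup>2 * b ^ 4 * c\<^sup>2"
  define s where "s = q - inverse q"
  \<comment> \<open>Multiplying by c0 turns the four rates into the coefficients of
    \<open>bigJ_two_site\<close>, which contain only even powers of \<alpha>, \<beta>, a, b, c, e, H
    and q.\<close>
  define c0 where "c0 = q * e * c * s\<^sup>2"
  have pos: "0 < a" "0 < b" "0 < c" "0 < e" "0 < H" "0 < \<alpha>" "0 < \<beta>"
    using q by (simp_all add: a_def b_def c_def e_def H_def \<alpha>_def \<beta>_def)
  have s0: "s \<noteq> 0" unfolding s_def by (rule minus_inverse_neq_0 [OF q])
  have c0: "c0 \<noteq> 0" using pos q s0 by (simp add: c0_def)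
  have p: "0 < p" "p < 1" and p0: "p \<noteq> 0" using q by (simp_all add: p_def power_less_one_iff abs_square_less_1)
  have sq: "(q powr b)\<^sup>2 = q powr (2 * b)" for b
    by (simp add: power2_eq_square powr_add [symmetric])
  have lt1: "q powr b < 1" if "b > 0" for b
    using q that powr_less_mono' [of q 0 b] by simp
  have \<kappa>: "0 < e\<^sup>2" "e\<^sup>2 < 1" "0 < c\<^sup>2" "c\<^sup>2 < 1"
    using pos k unfolding e_def c_def sq by (simp_all add: lt1)
  have pn: "p ^ n = (q powr real n)\<^sup>2" for n unfolding sq p_def powr_even_eq(4) [OF q(1)] ..
  have px: "p ^ x1 = a\<^sup>2" "p ^ x2 = b\<^sup>2" "p ^ n1 = \<alpha>\<^sup>2" "p ^ n2 = \<beta>\<^sup>2"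
    unfolding pn by (simp_all add: a_def b_def \<alpha>_def \<beta>_def)
  have hp: "H * b\<^sup>2 * c = q powr (h + 2 * real x2 + k2)"
    unfolding H_def b_def c_def sq powr_add by simp
  have one: "(q powr u)\<^sup>2 \<noteq> 1" if "u \<noteq> 0" for u
    unfolding sq using q that by simp
  have ne: "(H * b\<^sup>2 * c)\<^sup>2 \<noteq> 1" "(H * b\<^sup>2 * c * q)\<^sup>2 \<noteq> 1" "(H * b\<^sup>2 * c / q)\<^sup>2 \<noteq> 1"
  proof -
    have 1: "H * b\<^sup>2 * c * q = q powr (h + 2 * real x2 + k2 + 1)" "H * b\<^sup>2 * c / q = q powr (h + 2 * real x2 + k2 - 1)"
      unfolding hp powr_add powr_diff using q by simp_all
    show "(H * b\<^sup>2 * c)\<^sup>2 \<noteq> 1" unfolding hp by (rule one) (use h2 in auto)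
    show "(H * b\<^sup>2 * c * q)\<^sup>2 \<noteq> 1" unfolding 1 by (rule one) (use h2 in auto)
    show "(H * b\<^sup>2 * c / q)\<^sup>2 \<noteq> 1" unfolding 1 by (rule one) (use h2 in auto)
  qed
  have AB: "A - B = - ((H * b\<^sup>2 * c)\<^sup>2 - 1) / b\<^sup>2" "A - p * B = - ((H * b\<^sup>2 * c * q)\<^sup>2 - 1) / b\<^sup>2"
    "B - p * A = q\<^sup>2 * ((H * b\<^sup>2 * c / q)\<^sup>2 - 1) / b\<^sup>2"
    using pos q by (simp_all add: A_def B_def p_def power2_eq_square field_simps)
  have AB': "A - B \<noteq> 0" "A - p * B \<noteq> 0" "B - p * A \<noteq> 0"
    unfolding AB using ne pos q by simp_all
  have Fb: "F m1 m2 y1 y2 = bigJ p (e\<^sup>2) m1 (1 / p ^ y1) (p ^ y1 * (p ^ y2)\<^sup>2 * H\<^sup>2 * c\<^sup>2 * e\<^sup>2) (w / p ^ y2)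
     * bigJ p (c\<^sup>2) m2 (1 / p ^ y2) (p ^ y2 * c\<^sup>2 * H\<^sup>2) (w / p ^ m1)" for m1 m2 y1 y2
    unfolding F_def p_def c_def e_def H_def w_def by (rule p_J_pair_eq_bigJ [OF q(1) v])
  have B1': "a\<^sup>2 * (b\<^sup>2)\<^sup>2 * H\<^sup>2 * c\<^sup>2 * e\<^sup>2 = B1" by (simp add: B1_def mult_ac)
  have wA: "w / b\<^sup>2 = w * A" by (simp add: A_def)
  have F0: "F n1 n2 x1 x2 = bigJ p (e\<^sup>2) n1 A1 B1 (w * A) * bigJ p (c\<^sup>2) n2 A B (w / p ^ n1)"
    unfolding Fb px B1' wA by (simp add: A_def B_def A1_def)
  define X where "X = q powr (real n1 + k1 - real n2 - 1) * qnum q (real n1) * qnum q (real n2 + k2)"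
  define Y where "Y = q powr (- (real n2 + k2 - real n1 - 1)) * qnum q (real n2) * qnum q (real n1 + k1)"
  have X: "c0 * X = e\<^sup>2 * c\<^sup>2 * (p ^ n1 - 1) * (1 - 1 / (p ^ n2 * c\<^sup>2))"
  proof -
    have "q powr (real n1 + k1 - real n2 - 1) = \<alpha> * e / (\<beta> * q)"
      using q by (simp add: powr_diff powr_add \<alpha>_def \<beta>_def e_def)
    moreover have "q powr (real n2 + k2) = \<beta> * c" by (simp add: powr_add \<beta>_def c_def)
    ultimately have X': "X = \<alpha> * e / (\<beta> * q) * ((\<alpha> - inverse \<alpha>) / s) * ((\<beta> * c - inverse (\<beta> * c)) / s)"
      unfolding X_def qnum_powr s_def \<alpha>_def by simp
    show ?thesis unfolding c0_def px X' using pos q s0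
      by (simp add: power2_eq_square field_simps)
  qed
  have Y: "c0 * Y = p * (1 - 1 / p ^ n2) * (p ^ n1 * e\<^sup>2 - 1)"
  proof -
    have "- (real n2 + k2 - real n1 - 1) = real n1 + 1 - real n2 - k2" by simp
    then have "q powr (- (real n2 + k2 - real n1 - 1)) = \<alpha> * q / (\<beta> * c)"
      using q by (simp only: powr_diff powr_add \<alpha>_def \<beta>_def c_def) simp
    moreover have "q powr (real n1 + k1) = \<alpha> * e" by (simp add: powr_add \<alpha>_def e_def)
    ultimately have Y': "Y = \<alpha> * q / (\<beta> * c) * ((\<beta> - inverse \<beta>) / s) * ((\<alpha> * e - inverse (\<alpha> * e)) / s)"
      unfolding Y_def qnum_powr s_def \<beta>_def by simp
    show ?thesis unfolding c0_def px Y' unfolding p_def using pos q s0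
      by (simp add: power2_eq_square field_simps)
  qed
  have 1: "c0 * X * (F (n1 - 1) (n2 + 1) x1 x2 - F n1 n2 x1 x2)
    = e\<^sup>2 * c\<^sup>2 * (p ^ n1 - 1) * (1 - 1 / (p ^ n2 * c\<^sup>2))
        * (bigJ p (e\<^sup>2) (n1 - 1) A1 B1 (w * A) * bigJ p (c\<^sup>2) (Suc n2) A B (w / p ^ n1 * p) - F n1 n2 x1 x2)"
  proof (cases n1)
    case (Suc m)
    have "w / p ^ (n1 - 1) = w / p ^ n1 * p" using p0 by (simp add: Suc)
    then show ?thesis
      unfolding X Fb [of "n1 - 1" "n2 + 1"] px(1,2) B1' wA by (simp add: A_def B_def A1_def)
  qed (simp add: X)
  have 2: "c0 * Y * (F (n1 + 1) (n2 - 1) x1 x2 - F n1 n2 x1 x2)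
    = p * (1 - 1 / p ^ n2) * (p ^ n1 * e\<^sup>2 - 1)
        * (bigJ p (e\<^sup>2) (Suc n1) A1 B1 (w * A) * bigJ p (c\<^sup>2) (n2 - 1) A B (w / p ^ n1 / p) - F n1 n2 x1 x2)"
  proof -
    have "w / p ^ (n1 + 1) = w / p ^ n1 / p" using p0 by simp
    then show ?thesis
      unfolding Y Fb [of "n1 + 1" "n2 - 1"] px(1,2) B1' wA by (simp add: A_def B_def A1_def mult.commute [of p])
  qed
  have 3: "c0 * pair_right_rate q k1 k2 h x1 x2 = - p * A * ((A - c\<^sup>2) * (1 - B) / ((A - B) * (A - p * B)) * ((1 - A1) * (1 - B1)))"
  proof (cases "x1 = 0")
    case True
    then show ?thesis using q by (simp add: pair_right_rate_def A1_def a_def)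
  next
    case False
    have hh: "q powr (real x2 + k2) = b * c" "q powr (h + 2 * real x2 + k2 + real x1 + k1) = H * b\<^sup>2 * c * a * e"
      "q powr (h + 2 * real x2 + k2 + 1) = H * b\<^sup>2 * c * q" "q powr (h + real x2 + k2) = H * b * c"
      "q powr (h + 2 * real x2 + k2) = H * b\<^sup>2 * c"
      unfolding hp using q by (simp_all add: powr_add H_def a_def b_def c_def e_def power2_eq_square)
    have nz: "qnum q (h + 2 * real x2 + k2) \<noteq> 0" using h2 qnum_eq_0_iff [OF q] by auto
    \<comment> \<open>For x2 = 0 the ratio that is read as 1 has equal numerator and denominator,
      which are nonzero by fact nz; so the generic formula covers both cases.\<close>
    have "pair_right_rate q k1 k2 h x1 x2 = qnum q (real x1) * qnum q (real x2 + k2)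
        * (qnum q (h + 2 * real x2 + k2 + real x1 + k1) / qnum q (h + 2 * real x2 + k2 + 1))
        * (qnum q (h + real x2 + k2) / qnum q (h + 2 * real x2 + k2))"
      using False nz by (cases "x2 = 0") (simp_all add: pair_right_rate_def)
    then show ?thesis
      using right_rate_identity [OF q pos(1-5) ne(1,2)]
      unfolding qnum_powr hh A_def B_def A1_def B1_def c0_def s_def p_def a_def [symmetric] by simp
  qed
  have 4: "c0 * pair_left_rate q k1 k2 h x1 x2 = - p * A * ((B - c\<^sup>2) * (1 - A) / ((B - A) * (B - p * A)) * (e\<^sup>2 - A1 - B1 + \<theta>))"
  proof (cases "x2 = 0")
    case True
    then show ?thesis using q by (simp add: pair_left_rate_def A_def b_def)
  next
    case False
    have hh: "q powr (real x1 + k1) = a * e" "q powr (h + 2 * real x2 + k2 + real x1) = H * b\<^sup>2 * c * a"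
      "q powr (h + 2 * real x2 + k2 - 1) = H * b\<^sup>2 * c / q" "q powr (h + real x2) = H * b"
      "q powr (h + 2 * real x2 + k2) = H * b\<^sup>2 * c"
      unfolding hp using q by (simp_all add: powr_add powr_diff H_def a_def b_def c_def e_def power2_eq_square)
    show ?thesis
      using left_rate_identity [OF q pos(1-5) ne(1,3)] False
      unfolding pair_left_rate_def qnum_powr hh A_def B_def A1_def B1_def \<theta>_def c0_def s_def p_def b_def [symmetric] by simp
  qed
  define PR where "PR = (A - c\<^sup>2) * (1 - B) / ((A - B) * (A - p * B)) * ((1 - A1) * (1 - B1))"
  define PL where "PL = (B - c\<^sup>2) * (1 - A) / ((B - A) * (B - p * A)) * (e\<^sup>2 - A1 - B1 + \<theta>)"
  have 5: "PR * (F n1 n2 (x1 - 1) (x2 + 1) - F n1 n2 x1 x2)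
    = PR * (bigJ p (e\<^sup>2) n1 (p * A1) (p * B1) (w * A / p) * bigJ p (c\<^sup>2) n2 (A / p) (p * B) (w / p ^ n1) - F n1 n2 x1 x2)"
  proof (cases x1)
    \<comment> \<open>Here x1 - 1 is truncated, but A1 = 1, so the coefficient PR vanishes. The case
      x2 = 0 for PL is alike, with A = 1.\<close>
    case 0
    then show ?thesis using q by (simp add: PR_def A1_def a_def)
  next
    case (Suc m)
    have pm: "p ^ (x1 - 1) = a\<^sup>2 / p" "p ^ (x2 + 1) = b\<^sup>2 * p"
      using p0 unfolding px [symmetric] by (simp_all add: Suc)
    have E: "1 / (a\<^sup>2 / p) = p * A1" "a\<^sup>2 / p * (b\<^sup>2 * p)\<^sup>2 * H\<^sup>2 * c\<^sup>2 * e\<^sup>2 = p * B1" "w / (b\<^sup>2 * p) = w * A / p"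
      "1 / (b\<^sup>2 * p) = A / p" "b\<^sup>2 * p * c\<^sup>2 * H\<^sup>2 = p * B"
      using p0 pos by (simp_all add: A1_def B1_def A_def B_def power2_eq_square power4_eq_xxxx)
    show ?thesis unfolding Fb [of _ _ "x1 - 1" "x2 + 1"] pm E ..
  qed
  have 6: "PL * (F n1 n2 (x1 + 1) (x2 - 1) - F n1 n2 x1 x2)
    = PL * (bigJ p (e\<^sup>2) n1 (A1 / p) (B1 / p) (w * A * p) * bigJ p (c\<^sup>2) n2 (p * A) (B / p) (w / p ^ n1) - F n1 n2 x1 x2)"
  proof (cases x2)
    case 0
    then show ?thesis using q by (simp add: PL_def A_def b_def)
  next
    case (Suc m)
    have pm: "p ^ (x2 - 1) = b\<^sup>2 / p" "p ^ (x1 + 1) = a\<^sup>2 * p"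
      using p0 unfolding px [symmetric] by (simp_all add: Suc)
    have E: "1 / (a\<^sup>2 * p) = A1 / p" "a\<^sup>2 * p * (b\<^sup>2 / p)\<^sup>2 * H\<^sup>2 * c\<^sup>2 * e\<^sup>2 = B1 / p" "w / (b\<^sup>2 / p) = w * A * p"
      "1 / (b\<^sup>2 / p) = p * A" "b\<^sup>2 / p * c\<^sup>2 * H\<^sup>2 = B / p"
      using p0 pos by (simp_all add: A1_def B1_def A_def B_def power2_eq_square power4_eq_xxxx)
    show ?thesis unfolding Fb [of _ _ "x1 + 1" "x2 - 1"] pm E ..
  qed
  have "c0 * (X * (F (n1 - 1) (n2 + 1) x1 x2 - F n1 n2 x1 x2) + Y * (F (n1 + 1) (n2 - 1) x1 x2 - F n1 n2 x1 x2))
    = c0 * X * (F (n1 - 1) (n2 + 1) x1 x2 - F n1 n2 x1 x2) + c0 * Y * (F (n1 + 1) (n2 - 1) x1 x2 - F n1 n2 x1 x2)"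
    by (simp only: distrib_left mult.assoc)
  also have "\<dots> = - p * A * (PR
          * (bigJ p (e\<^sup>2) n1 (p * A1) (p * B1) (w * A / p) * bigJ p (c\<^sup>2) n2 (A / p) (p * B) (w / p ^ n1) - F n1 n2 x1 x2)
       + PL
          * (bigJ p (e\<^sup>2) n1 (A1 / p) (B1 / p) (w * A * p) * bigJ p (c\<^sup>2) n2 (p * A) (B / p) (w / p ^ n1) - F n1 n2 x1 x2))"
    unfolding 1 2 unfolding F0 PR_def PL_def
  proof (rule bigJ_two_site [where x = x2])
    show "generic p w" using gen by (simp add: p_def w_def)
    show "A = 1 / p ^ x2" by (simp add: A_def px)
    show "B = \<theta> * A" using pos by (simp add: B_def \<theta>_def A_def power2_eq_square power4_eq_xxxx)
    show "A1 * B1 = e\<^sup>2 * \<theta>" using pos by (simp add: A1_def B1_def \<theta>_def)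
  qed (use p \<kappa> AB' in auto)
  also have "\<dots> = (- p * A * PR) * (F n1 n2 (x1 - 1) (x2 + 1) - F n1 n2 x1 x2)
      + (- p * A * PL) * (F n1 n2 (x1 + 1) (x2 - 1) - F n1 n2 x1 x2)"
    unfolding 5 [symmetric] 6 [symmetric] by (simp only: distrib_left mult.assoc)
  also have "\<dots> = c0 * (pair_right_rate q k1 k2 h x1 x2 * (F n1 n2 (x1 - 1) (x2 + 1) - F n1 n2 x1 x2)
      + pair_left_rate q k1 k2 h x1 x2 * (F n1 n2 (x1 + 1) (x2 - 1) - F n1 n2 x1 x2))"
    unfolding PR_def PL_def 3 [symmetric] 4 [symmetric] by (simp only: distrib_left mult.assoc)
  finally show ?thesis
    using c0 unfolding X_def Y_def by simp
qed

subsection \<open>Duality for the product\<close>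

text \<open>If the limits differed, f and g would differ on a whole punctured neighbourhood, and an
  interval would lie inside the countable set C.\<close>

lemma tendsto_off_countable_eq:
  fixes f g :: "real \<Rightarrow> real"
  assumes "countable C" "(f \<longlongrightarrow> a) (at x)" "(g \<longlongrightarrow> b) (at x)" "\<And>y. y \<notin> C \<Longrightarrow> f y = g y"
  shows "a = b"
proof (rule ccontr)
  assume "a \<noteq> b"
  have "((\<lambda>y. f y - g y) \<longlongrightarrow> a - b) (at x)" using assms by (intro tendsto_diff)
  then have "\<forall>\<^sub>F y in at x. f y - g y \<noteq> 0"
    by (rule tendsto_imp_eventually_ne) (use \<open>a \<noteq> b\<close> in simp)
  then obtain d where d: "d > 0" "\<And>y. y \<noteq> x \<Longrightarrow> dist y x < d \<Longrightarrow> f y - g y \<noteq> 0"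
    unfolding eventually_at by auto
  have "{x<..<x + d} \<subseteq> C"
    using d(2) assms(4) by (force simp: dist_real_def)
  then have "countable {x<..<x + d}" using assms(1) countable_subset by blast
  then show False using d(1) uncountable_open_interval [of x "x + d"] by simp
qed

text \<open>Each of the countably many equations has at most one solution h, by injectivity of the
  exponential.\<close>

lemma countable_not_generic:
  assumes q: "0 < q" "q < 1" and v: "v \<noteq> 0"
  shows "countable {h. \<not> generic (q\<^sup>2) (v * q powr (c - h))}"
proof -
  have "countable {h. v * q powr (c - h) * (q\<^sup>2) ^ m = (q\<^sup>2) ^ j}" for m j
  proof -
    have "inj (\<lambda>h. v * q powr (c - h) * (q\<^sup>2) ^ m)"
      using q v by (auto intro!: injI simp: powr_inj)
    then have "finite ((\<lambda>h. v * q powr (c - h) * (q\<^sup>2) ^ m) -` {(q\<^sup>2) ^ j})"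
      by (intro finite_vimageI) auto
    then show ?thesis
      by (auto simp: vimage_def intro: countable_finite)
  qed
  then have "countable (\<Union>m. \<Union>j. {h. v * q powr (c - h) * (q\<^sup>2) ^ m = (q\<^sup>2) ^ j})"
    by (intro countable_UN) simp_all
  moreover have "v * q powr (c - h) \<noteq> 0" for h using q v by simp
  then have "{h. \<not> generic (q\<^sup>2) (v * q powr (c - h))}
      \<subseteq> (\<Union>m. \<Union>j. {h. v * q powr (c - h) * (q\<^sup>2) ^ m = (q\<^sup>2) ^ j})"
    unfolding generic_def by blast
  ultimately show ?thesis by (rule countable_subset [rotated])
qed

lemma tendsto_qnum:
  assumes "0 < q" "(f \<longlongrightarrow> a) F"
  shows "((\<lambda>t. qnum q (f t)) \<longlongrightarrow> qnum q a) F"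
  unfolding qnum_def divide_inverse
  by (intro tendsto_mult_right tendsto_diff tendsto_powr tendsto_const tendsto_minus assms) (use assms in auto)

lemma tendsto_p_J:
  assumes q: "0 < q" and v: "v \<noteq> 0" and r: "(r \<longlongrightarrow> r') F"
  shows "((\<lambda>t. p_J n x l (r t) v k q) \<longlongrightarrow> p_J n x l r' v k q) F"
  unfolding p_J_eq_bigJ [OF q v]
  by (intro tendsto_bigJ tendsto_const tendsto_mult_left tendsto_powr tendsto_add tendsto_diff r) (use q in auto)

text \<open>
  In the state space the right boundary height \<open>h\<close> may still be exceptional (for instance
  \<open>h + k2 = 0\<close> with \<open>x2 = 0\<close>), but both sides are continuous there.
\<close>

lemma p_J_pair_duality:
  fixes q v l k1 k2 h :: real and n1 n2 x1 x2 :: nat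
  assumes q: "0 < q" "q < 1" and v: "v \<noteq> 0" and k: "0 < k1" "0 < k2"
    and h1: "x1 > 0 \<Longrightarrow> h + 2 * real x2 + k2 + 1 \<noteq> 0"
    and h2: "x2 > 0 \<Longrightarrow> h + 2 * real x2 + k2 \<noteq> 0" "x2 > 0 \<Longrightarrow> h + 2 * real x2 + k2 - 1 \<noteq> 0"
  defines "F \<equiv> p_J_pair q v l k1 k2 h"
  shows "q powr (real n1 + k1 - real n2 - 1) * qnum q (real n1) * qnum q (real n2 + k2)
        * (F (n1 - 1) (n2 + 1) x1 x2 - F n1 n2 x1 x2)
      + q powr (- (real n2 + k2 - real n1 - 1)) * qnum q (real n2) * qnum q (real n1 + k1)
        * (F (n1 + 1) (n2 - 1) x1 x2 - F n1 n2 x1 x2)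
    = pair_right_rate q k1 k2 h x1 x2 * (F n1 n2 (x1 - 1) (x2 + 1) - F n1 n2 x1 x2)
      + pair_left_rate q k1 k2 h x1 x2 * (F n1 n2 (x1 + 1) (x2 - 1) - F n1 n2 x1 x2)"
proof -
  have pair: "((\<lambda>h. p_J_pair q v l k1 k2 h m1 m2 y1 y2) \<longlongrightarrow> F m1 m2 y1 y2) (at h)" for m1 m2 y1 y2
    unfolding p_J_pair_def F_def
    by (intro tendsto_mult tendsto_p_J q v tendsto_add tendsto_ident_at tendsto_const)
  have right: "((\<lambda>h. pair_right_rate q k1 k2 h x1 x2) \<longlongrightarrow> pair_right_rate q k1 k2 h x1 x2) (at h)"
  proof (cases "x1 = 0")
    case False
    have 1: "qnum q (h + 2 * real x2 + k2 + 1) \<noteq> 0"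
      using h1 False qnum_eq_0_iff [OF q] by auto
    show ?thesis
    proof (cases "x2 = 0")
      case True
      show ?thesis unfolding pair_right_rate_def if_not_P [OF False] if_P [OF True]
        by (intro tendsto_mult tendsto_divide tendsto_qnum q tendsto_add tendsto_ident_at tendsto_const 1)
    next
      case x2: False
      have 2: "qnum q (h + 2 * real x2 + k2) \<noteq> 0"
        using h2 x2 qnum_eq_0_iff [OF q] by auto
      show ?thesis unfolding pair_right_rate_def if_not_P [OF False] if_not_P [OF x2]
        by (intro tendsto_mult tendsto_divide tendsto_qnum q tendsto_add tendsto_ident_at tendsto_const 1 2)
    qed
  qed (simp add: pair_right_rate_def)
  have left: "((\<lambda>h. pair_left_rate q k1 k2 h x1 x2) \<longlongrightarrow> pair_left_rate q k1 k2 h x1 x2) (at h)"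
  proof (cases "x2 = 0")
    case False
    have 1: "qnum q (h + 2 * real x2 + k2) * qnum q (h + 2 * real x2 + k2 - 1) \<noteq> 0"
      using h2 False qnum_eq_0_iff [OF q] by auto
    show ?thesis unfolding pair_left_rate_def if_not_P [OF False]
      by (intro tendsto_mult tendsto_divide tendsto_qnum q tendsto_add tendsto_diff tendsto_ident_at tendsto_const 1)
  qed (simp add: pair_left_rate_def)
  define C where "C = {h. \<not> generic (q\<^sup>2) (v * q powr ((- l - k1 - k2 - 1) - h))}
    \<union> (\<lambda>a. a - 2 * real x2 - k2) ` {0, 1, -1}"
  have "countable C"
    unfolding C_def by (intro countable_Un countable_not_generic q v countable_image) auto
  then show ?thesis
  proof (rule tendsto_off_countable_eq)
    show "((\<lambda>h. q powr (real n1 + k1 - real n2 - 1) * qnum q (real n1) * qnum q (real n2 + k2)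
        * (p_J_pair q v l k1 k2 h (n1 - 1) (n2 + 1) x1 x2 - p_J_pair q v l k1 k2 h n1 n2 x1 x2)
      + q powr (- (real n2 + k2 - real n1 - 1)) * qnum q (real n2) * qnum q (real n1 + k1)
        * (p_J_pair q v l k1 k2 h (n1 + 1) (n2 - 1) x1 x2 - p_J_pair q v l k1 k2 h n1 n2 x1 x2)) \<longlongrightarrow>
      q powr (real n1 + k1 - real n2 - 1) * qnum q (real n1) * qnum q (real n2 + k2)
        * (F (n1 - 1) (n2 + 1) x1 x2 - F n1 n2 x1 x2)
      + q powr (- (real n2 + k2 - real n1 - 1)) * qnum q (real n2) * qnum q (real n1 + k1)
        * (F (n1 + 1) (n2 - 1) x1 x2 - F n1 n2 x1 x2)) (at h)"
      by (intro tendsto_add tendsto_mult_left tendsto_diff pair)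
    show "((\<lambda>h. pair_right_rate q k1 k2 h x1 x2 * (p_J_pair q v l k1 k2 h n1 n2 (x1 - 1) (x2 + 1) - p_J_pair q v l k1 k2 h n1 n2 x1 x2)
      + pair_left_rate q k1 k2 h x1 x2 * (p_J_pair q v l k1 k2 h n1 n2 (x1 + 1) (x2 - 1) - p_J_pair q v l k1 k2 h n1 n2 x1 x2)) \<longlongrightarrow>
      pair_right_rate q k1 k2 h x1 x2 * (F n1 n2 (x1 - 1) (x2 + 1) - F n1 n2 x1 x2)
      + pair_left_rate q k1 k2 h x1 x2 * (F n1 n2 (x1 + 1) (x2 - 1) - F n1 n2 x1 x2)) (at h)"
      by (intro tendsto_add tendsto_mult tendsto_diff pair right left)
    fix y assume y: "y \<notin> C"
    have "y + 2 * real x2 + k2 \<notin> {0, 1, -1}"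
    proof
      assume "y + 2 * real x2 + k2 \<in> {0, 1, -1}"
      then have "(y + 2 * real x2 + k2) - 2 * real x2 - k2 \<in> C" unfolding C_def by blast
      then show False using y by simp
    qed
    moreover have eq: "- l - k1 - y - k2 - 1 = - l - k1 - k2 - 1 - y" by simp
    have "generic (q\<^sup>2) (v * q powr (- l - k1 - y - k2 - 1))" using y unfolding C_def eq by auto
    ultimately show "q powr (real n1 + k1 - real n2 - 1) * qnum q (real n1) * qnum q (real n2 + k2)
        * (p_J_pair q v l k1 k2 y (n1 - 1) (n2 + 1) x1 x2 - p_J_pair q v l k1 k2 y n1 n2 x1 x2)
      + q powr (- (real n2 + k2 - real n1 - 1)) * qnum q (real n2) * qnum q (real n1 + k1)
        * (p_J_pair q v l k1 k2 y (n1 + 1) (n2 - 1) x1 x2 - p_J_pair q v l k1 k2 y n1 n2 x1 x2)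
      = pair_right_rate q k1 k2 y x1 x2 * (p_J_pair q v l k1 k2 y n1 n2 (x1 - 1) (x2 + 1) - p_J_pair q v l k1 k2 y n1 n2 x1 x2)
      + pair_left_rate q k1 k2 y x1 x2 * (p_J_pair q v l k1 k2 y n1 n2 (x1 + 1) (x2 - 1) - p_J_pair q v l k1 k2 y n1 n2 x1 x2)"
      by (intro p_J_pair_duality_generic q v k)
  qed
qed

section \<open>Heights and factorisation along one bond\<close>

lemma hplus_Suc:
  assumes "j \<le> M"
  shows "hplus M \<rho> k \<xi> j = hplus M \<rho> k \<xi> (Suc j) + 2 * real (\<xi> j) + k j"
  using assms by (simp add: hplus_def sum.atLeast_Suc_atMost)

lemma hminus_Suc: "hminus l k \<eta> (Suc j) = hminus l k \<eta> j + 2 * real (\<eta> (Suc j)) + k (Suc j)"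
  by (simp add: hminus_def)

lemma hminus_eq_add: "hminus l k \<eta> j = l + hminus0 k \<eta> j"
  by (simp add: hminus_def)

lemma hplus_eq_add: "hplus M \<rho> k \<xi> j = \<rho> + hplus0 M k \<xi> j"
  by (simp add: hplus_def)

lemma sum_remove_two:
  fixes f :: "'a \<Rightarrow> real"
  assumes "finite S" "a \<in> S" "b \<in> S" "a \<noteq> b"
  shows "sum f S = f a + f b + sum f (S - {a} - {b})"
  using sum.remove [of S a f] sum.remove [of "S - {a}" b f] assms by simp

lemma prod_remove_two:
  fixes f :: "'a \<Rightarrow> real"
  assumes "finite S" "a \<in> S" "b \<in> S" "a \<noteq> b"
  shows "prod f S = prod f (S - {a} - {b}) * (f a * f b)"
  using prod.remove [of S a f] prod.remove [of "S - {a}" b f] assms by simp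

text \<open>Wide enough to contain the identity and both jumps over the bond, so that one
  factorisation serves all terms of the two generators.\<close>

definition bond_equiv :: "nat \<Rightarrow> config \<Rightarrow> config \<Rightarrow> bool" where
  "bond_equiv j \<eta> \<eta>' \<longleftrightarrow> (\<forall>i. i \<noteq> j \<and> i \<noteq> Suc j \<longrightarrow> \<eta>' i = \<eta> i) \<and> \<eta>' j + \<eta>' (Suc j) = \<eta> j + \<eta> (Suc j)"

text \<open>A partial sum up to i contains both sites of the bond or neither, unless i = j; the
  total on the bond is conserved.\<close>

lemma bond_equiv_hminus:
  assumes "bond_equiv j \<eta> \<eta>'" "1 \<le> j" "i \<noteq> j"
  shows "hminus l k \<eta>' i = hminus l k \<eta> i"
proof (cases "i < j")
  case True
  then show ?thesis using assms unfolding hminus_def bond_equiv_def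
    by (intro arg_cong2 [where f = "(+)"] sum.cong refl) auto
next
  case False
  then have "j < i" using assms by simp
  then have "Suc j \<in> {1..i}" "j \<in> {1..i}" using assms by auto
  then have sp: "(\<Sum>i=1..i. f i) = f j + f (Suc j) + (\<Sum>i\<in>{1..i} - {j} - {Suc j}. f i)" for f :: "nat \<Rightarrow> real"
    by (intro sum_remove_two) auto
  have "(\<Sum>i\<in>{1..i} - {j} - {Suc j}. 2 * real (\<eta>' i) + k i) = (\<Sum>i\<in>{1..i} - {j} - {Suc j}. 2 * real (\<eta> i) + k i)"
    using assms unfolding bond_equiv_def by (intro sum.cong) auto
  moreover have "real (\<eta>' j) + real (\<eta>' (Suc j)) = real (\<eta> j) + real (\<eta> (Suc j))"
    using assms unfolding bond_equiv_def by (metis of_nat_add)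
  ultimately show ?thesis unfolding hminus_def sp by simp
qed

lemma bond_equiv_hplus:
  assumes "bond_equiv j \<eta> \<eta>'" "Suc j \<le> M" "i \<noteq> Suc j"
  shows "hplus M \<rho> k \<eta>' i = hplus M \<rho> k \<eta> i"
proof (cases "Suc j < i")
  case True
  then show ?thesis using assms unfolding hplus_def bond_equiv_def
    by (intro arg_cong2 [where f = "(+)"] sum.cong refl) auto
next
  case False
  then have "i \<le> j" using assms by simp
  then have "Suc j \<in> {i..M}" "j \<in> {i..M}" using assms by auto
  then have sp: "(\<Sum>i=i..M. f i) = f j + f (Suc j) + (\<Sum>i\<in>{i..M} - {j} - {Suc j}. f i)" for f :: "nat \<Rightarrow> real"
    by (intro sum_remove_two) auto
  have "(\<Sum>i\<in>{i..M} - {j} - {Suc j}. 2 * real (\<eta>' i) + k i) = (\<Sum>i\<in>{i..M} - {j} - {Suc j}. 2 * real (\<eta> i) + k i)"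
    using assms unfolding bond_equiv_def by (intro sum.cong) auto
  moreover have "real (\<eta>' j) + real (\<eta>' (Suc j)) = real (\<eta> j) + real (\<eta> (Suc j))"
    using assms unfolding bond_equiv_def by (metis of_nat_add)
  ultimately show ?thesis unfolding hplus_def sp by simp
qed

definition P_J_product :: "nat \<Rightarrow> real \<Rightarrow> (nat \<Rightarrow> real) \<Rightarrow> real \<Rightarrow> real \<Rightarrow> config \<Rightarrow> config \<Rightarrow> real" where
  "P_J_product M q k \<rho> v \<eta> \<xi> =
     (\<Prod>j=1..M. p_J (\<eta> j) (\<xi> j) (hminus0 k \<eta> (j - 1)) (hplus M \<rho> k \<xi> (j + 1)) v (k j) q)"

text \<open>The factor R depends on the base configurations only, not on the jumped ones; this
  allows it to be pulled out of the difference quotients on both sides.\<close>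

lemma P_J_product_bond:
  assumes j: "1 \<le> j" "Suc j \<le> M"
  obtains R where "\<And>\<eta>' \<xi>'. bond_equiv j \<eta> \<eta>' \<Longrightarrow> bond_equiv j \<xi> \<xi>' \<Longrightarrow>
    P_J_product M q k \<rho> v \<eta>' \<xi>' = R * p_J_pair q v (hminus0 k \<eta> (j - 1)) (k j) (k (Suc j))
      (hplus M \<rho> k \<xi> (Suc (Suc j))) (\<eta>' j) (\<eta>' (Suc j)) (\<xi>' j) (\<xi>' (Suc j))"
proof -
  define f where "f = (\<lambda>\<eta> \<xi> i. p_J (\<eta> i) (\<xi> i) (hminus0 k \<eta> (i - 1)) (hplus M \<rho> k \<xi> (i + 1)) v (k i) q)"
  have in12: "Suc j \<in> {1..M}" "j \<in> {1..M}" using j by auto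
  have sp: "(\<Prod>i=1..M. g i) = (\<Prod>i\<in>{1..M} - {j} - {Suc j}. g i) * (g j * g (Suc j))" for g :: "nat \<Rightarrow> real"
    using in12 by (intro prod_remove_two) auto
  show ?thesis
  proof (rule that [of "\<Prod>i\<in>{1..M} - {j} - {Suc j}. f \<eta> \<xi> i"])
    fix \<eta>' \<xi>' assume eq: "bond_equiv j \<eta> \<eta>'" "bond_equiv j \<xi> \<xi>'"
    have "f \<eta>' \<xi>' i = f \<eta> \<xi> i" if "i \<in> {1..M} - {j} - {Suc j}" for i
    proof -
      have "\<eta>' i = \<eta> i" "\<xi>' i = \<xi> i" using eq that unfolding bond_equiv_def by auto
      moreover have "i - 1 \<noteq> j" "i + 1 \<noteq> Suc j" using that by auto
      ultimately show ?thesis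
        using bond_equiv_hminus [OF eq(1) j(1)] bond_equiv_hplus [OF eq(2) j(2)] unfolding f_def by simp
    qed
    moreover have "hminus0 k \<eta>' (j - 1) = hminus0 k \<eta> (j - 1)"
      using bond_equiv_hminus [OF eq(1) j(1)] j by simp
    moreover have "hminus0 k \<eta>' j = hminus0 k \<eta>' (j - 1) + 2 * real (\<eta>' j) + k j"
      using hminus_Suc [of 0 k \<eta>' "j - 1"] j by simp
    moreover have "hplus M \<rho> k \<xi>' (Suc j) = hplus M \<rho> k \<xi>' (Suc (Suc j)) + 2 * real (\<xi>' (Suc j)) + k (Suc j)"
      by (rule hplus_Suc) (use j in simp)
    moreover have "hplus M \<rho> k \<xi>' (Suc (Suc j)) = hplus M \<rho> k \<xi> (Suc (Suc j))"
      using bond_equiv_hplus [OF eq(2) j(2)] by simp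
    ultimately show "P_J_product M q k \<rho> v \<eta>' \<xi>' = (\<Prod>i\<in>{1..M} - {j} - {Suc j}. f \<eta> \<xi> i) * p_J_pair q v (hminus0 k \<eta> (j - 1)) (k j) (k (Suc j))
      (hplus M \<rho> k \<xi> (Suc (Suc j))) (\<eta>' j) (\<eta>' (Suc j)) (\<xi>' j) (\<xi>' (Suc j))"
      unfolding P_J_product_def sp p_J_pair_def by (simp add: f_def)
  qed
qed

lemma bond_equiv_refl: "bond_equiv j \<eta> \<eta>"
  by (simp add: bond_equiv_def)

lemma bond_equiv_move:
  "bond_equiv j \<eta> (move \<eta> j (Suc j))" "bond_equiv j \<eta> (move \<eta> (Suc j) j)"
  by (auto simp: bond_equiv_def move_def)

text \<open>The state space keeps the denominators of the active rates away from 0. For \<rho> > -1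
  all heights are at least \<rho>, and a particle at site j + 1 lifts its height above 1. Otherwise
  all heights are negative, and a particle at site j pushes the next height below -2.\<close>

lemma ASIP_R_space_hplus:
  assumes \<xi>: "\<xi> \<in> ASIP_R_space M k \<rho>" and k: "\<forall>j\<in>{1..M}. k j > 0" and j: "1 \<le> j" "Suc j \<le> M"
  shows "\<xi> j > 0 \<Longrightarrow> hplus M \<rho> k \<xi> (Suc j) + 1 \<noteq> 0"
    and "\<xi> (Suc j) > 0 \<Longrightarrow> hplus M \<rho> k \<xi> (Suc j) \<noteq> 0 \<and> hplus M \<rho> k \<xi> (Suc j) - 1 \<noteq> 0"
proof -
  have nn: "0 \<le> (\<Sum>i=a..M. 2 * real (\<xi> i) + k i)" if "a \<ge> 1" for a
  proof (rule sum_nonneg)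
    fix i assume "i \<in> {a..M}"
    then have "k i > 0" using k that by auto
    then show "0 \<le> 2 * real (\<xi> i) + k i" by simp
  qed
  have kj: "k j > 0" "k (Suc j) > 0" using k j by auto
  have s: "hplus M \<rho> k \<xi> (Suc j) = hplus M \<rho> k \<xi> (Suc (Suc j)) + 2 * real (\<xi> (Suc j)) + k (Suc j)"
    by (rule hplus_Suc) (use j in simp)
  have s': "hplus M \<rho> k \<xi> j = hplus M \<rho> k \<xi> (Suc j) + 2 * real (\<xi> j) + k j"
    by (rule hplus_Suc) (use j in simp)
  have "(\<xi> j > 0 \<longrightarrow> hplus M \<rho> k \<xi> (Suc j) + 1 \<noteq> 0) \<and>
     (\<xi> (Suc j) > 0 \<longrightarrow> hplus M \<rho> k \<xi> (Suc j) \<noteq> 0 \<and> hplus M \<rho> k \<xi> (Suc j) - 1 \<noteq> 0)"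
  proof (cases "\<rho> > -1")
    case True
    have "hplus M \<rho> k \<xi> (Suc j) \<ge> \<rho>" "hplus M \<rho> k \<xi> (Suc (Suc j)) \<ge> \<rho>"
      using nn by (simp_all add: hplus_def)
    then show ?thesis using True s kj by auto
  next
    case False
    then have "2 * real (\<Sum>j=1..M. \<xi> j) + (\<Sum>j=1..M. k j) + \<rho> < 0"
      using \<xi> by (simp add: ASIP_R_space_def)
    then have "hplus M \<rho> k \<xi> 1 < 0"
      by (simp add: hplus_def sum.distrib sum_distrib_left)
    moreover have "hplus M \<rho> k \<xi> j \<le> hplus M \<rho> k \<xi> 1"
      unfolding hplus_def
    proof (intro add_left_mono sum_mono2)
      fix i assume "i \<in> {1..M} - {j..M}"
      then have "k i > 0" using k by auto
      then show "0 \<le> 2 * real (\<xi> i) + k i" by simp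
    qed (use j in auto)
    ultimately show ?thesis using s' kj by auto
  qed
  then show "\<xi> j > 0 \<Longrightarrow> hplus M \<rho> k \<xi> (Suc j) + 1 \<noteq> 0"
    and "\<xi> (Suc j) > 0 \<Longrightarrow> hplus M \<rho> k \<xi> (Suc j) \<noteq> 0 \<and> hplus M \<rho> k \<xi> (Suc j) - 1 \<noteq> 0" by auto
qed

lemma P_J_product_duality:
  assumes q: "0 < q" "q < 1" and k: "\<forall>j\<in>{1..M}. k j > 0" and v: "v \<noteq> 0"
    and \<xi>: "\<xi> \<in> ASIP_R_space M k \<rho>"
  shows "ASIP M q k (\<lambda>\<eta>'. P_J_product M q k \<rho> v \<eta>' \<xi>) \<eta> = ASIP_R M q k \<rho> (P_J_product M q k \<rho> v \<eta>) \<xi>"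
  unfolding ASIP_def ASIP_R_def
proof (rule sum.cong [OF refl])
  fix j assume "j \<in> {1..<M}"
  then have j: "1 \<le> j" "Suc j \<le> M" by auto
  obtain R where R: "\<And>\<eta>' \<xi>'. bond_equiv j \<eta> \<eta>' \<Longrightarrow> bond_equiv j \<xi> \<xi>' \<Longrightarrow>
    P_J_product M q k \<rho> v \<eta>' \<xi>' = R * p_J_pair q v (hminus0 k \<eta> (j - 1)) (k j) (k (Suc j))
      (hplus M \<rho> k \<xi> (Suc (Suc j))) (\<eta>' j) (\<eta>' (Suc j)) (\<xi>' j) (\<xi>' (Suc j))"
    using P_J_product_bond [OF j] by metis
  define h where "h = hplus M \<rho> k \<xi> (Suc (Suc j))"
  define F where "F = p_J_pair q v (hminus0 k \<eta> (j - 1)) (k j) (k (Suc j)) h"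
  note R = R [folded h_def, folded F_def]
  have kj: "k j > 0" "k (Suc j) > 0" using k j by auto
  have h1: "hplus M \<rho> k \<xi> (Suc j) = h + 2 * real (\<xi> (Suc j)) + k (Suc j)"
    unfolding h_def by (rule hplus_Suc) (use j in simp)
  have h0: "hplus M \<rho> k \<xi> j = h + 2 * real (\<xi> (Suc j)) + k (Suc j) + 2 * real (\<xi> j) + k j"
    unfolding h1 [symmetric] by (rule hplus_Suc) (use j in simp)
  let ?P = "P_J_product M q k \<rho> v"
  have P0: "?P \<eta> \<xi> = R * F (\<eta> j) (\<eta> (Suc j)) (\<xi> j) (\<xi> (Suc j))"
    by (intro R bond_equiv_refl)
  have 1: "asip_right_rate q k \<eta> j * (?P (move \<eta> j (j + 1)) \<xi> - ?P \<eta> \<xi>)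
    = R * (q powr (real (\<eta> j) + k j - real (\<eta> (Suc j)) - 1) * qnum q (real (\<eta> j)) * qnum q (real (\<eta> (Suc j)) + k (Suc j))
        * (F (\<eta> j - 1) (\<eta> (Suc j) + 1) (\<xi> j) (\<xi> (Suc j)) - F (\<eta> j) (\<eta> (Suc j)) (\<xi> j) (\<xi> (Suc j))))"
  proof (cases "\<eta> j = 0")
    case False
    have "?P (move \<eta> j (Suc j)) \<xi> = R * F (\<eta> j - 1) (\<eta> (Suc j) + 1) (\<xi> j) (\<xi> (Suc j))"
      using R [OF bond_equiv_move(1) bond_equiv_refl] False by (simp add: move_def)
    then show ?thesis by (simp add: P0 asip_right_rate_def algebra_simps)
  qed (simp add: asip_right_rate_def)
  have 2: "asip_left_rate q k \<eta> (j + 1) * (?P (move \<eta> (j + 1) j) \<xi> - ?P \<eta> \<xi>)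
    = R * (q powr (- (real (\<eta> (Suc j)) + k (Suc j) - real (\<eta> j) - 1)) * qnum q (real (\<eta> (Suc j))) * qnum q (real (\<eta> j) + k j)
        * (F (\<eta> j + 1) (\<eta> (Suc j) - 1) (\<xi> j) (\<xi> (Suc j)) - F (\<eta> j) (\<eta> (Suc j)) (\<xi> j) (\<xi> (Suc j))))"
  proof (cases "\<eta> (Suc j) = 0")
    case False
    have "?P (move \<eta> (Suc j) j) \<xi> = R * F (\<eta> j + 1) (\<eta> (Suc j) - 1) (\<xi> j) (\<xi> (Suc j))"
      using R [OF bond_equiv_move(2) bond_equiv_refl] False by (simp add: move_def)
    then show ?thesis by (simp add: P0 asip_left_rate_def algebra_simps)
  qed (simp add: asip_left_rate_def)
  have 3: "asipR_right_rate M q k \<rho> \<xi> j * (?P \<eta> (move \<xi> j (j + 1)) - ?P \<eta> \<xi>)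
    = R * (pair_right_rate q (k j) (k (Suc j)) h (\<xi> j) (\<xi> (Suc j))
        * (F (\<eta> j) (\<eta> (Suc j)) (\<xi> j - 1) (\<xi> (Suc j) + 1) - F (\<eta> j) (\<eta> (Suc j)) (\<xi> j) (\<xi> (Suc j))))"
  proof (cases "\<xi> j = 0")
    case False
    have "?P \<eta> (move \<xi> j (Suc j)) = R * F (\<eta> j) (\<eta> (Suc j)) (\<xi> j - 1) (\<xi> (Suc j) + 1)"
      using R [OF bond_equiv_refl bond_equiv_move(1)] False by (simp add: move_def)
    moreover have "asipR_right_rate M q k \<rho> \<xi> j = pair_right_rate q (k j) (k (Suc j)) h (\<xi> j) (\<xi> (Suc j))"
    proof -
      have E: "hplus M \<rho> k \<xi> j - real (\<xi> j) = h + 2 * real (\<xi> (Suc j)) + k (Suc j) + real (\<xi> j) + k j"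
        "hplus M \<rho> k \<xi> (Suc j) - real (\<xi> (Suc j)) = h + real (\<xi> (Suc j)) + k (Suc j)"
        unfolding h0 h1 by simp_all
      show ?thesis
        unfolding asipR_right_rate_def pair_right_rate_def Let_def Suc_eq_plus1 [symmetric] E unfolding h1 ..
    qed
    ultimately show ?thesis by (simp add: P0 algebra_simps)
  qed (simp add: asipR_right_rate_def pair_right_rate_def)
  have 4: "asipR_left_rate M q k \<rho> \<xi> (j + 1) * (?P \<eta> (move \<xi> (j + 1) j) - ?P \<eta> \<xi>)
    = R * (pair_left_rate q (k j) (k (Suc j)) h (\<xi> j) (\<xi> (Suc j))
        * (F (\<eta> j) (\<eta> (Suc j)) (\<xi> j + 1) (\<xi> (Suc j) - 1) - F (\<eta> j) (\<eta> (Suc j)) (\<xi> j) (\<xi> (Suc j))))"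
  proof (cases "\<xi> (Suc j) = 0")
    case False
    have "?P \<eta> (move \<xi> (Suc j) j) = R * F (\<eta> j) (\<eta> (Suc j)) (\<xi> j + 1) (\<xi> (Suc j) - 1)"
      using R [OF bond_equiv_refl bond_equiv_move(2)] False by (simp add: move_def)
    moreover have "asipR_left_rate M q k \<rho> \<xi> (j + 1) = pair_left_rate q (k j) (k (Suc j)) h (\<xi> j) (\<xi> (Suc j))"
      unfolding asipR_left_rate_def pair_left_rate_def Let_def by (simp add: h1 h_def [symmetric])
    ultimately show ?thesis by (simp add: P0 algebra_simps)
  qed (simp add: asipR_left_rate_def pair_left_rate_def)
  show "asip_right_rate q k \<eta> j * (?P (move \<eta> j (j + 1)) \<xi> - ?P \<eta> \<xi>)
      + asip_left_rate q k \<eta> (j + 1) * (?P (move \<eta> (j + 1) j) \<xi> - ?P \<eta> \<xi>)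
    = asipR_right_rate M q k \<rho> \<xi> j * (?P \<eta> (move \<xi> j (j + 1)) - ?P \<eta> \<xi>)
      + asipR_left_rate M q k \<rho> \<xi> (j + 1) * (?P \<eta> (move \<xi> (j + 1) j) - ?P \<eta> \<xi>)"
    unfolding 1 2 3 4 distrib_left [symmetric] unfolding F_def
    by (intro arg_cong [where f = "(*) R"] p_J_pair_duality q v kj)
      (use ASIP_R_space_hplus [OF \<xi> k j] in \<open>auto simp: h1\<close>)
qed

subsection \<open>The limits\<close>

lemma powr_mult_powr: "(q::real) powr a * q powr b = q powr (a + b)"
  by (simp add: powr_add)

text \<open>The factor q^l in v exactly cancels the dependence of w on l, while C and z decay like
  q^(2 l); what remains is \<open>bigAW_0\<close>.\<close>

lemma p_AW_tendsto_p_J: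
  assumes q: "0 < q" "q < 1" and v: "v \<noteq> 0"
  shows "((\<lambda>l. p_AW y x (l + h) r (v * q powr l) k q) \<longlongrightarrow> p_J y x h r v k q) at_top"
proof -
  have vl: "v * q powr l \<noteq> 0" for l using q v by simp
  have C: "q powr (2 * real y + 2 * (l + h) + 2 * k) = q powr (2 * l + (2 * real y + 2 * h + 2 * k))" for l
    by (simp add: algebra_simps)
  have w: "v * q powr l * q powr (- r - (l + h) - k - 1) = v * q powr (- h - r - k - 1)"
    and z: "v * q powr l * q powr (r + (l + h) + k + 1) = v * q powr (2 * l + (r + h + k + 1))" for l
    unfolding mult.assoc powr_mult_powr by (rule arg_cong [where f = "\<lambda>t. v * q powr t"], simp)+
  have lim: "((\<lambda>l. q powr (2 * l + c)) \<longlongrightarrow> 0) at_top" for c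
    by (rule powr_at_top_tendsto_0 [OF q]) simp
  show ?thesis
    unfolding p_AW_eq_bigAW [OF q(1) vl] p_J_eq_bigJ [OF q(1) v] C w z bigAW_0 [where x = x, symmetric]
    by (intro tendsto_bigAW tendsto_const tendsto_mult_right_zero lim)
qed

text \<open>B tends to infinity and w to 0 with constant product \<beta>. So the diverging (B; p)_i
  has to be paired with the i factors - w/p^m before the limit is taken, and each pair tends to
  \<beta>.\<close>

lemma p_J_tendsto_p_M:
  assumes q: "0 < q" "q < 1" and v: "v \<noteq> 0"
  shows "((\<lambda>r. p_J n x l (r + h) (v * q powr (- r)) k q) \<longlongrightarrow> p_M n x l h v k q) at_bot"
proof -
  define p where "p = q\<^sup>2"
  define \<kappa> where "\<kappa> = q powr (2 * k)"
  define A where "A = 1 / p ^ x"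
  define \<beta> where "\<beta> = v * q powr (2 * real x + h - l + k - 1)"
  define B where "B = (\<lambda>r. q powr (2 * real x + 2 * (r + h) + 2 * k))"
  define w where "w = (\<lambda>r. v * q powr (- 2 * r + (- l - h - k - 1)))"
  have p0: "p \<noteq> 0" using q by (simp add: p_def)
  have vr: "v * q powr (- r) \<noteq> 0" for r using q v by simp
  have wr: "v * q powr (- r) * q powr (- l - (r + h) - k - 1) = w r" for r
    unfolding w_def mult.assoc powr_mult_powr by (rule arg_cong [where f = "\<lambda>t. v * q powr t"]) simp
  have Bw: "B r * w r = \<beta>" for r
    unfolding B_def w_def \<beta>_def mult.left_commute [of _ v] powr_mult_powr
    by (rule arg_cong [where f = "\<lambda>t. v * q powr t"]) simp
  have w0: "(w \<longlongrightarrow> 0) at_bot"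
    unfolding w_def by (intro tendsto_mult_right_zero powr_at_bot_tendsto_0 q) simp
  have "bigJ p \<kappa> n A (B r) (w r) = (\<Sum>i\<le>n. qpoch A p i * qpoch (1 / p ^ n) p i / (qpoch p p i * qpoch \<kappa> p i) * p ^ i
      * ((\<Prod>m<i. \<beta> - w r / p ^ m) * (\<Prod>m=i..<n. 1 - w r / p ^ m)))" for r
    unfolding bigJ_def
  proof (rule sum.cong [OF refl])
    fix i
    have "qpoch (B r) p i * (\<Prod>m<i. - w r / p ^ m) = (\<Prod>m<i. \<beta> - w r / p ^ m)"
      unfolding qpoch_def prod.distrib [symmetric] Bw [of r, symmetric]
      by (rule prod.cong [OF refl]) (use p0 in \<open>simp add: field_simps\<close>)
    then have "qpoch (B r) p i * tail_poch p n i (w r) = (\<Prod>m<i. \<beta> - w r / p ^ m) * (\<Prod>m=i..<n. 1 - w r / p ^ m)"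
      unfolding tail_poch_def by (metis mult.assoc)
    then show "qpoch A p i * qpoch (B r) p i * qpoch (1 / p ^ n) p i / (qpoch p p i * qpoch \<kappa> p i) * p ^ i * tail_poch p n i (w r)
      = qpoch A p i * qpoch (1 / p ^ n) p i / (qpoch p p i * qpoch \<kappa> p i) * p ^ i
        * ((\<Prod>m<i. \<beta> - w r / p ^ m) * (\<Prod>m=i..<n. 1 - w r / p ^ m))"
      by (simp add: mult_ac)
  qed
  moreover have "((\<lambda>r. \<Sum>i\<le>n. qpoch A p i * qpoch (1 / p ^ n) p i / (qpoch p p i * qpoch \<kappa> p i) * p ^ i
      * ((\<Prod>m<i. \<beta> - w r / p ^ m) * (\<Prod>m=i..<n. 1 - w r / p ^ m)))
    \<longlongrightarrow> (\<Sum>i\<le>n. qpoch A p i * qpoch (1 / p ^ n) p i / (qpoch p p i * qpoch \<kappa> p i) * p ^ i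
      * ((\<Prod>m<i. \<beta> - 0 / p ^ m) * (\<Prod>m=i..<n. 1 - 0 / p ^ m)))) at_bot"
    by (intro tendsto_sum tendsto_mult_left tendsto_mult tendsto_prod tendsto_diff tendsto_const tendsto_divide w0)
      (simp_all add: p0)
  moreover have "(\<Sum>i\<le>n. qpoch A p i * qpoch (1 / p ^ n) p i / (qpoch p p i * qpoch \<kappa> p i) * p ^ i
      * ((\<Prod>m<i. \<beta> - 0 / p ^ m) * (\<Prod>m=i..<n. 1 - 0 / p ^ m))) = p_M n x l h v k q"
  proof -
    \<comment> \<open>The limit has \<beta>^i and the series its own p^i; together they give the
      argument p \<beta>, which accounts for + 1 here against - 1 in the definition of
      \<beta>.\<close>
    have "2 * real x + h - l + k + 1 = 2 * 1 + (2 * real x + h - l + k - 1)" by simp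
    then have z: "v * q powr (2 * real x + h - l + k + 1) = p * \<beta>"
      using powr_even_eq(4) [OF q(1), of 1] by (simp only: powr_add \<beta>_def p_def) simp
    show ?thesis
      unfolding p_M_def powr_even_eq [OF q(1)] z p_def [symmetric] \<kappa>_def [symmetric] A_def [symmetric]
      by (subst qhyp_finite [of "1 / p ^ n" _ _ n])
        (use p0 in \<open>auto intro!: sum.cong simp: power_mult_distrib mult_ac\<close>)
  qed
  ultimately show ?thesis
    unfolding p_J_eq_bigJ [OF q(1) vr] wr B_def [symmetric] p_def [symmetric] \<kappa>_def [symmetric] A_def [symmetric]
    using B_def by simp
qed

text \<open>With this choice w does not depend on r, and B tends to 0, which is the big q-Laguerre
  case of \<open>bigJ\<close>.\<close>

lemma p_J_tendsto_p_L:
  assumes q: "0 < q" "q < 1" and v: "v \<noteq> 0"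
  shows "((\<lambda>r. p_J n x l (r + h) (inverse v * q powr r) k q) \<longlongrightarrow> p_L n x l h v k q) at_top"
proof -
  have vr: "inverse v * q powr r \<noteq> 0" for r using q v by simp
  have B: "q powr (2 * real x + 2 * (r + h) + 2 * k) = q powr (2 * r + (2 * real x + 2 * h + 2 * k))" for r
    by (simp add: algebra_simps)
  have w: "inverse v * q powr r * q powr (- l - (r + h) - k - 1) = inverse v * q powr (- l - h - k - 1)" for r
    unfolding mult.assoc powr_mult_powr by (rule arg_cong [where f = "\<lambda>t. inverse v * q powr t"]) simp
  have lim: "((\<lambda>r. q powr (2 * r + c)) \<longlongrightarrow> 0) at_top" for c
    by (rule powr_at_top_tendsto_0 [OF q]) simp
  show ?thesis
    unfolding p_J_eq_bigJ [OF q(1) vr] p_L_eq_bigJ [OF q(1) v] B w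
    by (intro tendsto_bigJ tendsto_const lim)
qed

lemma P_AW_tendsto:
  assumes q: "0 < q" "q < 1" and v: "v \<noteq> 0"
  shows "((\<lambda>l. P_AW M q k l \<rho> (v * q powr l) \<eta> \<xi>) \<longlongrightarrow> P_J_product M q k \<rho> v \<eta> \<xi>) at_top"
  unfolding P_AW_def P_J_product_def
  by (intro tendsto_prod
      p_AW_tendsto_p_J [OF q v, where h = "hminus0 k \<eta> i" for i, unfolded hminus_eq_add [symmetric]])

lemma P_J_eq_product:
  assumes "0 < q" "q < 1" "v \<noteq> 0"
  shows "P_J M q k \<rho> v = P_J_product M q k \<rho> v"
  by (intro ext) (simp add: P_J_def tendsto_Lim [OF _ P_AW_tendsto [OF assms]])

lemma P_J_tendsto_M:
  assumes q: "0 < q" "q < 1" and v: "v \<noteq> 0"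
  shows "((\<lambda>r. P_J_product M q k r (v * q powr (- r)) \<eta> \<xi>) \<longlongrightarrow>
    (\<Prod>j=1..M. p_M (\<eta> j) (\<xi> j) (hminus0 k \<eta> (j - 1)) (hplus0 M k \<xi> (j + 1)) v (k j) q)) at_bot"
  unfolding P_J_product_def
  by (intro tendsto_prod
      p_J_tendsto_p_M [OF q v, where h = "hplus0 M k \<xi> i" for i, unfolded hplus_eq_add [symmetric]])

lemma P_J_tendsto_L:
  assumes q: "0 < q" "q < 1" and v: "v \<noteq> 0"
  shows "((\<lambda>r. P_J_product M q k r (inverse v * q powr r) \<eta> \<xi>) \<longlongrightarrow>
    (\<Prod>j=1..M. p_L (\<eta> j) (\<xi> j) (hminus0 k \<eta> (j - 1)) (hplus0 M k \<xi> (j + 1)) v (k j) q)) at_top"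
  unfolding P_J_product_def
  by (intro tendsto_prod
      p_J_tendsto_p_L [OF q v, where h = "hplus0 M k \<xi> i" for i, unfolded hplus_eq_add [symmetric]])

lemma P_M_eq:
  assumes q: "0 < q" "q < 1" and v: "v \<noteq> 0"
  shows "P_M M q k v \<eta> \<xi> =
    (\<Prod>j=1..M. p_M (\<eta> j) (\<xi> j) (hminus0 k \<eta> (j - 1)) (hplus0 M k \<xi> (j + 1)) v (k j) q)"
proof -
  have vr: "v * q powr (- r) \<noteq> 0" for r using q v by simp
  show ?thesis
    unfolding P_M_def P_J_eq_product [OF q vr]
    by (intro tendsto_Lim P_J_tendsto_M assms) simp
qed

lemma P_L_eq:
  assumes q: "0 < q" "q < 1" and v: "v \<noteq> 0"
  shows "P_L M q k v \<eta> \<xi> =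
    (\<Prod>j=1..M. p_L (\<eta> j) (\<xi> j) (hminus0 k \<eta> (j - 1)) (hplus0 M k \<xi> (j + 1)) v (k j) q)"
proof -
  have vr: "inverse v * q powr r \<noteq> 0" for r using q v by simp
  show ?thesis
    unfolding P_L_def P_J_eq_product [OF q vr]
    by (intro tendsto_Lim P_J_tendsto_L assms) simp
qed

section \<open>Limits of the rates and of the duality relation\<close>

lemma qnum_ratio_at_bot:
  assumes q: "0 < q" "q < 1"
  shows "((\<lambda>r. qnum q (r + a) / qnum q (r + b)) \<longlongrightarrow> q powr (a - b)) at_bot"
proof -
  note s = minus_inverse_neq_0 [OF q]
  have c: "qnum q (r + a) = q powr r * (q powr a - q powr (- 2 * r + (- a))) / (q - inverse q)" for r a
    by (simp add: qnum_def right_diff_distrib powr_mult_powr)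
  have e: "qnum q (r + a) / qnum q (r + b) = (q powr a - q powr (- 2 * r + (- a))) / (q powr b - q powr (- 2 * r + (- b)))" for r
    unfolding c using s q by simp
  have t: "((\<lambda>r. q powr a - q powr (- 2 * r + (- a))) \<longlongrightarrow> q powr a - 0) at_bot" for a
    by (intro tendsto_diff tendsto_const powr_at_bot_tendsto_0 q) simp
  have "((\<lambda>r. (q powr a - q powr (- 2 * r + (- a))) / (q powr b - q powr (- 2 * r + (- b)))) \<longlongrightarrow>
    (q powr a - 0) / (q powr b - 0)) at_bot"
    by (intro tendsto_divide t) (use q in simp)
  then show ?thesis unfolding e by (simp add: powr_diff)
qed

text \<open>Now q^(-r) dominates numerator and denominator instead of q^r. This is the source of the
  parameter 1/q in the third duality.\<close>

lemma qnum_ratio_at_top: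
  assumes q: "0 < q" "q < 1"
  shows "((\<lambda>r. qnum q (r + a) / qnum q (r + b)) \<longlongrightarrow> inverse q powr (a - b)) at_top"
proof -
  note s = minus_inverse_neq_0 [OF q]
  have c: "qnum q (r + a) = q powr (- r) * (q powr (2 * r + a) - q powr (- a)) / (q - inverse q)" for r a
    by (simp add: qnum_def right_diff_distrib powr_mult_powr)
  have e: "qnum q (r + a) / qnum q (r + b) = (q powr (2 * r + a) - q powr (- a)) / (q powr (2 * r + b) - q powr (- b))" for r
    unfolding c using s q by simp
  have t: "((\<lambda>r. q powr (2 * r + a) - q powr (- a)) \<longlongrightarrow> 0 - q powr (- a)) at_top" for a
    by (intro tendsto_diff tendsto_const powr_at_top_tendsto_0 q) simp
  have "((\<lambda>r. (q powr (2 * r + a) - q powr (- a)) / (q powr (2 * r + b) - q powr (- b))) \<longlongrightarrow>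
    (0 - q powr (- a)) / (0 - q powr (- b))) at_top"
    by (intro tendsto_divide t) (use q in simp)
  moreover have "(0 - q powr (- a)) / (0 - q powr (- b)) = q powr (- (a - b))"
    by (simp add: powr_diff [symmetric])
  moreover have "q powr (- (a - b)) = inverse q powr (a - b)"
    using q by (simp only: powr_minus inverse_powr)
  ultimately show ?thesis unfolding e by simp
qed

text \<open>\<open>g\<close> is \<open>q\<close> for \<open>r\<close> tending to minus infinity and \<open>1/q\<close> for plus infinity.\<close>

lemma tendsto_asipR_rates:
  assumes ratio: "\<And>a b. ((\<lambda>r. qnum q (r + a) / qnum q (r + b)) \<longlongrightarrow> g powr (a - b)) F"
    and g: "0 < g" "\<And>a. qnum g a = qnum q a" and j: "Suc j \<le> M"
  shows "((\<lambda>r. asipR_right_rate M q k r \<xi> j) \<longlongrightarrow> asip_right_rate g k \<xi> j) F"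
    and "((\<lambda>r. asipR_left_rate M q k r \<xi> (Suc j)) \<longlongrightarrow> asip_left_rate g k \<xi> (Suc j)) F"
proof -
  define x1 x2 where x: "x1 = real (\<xi> j)" "x2 = real (\<xi> (Suc j))"
  define h where "h = hplus0 M k \<xi> (Suc (Suc j))"
  have h2: "hplus M r k \<xi> (Suc (Suc j)) = r + h" for r by (simp add: h_def hplus_eq_add [of M r])
  have h1: "hplus M r k \<xi> (Suc j) = r + (h + 2 * x2 + k (Suc j))" for r
    using hplus_Suc [of "Suc j" M r k \<xi>] j by (simp add: h2 x)
  have h0: "hplus M r k \<xi> j = r + (h + 2 * x2 + k (Suc j) + 2 * x1 + k j)" for r
    using hplus_Suc [of j M r k \<xi>] j by (simp add: h1 x)
  show "((\<lambda>r. asipR_right_rate M q k r \<xi> j) \<longlongrightarrow> asip_right_rate g k \<xi> j) F"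
  proof (cases "\<xi> j = 0")
    case True
    then show ?thesis using g by (simp add: asipR_right_rate_def asip_right_rate_def)
  next
    case False
    define a where "a = h + 2 * x2 + k (Suc j) + x1 + k j"
    define b where "b = h + 2 * x2 + k (Suc j) + 1"
    define c where "c = h + x2 + k (Suc j)"
    define d where "d = h + 2 * x2 + k (Suc j)"
    have eq: "asipR_right_rate M q k r \<xi> j = qnum q x1 * qnum q (x2 + k (Suc j)) * (qnum q (r + a) / qnum q (r + b))
      * (if \<xi> (Suc j) = 0 then 1 else qnum q (r + c) / qnum q (r + d))" for r
    proof -
      have "r + (h + 2 * x2 + k (Suc j) + 2 * x1 + k j) - x1 = r + a" "r + (h + 2 * x2 + k (Suc j)) + 1 = r + b"
        "r + (h + 2 * x2 + k (Suc j)) - x2 = r + c"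
        by (simp_all add: a_def b_def c_def)
      then show ?thesis
        using False unfolding asipR_right_rate_def Let_def Suc_eq_plus1 [symmetric] h0 h1 x [symmetric] d_def
        by (simp only: if_False)
    qed
    \<comment> \<open>With site j + 1 empty the ratio is read as 1, in agreement with the limit g
      powr 0.\<close>
    have "((\<lambda>r. if \<xi> (Suc j) = 0 then 1 else qnum q (r + c) / qnum q (r + d)) \<longlongrightarrow> g powr (- x2)) F"
    proof (cases "\<xi> (Suc j) = 0")
      case True
      then show ?thesis using g by (simp add: x)
    next
      case False
      then show ?thesis using ratio [of c d] by (simp add: c_def d_def)
    qed
    then have "((\<lambda>r. asipR_right_rate M q k r \<xi> j) \<longlongrightarrow> qnum q x1 * qnum q (x2 + k (Suc j)) * g powr (a - b) * g powr (- x2)) F"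
      unfolding eq by (intro tendsto_mult tendsto_const ratio)
    moreover have E: "a - b + - x2 = x1 + k j - x2 - 1" by (simp add: a_def b_def)
    have "qnum q x1 * qnum q (x2 + k (Suc j)) * g powr (a - b) * g powr (- x2) = asip_right_rate g k \<xi> j"
      unfolding asip_right_rate_def g(2) mult.assoc powr_mult_powr E unfolding x by (simp add: mult_ac)
    ultimately show ?thesis by simp
  qed
  show "((\<lambda>r. asipR_left_rate M q k r \<xi> (Suc j)) \<longlongrightarrow> asip_left_rate g k \<xi> (Suc j)) F"
  proof (cases "\<xi> (Suc j) = 0")
    case True
    then show ?thesis using g by (simp add: asipR_left_rate_def asip_left_rate_def)
  next
    case False
    define a where "a = h + 2 * x2 + k (Suc j) + x1"
    define b where "b = h + 2 * x2 + k (Suc j) - 1"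
    define c where "c = h + x2"
    define d where "d = h + 2 * x2 + k (Suc j)"
    have eq: "asipR_left_rate M q k r \<xi> (Suc j) = qnum q x2 * qnum q (x1 + k j) * (qnum q (r + a) / qnum q (r + b))
      * (qnum q (r + c) / qnum q (r + d))" for r
    proof -
      have "r + (h + 2 * x2 + k (Suc j)) + x1 = r + a" "r + (h + 2 * x2 + k (Suc j)) - 1 = r + b"
        "r + h + x2 = r + c" "r + (h + 2 * x2 + k (Suc j)) = r + d"
        by (simp_all add: a_def b_def c_def d_def)
      then have "asipR_left_rate M q k r \<xi> (Suc j) = qnum q x2 * qnum q (x1 + k j) * (qnum q (r + a) * qnum q (r + c))
          / (qnum q (r + d) * qnum q (r + b))"
        using False unfolding asipR_left_rate_def Let_def Suc_eq_plus1 [symmetric] diff_Suc_1 h1 h2 x [symmetric]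
        by (simp only: if_False)
      then show ?thesis by (simp add: mult_ac)
    qed
    have "((\<lambda>r. asipR_left_rate M q k r \<xi> (Suc j)) \<longlongrightarrow> qnum q x2 * qnum q (x1 + k j) * g powr (a - b) * g powr (c - d)) F"
      unfolding eq by (intro tendsto_mult tendsto_const ratio)
    moreover have E: "a - b + (c - d) = - (x2 + k (Suc j) - x1 - 1)" by (simp add: a_def b_def c_def d_def)
    have "qnum q x2 * qnum q (x1 + k j) * g powr (a - b) * g powr (c - d) = asip_left_rate g k \<xi> (Suc j)"
      unfolding asip_left_rate_def g(2) mult.assoc powr_mult_powr E unfolding x by (simp add: mult_ac)
    ultimately show ?thesis by simp
  qed
qed

text \<open>The state space moves with r, so the duality at finite r is available only eventually.
  That suffices for equating the limits of both sides; the left generator does not involve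
  r.\<close>

lemma limit_duality:
  assumes q: "0 < q" "q < 1" and k: "\<forall>j\<in>{1..M}. k j > 0" and F: "F \<noteq> bot"
    and ratio: "\<And>a b. ((\<lambda>r. qnum q (r + a) / qnum q (r + b)) \<longlongrightarrow> g powr (a - b)) F"
    and g: "0 < g" "\<And>a. qnum g a = qnum q a"
    and u: "\<And>r. u r \<noteq> 0" and space: "\<forall>\<^sub>F r in F. \<xi> \<in> ASIP_R_space M k r"
    and D: "\<And>\<eta> \<xi>. ((\<lambda>r. P_J_product M q k r (u r) \<eta> \<xi>) \<longlongrightarrow> D \<eta> \<xi>) F"
  shows "ASIP M q k (\<lambda>\<eta>'. D \<eta>' \<xi>) \<eta> = ASIP M g k (D \<eta>) \<xi>"
proof (rule tendsto_unique [OF F])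
  show "((\<lambda>r. ASIP M q k (\<lambda>\<eta>'. P_J_product M q k r (u r) \<eta>' \<xi>) \<eta>) \<longlongrightarrow> ASIP M q k (\<lambda>\<eta>'. D \<eta>' \<xi>) \<eta>) F"
    unfolding ASIP_def by (intro tendsto_sum tendsto_add tendsto_mult_left tendsto_diff D)
  have "((\<lambda>r. ASIP_R M q k r (P_J_product M q k r (u r) \<eta>) \<xi>) \<longlongrightarrow> ASIP M g k (D \<eta>) \<xi>) F"
    unfolding ASIP_def ASIP_R_def Suc_eq_plus1 [symmetric]
    by (intro tendsto_sum tendsto_add tendsto_mult tendsto_diff D tendsto_asipR_rates ratio g) auto
  then show "((\<lambda>r. ASIP M q k (\<lambda>\<eta>'. P_J_product M q k r (u r) \<eta>' \<xi>) \<eta>) \<longlongrightarrow> ASIP M g k (D \<eta>) \<xi>) F"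
  proof (rule Lim_transform_eventually)
    show "\<forall>\<^sub>F r in F. ASIP_R M q k r (P_J_product M q k r (u r) \<eta>) \<xi>
        = ASIP M q k (\<lambda>\<eta>'. P_J_product M q k r (u r) \<eta>' \<xi>) \<eta>"
      using space by eventually_elim (simp add: P_J_product_duality [OF q k u])
  qed
qed

theorem proposition3p1:
  fixes M :: nat and q v \<rho> :: real and k :: "nat \<Rightarrow> real"
  assumes "0 < q" and "q < 1"
    and "M \<ge> 1"
    and "\<forall>j\<in>{1..M}. k j > 0"
    and "v \<noteq> 0"
  shows
    "((\<forall>\<eta>\<in>Xd M. \<forall>\<xi>\<in>Xd M.
         ((\<lambda>l. P_AW M q k l \<rho> (v * q powr l) \<eta> \<xi>) \<longlongrightarrow> P_J M q k \<rho> v \<eta> \<xi>) at_top)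
      \<and> duality_function (Xd M) (ASIP M q k) (ASIP_R_space M k \<rho>) (ASIP_R M q k \<rho>)
          (P_J M q k \<rho> v)
      \<and> (\<forall>\<eta>\<in>Xd M. \<forall>\<xi>\<in>Xd M.
           P_J M q k \<rho> v \<eta> \<xi> =
             (\<Prod>j=1..M. p_J (\<eta> j) (\<xi> j) (hminus0 k \<eta> (j - 1)) (hplus M \<rho> k \<xi> (j + 1)) v (k j) q)))
   \<and> ((\<forall>\<eta>\<in>Xd M. \<forall>\<xi>\<in>Xd M.
         ((\<lambda>r. P_J M q k r (v * q powr (- r)) \<eta> \<xi>) \<longlongrightarrow> P_M M q k v \<eta> \<xi>) at_bot)
      \<and> self_duality_function (Xd M) (ASIP M q k) (P_M M q k v)
      \<and> (\<forall>\<eta>\<in>Xd M. \<forall>\<xi>\<in>Xd M.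
           P_M M q k v \<eta> \<xi> =
             (\<Prod>j=1..M. p_M (\<eta> j) (\<xi> j) (hminus0 k \<eta> (j - 1)) (hplus0 M k \<xi> (j + 1)) v (k j) q)))
   \<and> ((\<forall>\<eta>\<in>Xd M. \<forall>\<xi>\<in>Xd M.
         ((\<lambda>r. P_J M q k r (inverse v * q powr r) \<eta> \<xi>) \<longlongrightarrow> P_L M q k v \<eta> \<xi>) at_top)
      \<and> duality_function (Xd M) (ASIP M q k) (Xd M) (ASIP M (inverse q) k) (P_L M q k v)
      \<and> (\<forall>\<eta>\<in>Xd M. \<forall>\<xi>\<in>Xd M.
           P_L M q k v \<eta> \<xi> =
             (\<Prod>j=1..M. p_L (\<eta> j) (\<xi> j) (hminus0 k \<eta> (j - 1)) (hplus0 M k \<xi> (j + 1)) v (k j) q)))"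
proof -
  note q = assms(1,2) and k = assms(4) and v = assms(5)
  have vM: "v * q powr (- r) \<noteq> 0" and vL: "inverse v * q powr r \<noteq> 0" for r using q v by simp_all
  note J = P_J_eq_product [OF q v] and JM = P_J_eq_product [OF q vM] and JL = P_J_eq_product [OF q vL]
  have M_tendsto: "((\<lambda>r. P_J_product M q k r (v * q powr (- r)) \<eta> \<xi>) \<longlongrightarrow> P_M M q k v \<eta> \<xi>) at_bot" for \<eta> \<xi>
    unfolding P_M_eq [OF q v] by (rule P_J_tendsto_M [OF q v])
  have L_tendsto: "((\<lambda>r. P_J_product M q k r (inverse v * q powr r) \<eta> \<xi>) \<longlongrightarrow> P_L M q k v \<eta> \<xi>) at_top" for \<eta> \<xi>
    unfolding P_L_eq [OF q v] by (rule P_J_tendsto_L [OF q v])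
  have J_duality: "duality_function (Xd M) (ASIP M q k) (ASIP_R_space M k \<rho>) (ASIP_R M q k \<rho>) (P_J M q k \<rho> v)"
    unfolding duality_function_def J by (intro ballI P_J_product_duality [OF q k v])
  have M_duality: "self_duality_function (Xd M) (ASIP M q k) (P_M M q k v)"
    unfolding duality_function_def
  proof (intro ballI)
    fix \<eta> \<xi> assume \<xi>: "\<xi> \<in> Xd M"
    show "ASIP M q k (\<lambda>\<eta>'. P_M M q k v \<eta>' \<xi>) \<eta> = ASIP M q k (P_M M q k v \<eta>) \<xi>"
    proof (rule limit_duality [OF q k _ qnum_ratio_at_bot [OF q] q(1) refl vM _ M_tendsto])
      \<comment> \<open>Below this bound the negative branch of the state space applies and contains
        \<xi>.\<close>
      have "\<forall>\<^sub>F r in at_bot. r < min (-1) (- (2 * real (\<Sum>j=1..M. \<xi> j) + (\<Sum>j=1..M. k j)))"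
        by (rule eventually_gt_at_bot)
      then show "\<forall>\<^sub>F r in at_bot. \<xi> \<in> ASIP_R_space M k r"
        by eventually_elim (use \<xi> in \<open>auto simp: ASIP_R_space_def\<close>)
    qed simp
  qed
  have L_duality: "duality_function (Xd M) (ASIP M q k) (Xd M) (ASIP M (inverse q) k) (P_L M q k v)"
    unfolding duality_function_def
  proof (intro ballI)
    fix \<eta> \<xi> assume \<xi>: "\<xi> \<in> Xd M"
    show "ASIP M q k (\<lambda>\<eta>'. P_L M q k v \<eta>' \<xi>) \<eta> = ASIP M (inverse q) k (P_L M q k v \<eta>) \<xi>"
    proof (rule limit_duality [OF q k _ qnum_ratio_at_top [OF q] _ qnum_inverse [OF q(1)] vL _ L_tendsto])
      have "\<forall>\<^sub>F r in at_top. r > (-1 :: real)"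
        by (rule eventually_gt_at_top)
      then show "\<forall>\<^sub>F r in at_top. \<xi> \<in> ASIP_R_space M k r"
        by eventually_elim (use \<xi> in \<open>auto simp: ASIP_R_space_def\<close>)
    qed (use q in simp_all)
  qed
  show ?thesis
    using P_AW_tendsto [OF q v] M_tendsto L_tendsto J_duality M_duality L_duality P_M_eq [OF q v] P_L_eq [OF q v]
    by (simp add: J JM JL P_J_product_def)
qed

end
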